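(* Let $n\ge 1$ and let $\mathbb A=(a_{kj}^{\alpha\beta})$ be a constant real tensor satisfying the symmetry and relaxed ellipticity conditions stated in the context, with ellipticity constant $C_{\mathbb A}>0$. (i) Let $s\in\mathbb R$. For any $(\mathbf f,g)\in\dot{\mathbf H}_\#^{s-2}\times\dot H_\#^{s-1}$, the anisotropic Stokes system $$-\boldsymbol{\mathcal L}(\mathbf u,p)=\mathbf f,\qquad \operatorname{div}\mathbf u=g$$ on the torus $\mathbb T$ (understood in the sense of distributions) has a unique solution $(\mathbf u,p)\in\dot{\mathbf H}_\#^{s}\times\dot H_\#^{s-1}$, where $$\mathbf u(\mathbf x)=\sum_{\boldsymbol\xi\in\mathbb Z^n\setminus\{\mathbf 0\}}e^{2\pi i\mathbf x\cdot\boldsymbol\xi}\,\widehat{\mathbf u}(\boldsymbol\xi),\qquad p(\mathbf x)=\sum_{\boldsymbol\xi\in\mathbb Z^n\setminus\{\mathbf 0\}}e^{2\pi i\mathbf x\cdot\boldsymbol\xi}\,\hat p(\boldsymbol\xi),$$ with $$\begin{pmatrix}\widehat{\mathbf u}(\boldsymbol\xi)\\ \hat p(\boldsymbol\xi)\end{pmatrix}=\mathfrak S^{-1}(\boldsymbol\xi)\begin{pmatrix}\widehat{\mathbf f}(\boldsymbol\xi)\\ \hat g(\boldsymbol\xi)\end{pmatrix}\qquad\forall\,\boldsymbol\xi\in\mathbb Z^n\setminus\{\mathbf 0\},$$ the matrix $\mathfrak S(\boldsymbol\xi)$ being defined in the context. In addition, there exists a constant $C=C(C_{\mathbb A},n)>0$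 such that $$\|\mathbf u\|_{\dot{\mathbf H}_\#^{s}}+\|p\|_{\dot H_\#^{s-1}}\le C\left(\|\mathbf f\|_{\dot{\mathbf H}_\#^{s-2}}+\|g\|_{\dot H_\#^{s-1}}\right),$$ and the linear operator $$S:\dot{\mathbf H}_\#^{s}\times\dot H_\#^{s-1}\to\dot{\mathbf H}_\#^{s-2}\times\dot H_\#^{s-1},\qquad S(\mathbf u,p):=\left(-\boldsymbol{\mathcal L}(\mathbf u,p),\ \operatorname{div}\mathbf u\right),$$ is an isomorphism. (ii) Moreover, if $(\mathbf f,g)\in(\dot{\mathcal C}_\#^\infty)^n\times\dot{\mathcal C}_\#^\infty$, then $(\mathbf u,p)\in(\dot{\mathcal C}_\#^\infty)^n\times\dot{\mathcal C}_\#^\infty$.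
   Context: Summation over repeated indices from $1$ to $n$ is used. Function spaces. $\mathbb T=[0,1)^n$ is the $n$-dimensional flat torus; functions and distributions on $\mathbb T$ (real- or complex-valued) are identified with $1$-periodic ones on $\mathbb R^n$. $\mathcal C_\#^\infty$ is the space of $1$-periodic $C^\infty$ functions; $\mathcal D'_\#$ is its dual (periodic distributions), with duality pairing $\langle\cdot,\cdot\rangle_{\mathbb T}$. Fourier coefficients: $\hat g(\boldsymbol\xi)=\int_{\mathbb T}e^{-2\pi i\mathbf x\cdot\boldsymbol\xi}g(\mathbf x)\,d\mathbf x$, $\boldsymbol\xi\in\mathbb Z^n$, extended to $g\in\mathcal D'_\#$. Let $|\boldsymbol\xi|$ be the Euclidean norm and $\rho(\boldsymbol\xi)=(1+|\boldsymbol\xi|^2)^{1/2}$. For $s\in\mathbb R$, $H_\#^s$ is the space of $g\in\mathcal D'_\#$ with finite norm $\|g\|_{H_\#^s}=\big(\sum_{\boldsymbol\xi\in\mathbb Z^n}\rho(\boldsymbol\xi)^{2s}|\hat g(\boldsymbol\xi)|^2\big)^{1/2}$. The dotted spaces are the zero-mean subspaces $\dot H_\#^s=\{g\in H_\#^s:\langle g,1\rangle_{\mathbb T}=0\}$ (with the same norm) and $\dot{\mathcal C}_\#^\infty=\{g\in\mathcal C_\#^\infty:\langle g,1\rangle_{\mathbb T}=0\}$. Bold letters denote spaces of $n$-component vectors: $\mathbf H_\#^s=(H_\#^s)^n$, $\dot{\mathbf H}_\#^s=(\dot H_\#^s)^n$. Series converge in the norms of these spaces. Viscosity tensor. $\mathbb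 A=(a_{kj}^{\alpha\beta})_{1\le k,j,\alpha,\beta\le n}$ has constant real components, with symmetries $a_{kj}^{\alpha\beta}=a_{\alpha j}^{k\beta}=a_{k\beta}^{\alpha j}$, and satisfies the relaxed ellipticity condition: there is a constant $C_{\mathbb A}>0$ such that $a_{kj}^{\alpha\beta}\zeta_{k\alpha}\zeta_{j\beta}\ge C_{\mathbb A}^{-1}|\boldsymbol\zeta|^2$ for all real $n\times n$ matrices $\boldsymbol\zeta=(\zeta_{k\alpha})$ with $\boldsymbol\zeta=\boldsymbol\zeta^\top$ and $\sum_{k=1}^n\zeta_{kk}=0$, where $|\boldsymbol\zeta|^2=\zeta_{k\alpha}\zeta_{k\alpha}$. Stokes operator. $(\boldsymbol{\mathfrak L}\mathbf u)_k=\partial_\alpha\big(a_{kj}^{\alpha\beta}E_{j\beta}(\mathbf u)\big)=\partial_\alpha\big(a_{kj}^{\alpha\beta}\partial_\beta u_j\big)$, $k=1,\dots,n$, where $E_{j\beta}(\mathbf u)=\frac12(\partial_ju_\beta+\partial_\beta u_j)$, and $\boldsymbol{\mathcal L}(\mathbf u,p)=\boldsymbol{\mathfrak L}\mathbf u-\nabla p$. Symbol matrix. For $\boldsymbol\xi\in\mathbb Z^n\setminus\{\mathbf 0\}$, $\mathfrak S(\boldsymbol\xi)$ is the (non-singular) $(n+1)\times(n+1)$ matrix of the linear system $4\pi^2\xi_\alpha a_{kj}^{\alpha\beta}\xi_\beta\hat u_j+2\pi i\xi_k\hat p=\hat f_k$ ($k=1,\dots,n$), $2\pi i\xi_j\hat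 u_j=\hat g$, for the unknowns $(\hat u_1,\dots,\hat u_n,\hat p)$.
   Formalization: The constant C depends on C_A, n and also max |a_{kj}^{αβ}|, rather than on C_A and n only; the literal claim fails, e.g. for n=1, a=λ, f=0, where p=λg while every C_A>0 is admissible for every λ. *)

theory Defs
  imports "HOL-Analysis.Analysis"
begin

section \<open>Complex vector spaces\<close>

class scaleC =
  fixes scaleC :: "complex \<Rightarrow> 'a \<Rightarrow> 'a"  (infixr "*\<^sub>C" 75)

class complex_vector = scaleC + ab_group_add +
  assumes scaleC_add_right: "c *\<^sub>C (x + y) = c *\<^sub>C x + c *\<^sub>C y"
    and scaleC_add_left: "(c + d) *\<^sub>C x = c *\<^sub>C x + d *\<^sub>C x"
    and scaleC_scaleC: "c *\<^sub>C d *\<^sub>C x = (c * d) *\<^sub>C x"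
    and scaleC_one: "1 *\<^sub>C x = x"

definition clinear :: "('a::complex_vector \<Rightarrow> 'b::complex_vector) \<Rightarrow> bool" where
  "clinear T \<longleftrightarrow> (\<forall>x y. T (x + y) = T x + T y) \<and> (\<forall>c x. T (c *\<^sub>C x) = c *\<^sub>C T x)"

instantiation complex :: complex_vector
begin
definition scaleC_complex :: "complex \<Rightarrow> complex \<Rightarrow> complex" where "scaleC_complex c x = c * x"
instance by standard (simp_all add: scaleC_complex_def algebra_simps)
end

instantiation vec :: (complex_vector, finite) complex_vector
begin
definition scaleC_vec :: "complex \<Rightarrow> 'a ^ 'b \<Rightarrow> 'a ^ 'b" where
  "scaleC_vec c x = (\<chi> i. c *\<^sub>C (x $ i))"
instance
  by standard (simp_all add: scaleC_vec_def vec_eq_iff scaleC_add_right scaleC_add_left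
      scaleC_scaleC scaleC_one)
end

instantiation prod :: (complex_vector, complex_vector) complex_vector
begin
definition scaleC_prod :: "complex \<Rightarrow> 'a \<times> 'b \<Rightarrow> 'a \<times> 'b" where
  "scaleC_prod c x = (c *\<^sub>C fst x, c *\<^sub>C snd x)"
instance
  by standard (simp_all add: scaleC_prod_def scaleC_add_right scaleC_add_left
      scaleC_scaleC scaleC_one)
end


section \<open>Periodic smooth functions\<close>

definition pd :: "'n \<Rightarrow> (real ^ 'n \<Rightarrow> complex) \<Rightarrow> real ^ 'n::finite \<Rightarrow> complex" where
  "pd j \<phi> x = frechet_derivative \<phi> (at x) (axis j 1)"

abbreviation pds :: "'n list \<Rightarrow> (real ^ 'n \<Rightarrow> complex) \<Rightarrow> real ^ 'n::finite \<Rightarrow> complex" where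
  "pds js \<phi> \<equiv> foldr pd js \<phi>"

definition smooth :: "(real ^ 'n::finite \<Rightarrow> complex) \<Rightarrow> bool" where
  "smooth \<phi> \<longleftrightarrow> (\<forall>js x. pds js \<phi> differentiable at x)"

definition periodic :: "(real ^ 'n::finite \<Rightarrow> complex) \<Rightarrow> bool" where
  "periodic \<phi> \<longleftrightarrow> (\<forall>j x. \<phi> (x + axis j 1) = \<phi> x)"

lemma pd_eqI: "(\<phi> has_derivative D) (at x) \<Longrightarrow> pd j \<phi> x = D (axis j 1)"
  unfolding pd_def using frechet_derivative_at by metis

lemma pd_add:
  assumes "\<And>x. \<phi> differentiable at x" "\<And>x. \<psi> differentiable at x"
  shows "pd j (\<lambda>x. \<phi> x + \<psi> x) = (\<lambda>x. pd j \<phi> x + pd j \<psi> x)"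
proof
  fix x
  show "pd j (\<lambda>x. \<phi> x + \<psi> x) x = pd j \<phi> x + pd j \<psi> x"
    unfolding pd_def
    using has_derivative_add[OF assms(1)[of x, unfolded frechet_derivative_works]
        assms(2)[of x, unfolded frechet_derivative_works]]
    by (simp flip: frechet_derivative_at)
qed

lemma pd_cmult:
  assumes "\<And>x. \<phi> differentiable at x"
  shows "pd j (\<lambda>x. c * \<phi> x) = (\<lambda>x. c * pd j \<phi> x)"
proof
  fix x
  show "pd j (\<lambda>x. c * \<phi> x) x = c * pd j \<phi> x"
    unfolding pd_def
    using has_derivative_mult_right[OF assms[of x, unfolded frechet_derivative_works], of c]
    by (simp flip: frechet_derivative_at)
qed

lemma smoothD: "smooth \<phi> \<Longrightarrow> pds js \<phi> differentiable at x"
  by (simp add: smooth_def)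

lemma smooth_differentiable: "smooth \<phi> \<Longrightarrow> \<phi> differentiable at x"
  using smoothD[of \<phi> "[]"] by simp

lemma smooth_continuous_on: "smooth \<phi> \<Longrightarrow> continuous_on S \<phi>"
  by (meson continuous_at_imp_continuous_on differentiable_imp_continuous_within
      smooth_differentiable)

lemma pds_add:
  assumes "smooth \<phi>" "smooth \<psi>"
  shows "pds js (\<lambda>x. \<phi> x + \<psi> x) = (\<lambda>x. pds js \<phi> x + pds js \<psi> x)"
  by (induction js) (simp_all add: pd_add smoothD assms)

lemma pds_cmult:
  assumes "smooth \<phi>"
  shows "pds js (\<lambda>x. c * \<phi> x) = (\<lambda>x. c * pds js \<phi> x)"
  by (induction js) (simp_all add: pd_cmult smoothD assms)

lemma smooth_add: "smooth \<phi> \<Longrightarrow> smooth \<psi> \<Longrightarrow> smooth (\<lambda>x. \<phi> x + \<psi> x)"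
  unfolding smooth_def[of "\<lambda>x. _ x + _ x"] by (simp add: pds_add smoothD)

lemma smooth_cmult: "smooth \<phi> \<Longrightarrow> smooth (\<lambda>x. c * \<phi> x)"
  unfolding smooth_def[of "\<lambda>x. _ * _ x"] by (simp add: pds_cmult smoothD)

lemma smooth_minus: "smooth \<phi> \<Longrightarrow> smooth (\<lambda>x. - \<phi> x)"
  using smooth_cmult[of \<phi> "-1"] by simp

lemma smooth_diff: "smooth \<phi> \<Longrightarrow> smooth \<psi> \<Longrightarrow> smooth (\<lambda>x. \<phi> x - \<psi> x)"
  using smooth_add[of \<phi> "\<lambda>x. - \<psi> x"] smooth_minus[of \<psi>] by simp

lemma pds_pd: "pds js (pd j \<phi>) = pds (js @ [j]) \<phi>"
  by simp

lemma smooth_pd: "smooth \<phi> \<Longrightarrow> smooth (pd j \<phi>)"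
  unfolding smooth_def pds_pd by blast

lemma periodic_pd:
  assumes "\<And>x. \<phi> differentiable at x" "periodic \<phi>"
  shows "periodic (pd j \<phi>)"
  unfolding periodic_def
proof (intro allI)
  fix i and x :: "real ^ 'a"
  have "(\<phi> has_derivative frechet_derivative \<phi> (at (x + axis i 1))) (at (x + axis i 1))"
    using assms(1) frechet_derivative_works by blast
  then have "((\<lambda>y. \<phi> (y + axis i 1)) has_derivative
      (\<lambda>h. frechet_derivative \<phi> (at (x + axis i 1)) h)) (at x)"
    by (rule has_derivative_compose[rotated]) (auto intro!: derivative_eq_intros)
  moreover have "(\<lambda>y. \<phi> (y + axis i 1)) = \<phi>"
    using assms(2) by (auto simp: periodic_def)
  ultimately show "pd j \<phi> (x + axis i 1) = pd j \<phi> x"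
    by (simp add: pd_eqI) (simp add: pd_def)
qed

definition character :: "int ^ 'n \<Rightarrow> real ^ 'n::finite \<Rightarrow> complex" where
  "character \<xi> x = cis (2 * pi * (\<Sum>j\<in>UNIV. x $ j * of_int (\<xi> $ j)))"

lemma has_derivative_character:
  "(character \<xi> has_derivative
     (\<lambda>h. of_real (2 * pi * (\<Sum>j\<in>UNIV. h $ j * of_int (\<xi> $ j))) * \<i> * character \<xi> x)) (at x)"
proof -
  have "((\<lambda>x. 2 * pi * (\<Sum>j\<in>UNIV. x $ j * of_int (\<xi> $ j))) has_derivative
      (\<lambda>h. 2 * pi * (\<Sum>j\<in>UNIV. h $ j * of_int (\<xi> $ j)))) (at x)"
    by (intro has_derivative_mult_right has_derivative_sum has_derivative_mult_left
        bounded_linear_imp_has_derivative bounded_linear_vec_nth)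
  then have "((\<lambda>x. exp (\<i> * of_real (2 * pi * (\<Sum>j\<in>UNIV. x $ j * of_int (\<xi> $ j))))) has_derivative
     (\<lambda>h. exp (\<i> * of_real (2 * pi * (\<Sum>j\<in>UNIV. x $ j * of_int (\<xi> $ j)))) *
        (\<i> * of_real (2 * pi * (\<Sum>j\<in>UNIV. h $ j * of_int (\<xi> $ j)))))) (at x)"
    by (rule has_derivative_compose[OF has_derivative_mult_right[OF has_derivative_of_real]
        DERIV_exp[unfolded has_field_derivative_def]])
  then show ?thesis
    unfolding character_def[abs_def] cis_conv_exp by (simp add: mult_ac)
qed

lemma pd_character:
  "pd j (character \<xi>) = (\<lambda>x. (2 * pi * \<i> * of_int (\<xi> $ j)) * character \<xi> x)"
proof
  fix x
  have "(\<Sum>i\<in>UNIV. axis j 1 $ i * real_of_int (\<xi> $ i)) = of_int (\<xi> $ j)"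
    by (simp add: axis_def if_distrib [of "\<lambda>c. c * _"] cong: if_cong)
  then show "pd j (character \<xi>) x = (2 * pi * \<i> * of_int (\<xi> $ j)) * character \<xi> x"
    by (simp add: pd_eqI[OF has_derivative_character])
qed

lemma character_differentiable: "character \<xi> differentiable at x"
  using has_derivative_character differentiableI by blast

lemma pds_character: "\<exists>c. pds js (character \<xi>) = (\<lambda>x. c * character \<xi> x)"
proof (induction js)
  case Nil
  show ?case by (rule exI[of _ 1]) simp
next
  case (Cons j js)
  then obtain c where "pds js (character \<xi>) = (\<lambda>x. c * character \<xi> x)" by blast
  then have "pds (j # js) (character \<xi>) = (\<lambda>x. (c * (2 * pi * \<i> * of_int (\<xi> $ j))) * character \<xi> x)"
    by (simp add: pd_cmult character_differentiable pd_character mult_ac)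
  then show ?case by blast
qed

lemma smooth_character: "smooth (character \<xi>)"
  unfolding smooth_def
proof (intro allI)
  fix js x
  obtain c where "pds js (character \<xi>) = (\<lambda>x. c * character \<xi> x)"
    using pds_character by blast
  then show "pds js (character \<xi>) differentiable at x"
    using differentiable_mult[OF differentiable_const character_differentiable] by simp
qed

lemma periodic_character: "periodic (character \<xi>)"
  unfolding periodic_def
proof (intro allI)
  fix j and x :: "real ^ 'a"
  have "(\<Sum>i\<in>UNIV. axis j 1 $ i * real_of_int (\<xi> $ i)) = of_int (\<xi> $ j)"
    by (simp add: axis_def if_distrib [of "\<lambda>c. c * _"] cong: if_cong)
  then have "character \<xi> (x + axis j 1) = character \<xi> x * cis (2 * pi * of_int (\<xi> $ j))"
    unfolding character_def cis_mult
    by (simp only: vector_add_component distrib_left distrib_right sum.distrib)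
  moreover have "cis (2 * pi * of_int (\<xi> $ j)) = 1"
    by (rule cis_multiple_2pi) simp
  ultimately show "character \<xi> (x + axis j 1) = character \<xi> x"
    by simp
qed

typedef 'n test = "{\<phi> :: real ^ 'n::finite \<Rightarrow> complex. smooth \<phi> \<and> periodic \<phi>}"
  morphisms eval Abs_test
  using smooth_character periodic_character by blast

setup_lifting type_definition_test

lemma smooth_eval: "smooth (eval \<phi>)" and periodic_eval: "periodic (eval \<phi>)"
  using eval[of \<phi>] by auto

instantiation test :: (finite) complex_vector
begin
lift_definition zero_test :: "'a test" is "\<lambda>_. 0"
  using smooth_cmult[OF smooth_character, of 0] by (simp add: periodic_def)
lift_definition plus_test :: "'a test \<Rightarrow> 'a test \<Rightarrow> 'a test" is "\<lambda>\<phi> \<psi> x. \<phi> x + \<psi> x"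
  by (simp add: smooth_add periodic_def)
lift_definition minus_test :: "'a test \<Rightarrow> 'a test \<Rightarrow> 'a test" is "\<lambda>\<phi> \<psi> x. \<phi> x - \<psi> x"
  by (simp add: smooth_diff periodic_def)
lift_definition uminus_test :: "'a test \<Rightarrow> 'a test" is "\<lambda>\<phi> x. - \<phi> x"
  by (simp add: smooth_minus periodic_def)
lift_definition scaleC_test :: "complex \<Rightarrow> 'a test \<Rightarrow> 'a test" is "\<lambda>c \<phi> x. c * \<phi> x"
  by (simp add: smooth_cmult periodic_def)
instance by standard (transfer; simp add: fun_eq_iff algebra_simps)+
end

lift_definition dtest :: "'n \<Rightarrow> 'n::finite test \<Rightarrow> 'n test" is pd
  by (simp add: smooth_pd periodic_pd smooth_differentiable)

lift_definition echar :: "int ^ 'n \<Rightarrow> 'n::finite test" is character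
  by (simp add: smooth_character periodic_character)

text \<open>Convergence in the Frechet space of periodic smooth functions. The space is metrizable, so
  sequential continuity of a functional is continuity.\<close>

definition test_tendsto :: "(nat \<Rightarrow> 'n::finite test) \<Rightarrow> 'n test \<Rightarrow> bool" where
  "test_tendsto \<Phi> \<phi> \<longleftrightarrow>
    (\<forall>js. uniform_limit UNIV (\<lambda>k. pds js (eval (\<Phi> k))) (pds js (eval \<phi>)) sequentially)"


section \<open>Periodic distributions\<close>

typedef 'n pdistr =
  "{g :: 'n::finite test \<Rightarrow> complex. clinear g \<and>
     (\<forall>\<Phi> \<phi>. test_tendsto \<Phi> \<phi> \<longrightarrow> (\<lambda>k. g (\<Phi> k)) \<longlonglongrightarrow> g \<phi>)}"
  morphisms pairing Abs_pdistr
  by (rule exI[of _ "\<lambda>_. 0"]) (simp add: clinear_def scaleC_complex_def)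

setup_lifting type_definition_pdistr

instantiation pdistr :: (finite) complex_vector
begin
lift_definition zero_pdistr :: "'a pdistr" is "\<lambda>_. 0"
  by (simp add: clinear_def scaleC_complex_def)
lift_definition plus_pdistr :: "'a pdistr \<Rightarrow> 'a pdistr \<Rightarrow> 'a pdistr" is "\<lambda>g h \<phi>. g \<phi> + h \<phi>"
  by (auto simp: clinear_def scaleC_complex_def algebra_simps intro!: tendsto_add)
lift_definition minus_pdistr :: "'a pdistr \<Rightarrow> 'a pdistr \<Rightarrow> 'a pdistr" is "\<lambda>g h \<phi>. g \<phi> - h \<phi>"
  by (auto simp: clinear_def scaleC_complex_def algebra_simps intro!: tendsto_diff)
lift_definition uminus_pdistr :: "'a pdistr \<Rightarrow> 'a pdistr" is "\<lambda>g \<phi>. - g \<phi>"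
  by (auto simp: clinear_def scaleC_complex_def algebra_simps intro!: tendsto_minus)
lift_definition scaleC_pdistr :: "complex \<Rightarrow> 'a pdistr \<Rightarrow> 'a pdistr" is "\<lambda>c g \<phi>. c * g \<phi>"
  by (auto simp: clinear_def scaleC_complex_def algebra_simps intro!: tendsto_mult_left)
instance by standard (transfer; simp add: fun_eq_iff algebra_simps)+
end

lemma dtest_add: "dtest j (\<phi> + \<psi>) = dtest j \<phi> + dtest j \<psi>"
  by transfer (simp add: pd_add smooth_differentiable)

lemma dtest_scaleC: "dtest j (c *\<^sub>C \<phi>) = c *\<^sub>C dtest j \<phi>"
  by transfer (simp add: pd_cmult smooth_differentiable)

lemma test_tendsto_dtest: "test_tendsto \<Phi> \<phi> \<Longrightarrow> test_tendsto (\<lambda>k. dtest j (\<Phi> k)) (dtest j \<phi>)"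
  unfolding test_tendsto_def dtest.rep_eq pds_pd by blast

lift_definition D :: "'n \<Rightarrow> 'n::finite pdistr \<Rightarrow> 'n pdistr" is "\<lambda>j g \<phi>. - g (dtest j \<phi>)"
  by (simp add: clinear_def scaleC_complex_def dtest_add dtest_scaleC tendsto_minus
      test_tendsto_dtest)

definition torus :: "(real ^ 'n::finite) set" where
  "torus = {x. \<forall>j. 0 \<le> x $ j \<and> x $ j < 1}"

lemma
  fixes f :: "real ^ 'n::finite \<Rightarrow> complex"
  assumes "continuous_on UNIV f"
  shows set_integrable_torus: "set_integrable lborel torus f"
    and integral_torus: "(LBINT x:torus. f x) = integral (cbox 0 1) f"
proof -
  have sub: "torus \<subseteq> cbox 0 (1 :: real ^ 'n)"
    by (auto simp: torus_def mem_box_cart less_imp_le)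
  have "torus = (\<Inter>j. {x :: real ^ 'n. 0 \<le> x $ j} \<inter> {x. x $ j < 1})"
    by (auto simp: torus_def)
  also have "\<dots> \<in> sets borel"
    by (intro sets.countable_INT'' sets.Int borel_closed borel_open)
       (auto intro!: closed_Collect_le open_Collect_less continuous_intros)
  finally have meas: "torus \<in> sets (borel :: (real ^ 'n) measure)" .
  have "set_integrable lborel (cbox 0 (1 :: real ^ 'n)) f"
    by (meson assms borel_integrable_compact compact_cbox continuous_on_subset subset_UNIV
        set_integrable_def)
  then show int: "set_integrable lborel torus f"
    using sub meas by (auto intro: set_integrable_subset)
  have "negligible (\<Union>j\<in>UNIV. {x :: real ^ 'n. x $ j = 1})"
    by (intro negligible_Union) (auto simp: cart_eq_inner_axis intro!: negligible_hyperplane)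
  then have neg: "negligible (cbox 0 (1 :: real ^ 'n) - torus)"
  proof (rule negligible_subset)
    show "cbox 0 (1 :: real ^ 'n) - torus \<subseteq> (\<Union>j\<in>UNIV. {x. x $ j = 1})"
      by (auto simp: torus_def mem_box_cart) (metis order.antisym not_less)
  qed
  have "(LBINT x:torus. f x) = integral torus f"
    using set_borel_integral_eq_integral(2)[OF int] .
  also have "\<dots> = integral (cbox 0 1) f"
  proof (rule integral_spike_set)
    show "negligible {x \<in> torus - cbox 0 1. f x \<noteq> 0}"
      using sub by (auto intro: negligible_subset[OF negligible_empty])
    show "negligible {x \<in> cbox 0 1 - torus. f x \<noteq> 0}"
      by (rule negligible_subset[OF neg]) auto
  qed
  finally show "(LBINT x:torus. f x) = integral (cbox 0 1) f" .
qed

lift_definition of_test :: "'n::finite test \<Rightarrow> 'n pdistr" is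
  "\<lambda>h \<phi>. LBINT x:torus. eval h x * eval \<phi> x"
proof (intro conjI allI impI)
  fix h :: "'n test"
  have cont: "continuous_on S (\<lambda>x. eval h x * eval \<phi> x)" for S \<phi>
    by (intro continuous_intros smooth_continuous_on smooth_eval)
  note int = integral_torus[OF cont]
  show "clinear (\<lambda>\<phi>. LBINT x:torus. eval h x * eval \<phi> x)"
    unfolding clinear_def
  proof (intro conjI allI)
    fix \<phi> \<psi> c
    show "(LBINT x:torus. eval h x * eval (\<phi> + \<psi>) x) =
        (LBINT x:torus. eval h x * eval \<phi> x) + (LBINT x:torus. eval h x * eval \<psi> x)"
      unfolding int
      by (simp add: plus_test.rep_eq distrib_left integral_add integrable_continuous cont)
    show "(LBINT x:torus. eval h x * eval (c *\<^sub>C \<phi>) x) =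
        c *\<^sub>C (LBINT x:torus. eval h x * eval \<phi> x)"
      unfolding int scaleC_complex_def integral_mult_right[symmetric]
      by (simp add: scaleC_test.rep_eq mult.left_commute[of _ c])
  qed
  fix \<Phi> :: "nat \<Rightarrow> 'n test" and \<phi>
  assume "test_tendsto \<Phi> \<phi>"
  then have "uniform_limit UNIV (\<lambda>k. pds [] (eval (\<Phi> k))) (pds [] (eval \<phi>)) sequentially"
    unfolding test_tendsto_def by blast
  then have lim: "uniform_limit (cbox 0 1) (\<lambda>k. eval (\<Phi> k)) (eval \<phi>) sequentially"
    by (auto intro: uniform_limit_on_subset)
  have "uniform_limit (cbox 0 1) (\<lambda>k x. eval h x * eval (\<Phi> k) x)
      (\<lambda>x. eval h x * eval \<phi> x) sequentially"
    by (intro uniform_lim_mult uniform_limit_const lim compact_imp_bounded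
        compact_continuous_image smooth_continuous_on smooth_eval compact_cbox)
  then obtain I J where "\<And>k. ((\<lambda>x. eval h x * eval (\<Phi> k) x) has_integral I k) (cbox 0 1)"
    "((\<lambda>x. eval h x * eval \<phi> x) has_integral J) (cbox 0 1)" and lim: "I \<longlonglongrightarrow> J"
    by (rule uniform_limit_integral_cbox) (auto intro: cont)
  then have "I = (\<lambda>k. LBINT x:torus. eval h x * eval (\<Phi> k) x)"
    "J = (LBINT x:torus. eval h x * eval \<phi> x)"
    unfolding int by (auto intro!: ext integral_unique[symmetric])
  with lim show "(\<lambda>k. LBINT x:torus. eval h x * eval (\<Phi> k) x) \<longlonglongrightarrow> (LBINT x:torus. eval h x * eval \<phi> x)"
    by simp
qed

definition real_valued :: "'n::finite pdistr \<Rightarrow> bool" where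
  "real_valued g \<longleftrightarrow> (\<forall>\<phi>. (\<forall>x. eval \<phi> x \<in> \<real>) \<longrightarrow> pairing g \<phi> \<in> \<real>)"


section \<open>Periodic Sobolev spaces\<close>

definition fourier :: "'n::finite pdistr \<Rightarrow> int ^ 'n \<Rightarrow> complex" where
  "fourier g \<xi> = pairing g (echar (- \<xi>))"

definition rho :: "int ^ 'n::finite \<Rightarrow> real" where
  "rho \<xi> = sqrt (1 + (norm (\<chi> j. real_of_int (\<xi> $ j)))\<^sup>2)"

definition sobolev :: "real \<Rightarrow> 'n::finite pdistr set" where
  "sobolev s = {g. (\<lambda>\<xi>. rho \<xi> powr (2 * s) * (cmod (fourier g \<xi>))\<^sup>2) summable_on UNIV}"

definition sobolev_norm :: "real \<Rightarrow> 'n::finite pdistr \<Rightarrow> real" where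
  "sobolev_norm s g = sqrt (\<Sum>\<^sub>\<infinity>\<xi>. rho \<xi> powr (2 * s) * (cmod (fourier g \<xi>))\<^sup>2)"

definition zero_mean :: "'n::finite pdistr set" where
  "zero_mean = {g. pairing g (echar 0) = 0}"  \<comment> \<open>\<open>echar 0\<close> is the constant function \<open>1\<close>\<close>

definition sobolev0 :: "real \<Rightarrow> 'n::finite pdistr set" where
  "sobolev0 s = sobolev s \<inter> zero_mean"

definition smooth0 :: "'n::finite pdistr set" where
  "smooth0 = range of_test \<inter> zero_mean"

definition vecs :: "'a set \<Rightarrow> ('a ^ 'n) set" where
  "vecs X = {u. \<forall>k. u $ k \<in> X}"

definition vec_sobolev_norm :: "real \<Rightarrow> 'n::finite pdistr ^ 'n \<Rightarrow> real" where
  "vec_sobolev_norm s u = L2_set (\<lambda>k. sobolev_norm s (u $ k)) UNIV"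

definition pair_norm :: "real \<Rightarrow> real \<Rightarrow> ('n::finite pdistr ^ 'n) \<times> 'n pdistr \<Rightarrow> real" where
  "pair_norm s t up = vec_sobolev_norm s (fst up) + sobolev_norm t (snd up)"

text \<open>Unconditional convergence of the trigonometric series with coefficients \<open>c\<close> to \<open>g\<close>. The membership of \<open>g\<close> is needed because \<open>sobolev_norm\<close> has the value 0 outside \<open>sobolev s\<close>.\<close>

definition sobolev_series ::
    "real \<Rightarrow> (int ^ 'n \<Rightarrow> complex) \<Rightarrow> (int ^ 'n) set \<Rightarrow> 'n::finite pdistr \<Rightarrow> bool" where
  "sobolev_series s c A g \<longleftrightarrow> g \<in> sobolev s \<and>
    ((\<lambda>F. sobolev_norm s (g - (\<Sum>\<xi>\<in>F. c \<xi> *\<^sub>C of_test (echar \<xi>)))) \<longlongrightarrow> 0)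
      (finite_subsets_at_top A)"

definition top_iso_on :: "'a::complex_vector set \<Rightarrow> ('a \<Rightarrow> real) \<Rightarrow> 'b::complex_vector set \<Rightarrow>
    ('b \<Rightarrow> real) \<Rightarrow> ('a \<Rightarrow> 'b) \<Rightarrow> bool" where
  "top_iso_on V N W M T \<longleftrightarrow> clinear T \<and> bij_betw T V W \<and>
    (\<exists>K. \<forall>x\<in>V. M (T x) \<le> K * N x) \<and> (\<exists>K. \<forall>x\<in>V. N x \<le> K * M (T x))"


section \<open>The anisotropic Stokes system\<close>

text \<open>The value \<open>a k j \<alpha> \<beta>\<close> is the component with lower indices \<open>k, j\<close> and upper indices
  \<open>\<alpha>, \<beta>\<close>.\<close>

type_synonym 'n tensor = "'n \<Rightarrow> 'n \<Rightarrow> 'n \<Rightarrow> 'n \<Rightarrow> real"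

definition tensor_symmetric :: "'n tensor \<Rightarrow> bool" where
  "tensor_symmetric a \<longleftrightarrow>
    (\<forall>k j \<alpha> \<beta>. a k j \<alpha> \<beta> = a \<alpha> j k \<beta> \<and> a k j \<alpha> \<beta> = a k \<beta> \<alpha> j)"

definition relaxed_elliptic :: "real \<Rightarrow> 'n::finite tensor \<Rightarrow> bool" where
  "relaxed_elliptic C\<^sub>A a \<longleftrightarrow>
    (\<forall>\<zeta> :: real ^ 'n ^ 'n. \<zeta> = transpose \<zeta> \<and> (\<Sum>k\<in>UNIV. \<zeta> $ k $ k) = 0 \<longrightarrow>
      (\<Sum>k\<in>UNIV. \<Sum>j\<in>UNIV. \<Sum>\<alpha>\<in>UNIV. \<Sum>\<beta>\<in>UNIV. a k j \<alpha> \<beta> * \<zeta> $ k $ \<alpha> * \<zeta> $ j $ \<beta>)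
        \<ge> inverse C\<^sub>A * (\<Sum>k\<in>UNIV. \<Sum>\<alpha>\<in>UNIV. (\<zeta> $ k $ \<alpha>)\<^sup>2))"

text \<open>Constants in estimates for the Stokes system have to depend on this quantity as well as on
  the ellipticity constant: for \<open>n = 1\<close>, \<open>f = 0\<close> and \<open>a = \<lambda>\<close> the pressure is \<open>p = \<lambda> g\<close>, while every
  \<open>C\<^sub>A > 0\<close> is an ellipticity constant for every \<open>\<lambda>\<close>.\<close>

definition tensor_norm :: "'n::finite tensor \<Rightarrow> real" where
  "tensor_norm a = (MAX (k, j, \<alpha>, \<beta>) \<in> UNIV. \<bar>a k j \<alpha> \<beta>\<bar>)"

definition strain :: "'n::finite pdistr ^ 'n \<Rightarrow> 'n \<Rightarrow> 'n \<Rightarrow> 'n pdistr" where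
  "strain u j \<beta> = (1 / 2) *\<^sub>C (D j (u $ \<beta>) + D \<beta> (u $ j))"

definition viscous :: "'n::finite tensor \<Rightarrow> 'n pdistr ^ 'n \<Rightarrow> 'n pdistr ^ 'n" where
  "viscous a u = (\<chi> k. \<Sum>\<alpha>\<in>UNIV. D \<alpha>
     (\<Sum>j\<in>UNIV. \<Sum>\<beta>\<in>UNIV. complex_of_real (a k j \<alpha> \<beta>) *\<^sub>C strain u j \<beta>))"

definition grad :: "'n::finite pdistr \<Rightarrow> 'n pdistr ^ 'n" where
  "grad p = (\<chi> k. D k p)"

definition dvg :: "'n::finite pdistr ^ 'n \<Rightarrow> 'n pdistr" where
  "dvg u = (\<Sum>j\<in>UNIV. D j (u $ j))"

definition stokes_L :: "'n::finite tensor \<Rightarrow> 'n pdistr ^ 'n \<Rightarrow> 'n pdistr \<Rightarrow> 'n pdistr ^ 'n" where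
  "stokes_L a u p = viscous a u - grad p"

definition stokes_S :: "'n::finite tensor \<Rightarrow>
    ('n pdistr ^ 'n) \<times> 'n pdistr \<Rightarrow> ('n pdistr ^ 'n) \<times> 'n pdistr" where
  "stokes_S a = (\<lambda>(u, p). (- stokes_L a u p, dvg u))"

text \<open>Rows and columns \<open>1, \<dots>, n\<close> are indexed by \<open>Some k\<close>, row and column \<open>n + 1\<close> by \<open>None\<close>.\<close>

definition symbol ::
    "'n::finite tensor \<Rightarrow> int ^ 'n \<Rightarrow> complex ^ 'n option ^ 'n option" where
  "symbol a \<xi> = (\<chi> r c. case (r, c) of
      (Some k, Some j) \<Rightarrow>
        4 * pi\<^sup>2 * (\<Sum>\<alpha>\<in>UNIV. \<Sum>\<beta>\<in>UNIV. of_int (\<xi> $ \<alpha>) * of_real (a k j \<alpha> \<beta>) * of_int (\<xi> $ \<beta>))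
    | (Some k, None) \<Rightarrow> 2 * pi * \<i> * of_int (\<xi> $ k)
    | (None, Some j) \<Rightarrow> 2 * pi * \<i> * of_int (\<xi> $ j)
    | (None, None) \<Rightarrow> 0)"

definition fourier_pair ::
    "('n::finite pdistr ^ 'n) \<times> 'n pdistr \<Rightarrow> int ^ 'n \<Rightarrow> complex ^ 'n option" where
  "fourier_pair up \<xi> =
    (\<chi> r. case r of Some k \<Rightarrow> fourier (fst up $ k) \<xi> | None \<Rightarrow> fourier (snd up) \<xi>)"

end

theory Submission
  imports Defs
begin

text \<open>On Fourier coefficients the Stokes operator acts as multiplication by the symbol matrix.
  Relaxed ellipticity, tested on symmetrized rank one matrices \<open>v \<otimes> \<xi>\<close> with \<open>v\<close> orthogonal
  to \<open>\<xi>\<close>, bounds the solenoidal part of the velocity; the divergence equation fixes the remaining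
  gradient part, and the momentum equation then bounds the pressure. This gives an estimate of the
  inverse symbol that is uniform in \<open>\<xi>\<close> for the weights of the Sobolev norms. It transfers to
  distributions because a periodic distribution is determined by its Fourier coefficients and every
  polynomially bounded family of coefficients comes from a distribution. Smooth data are covered
  since the smooth functions are the intersection of all Sobolev spaces.\<close>

section \<open>Integration of periodic functions\<close>

text \<open>The tensor is controlled only on trace-free symmetric matrices, so the velocity block of
  the symbol need not be coercive along \<open>\<xi>\<close>. The component of the velocity along
  \<open>\<xi>\<close> is therefore read off from the divergence equation and enters the momentum
  equation as a perturbation estimated by the size of the tensor. There, and in the pressure bound,
  \<open>tensor_norm\<close> enters the constant. The unknowns have different orders: with
  \<open>r\<close> the length of the frequency, \<open>r\<^sup>2\<close> times velocity and
  \<open>r\<close> times pressure are compared with force and \<open>r\<close> times divergence.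
  Both sides share the weight \<open>rho \<xi> powr (2 * (s - 2))\<close>, so one inequality serves
  all \<open>s\<close> and the constant does not depend on \<open>s\<close>. The zero frequency is
  removed by the zero means. For distributions, uniqueness rests on convergence of the Fourier
  series of a test function with all derivatives, which needs completeness of the characters.
  Existence rests on the converse control: convergence of test functions makes their coefficients
  converge uniformly against every polynomial weight.\<close>

lemma periodicD: "periodic f \<Longrightarrow> f (x + axis j 1) = f x"
  by (simp add: periodic_def)

lemma content_unit_cube: "measure lborel (cbox 0 (1 :: real ^ 'n::finite)) = 1"
  by (subst content_cbox_cart) (auto simp: interval_ne_empty_cart)

text \<open>Cut the translated cube at the hyperplane where coordinate \<open>j\<close> equals 1 and
  move the protruding slab back by one period; the two pieces tile the unit cube.\<close>

lemma integral_periodic_shift: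
  fixes f :: "real ^ 'n::finite \<Rightarrow> complex"
  assumes cont: "continuous_on UNIV f" and per: "periodic f" and h: "0 \<le> h" "h \<le> 1"
  shows "integral (cbox 0 1) (\<lambda>x. f (x + axis j h)) = integral (cbox 0 1) f"
proof -
  \<comment> \<open>Upper corner of the slab where coordinate \<open>j\<close> is at most
    \<open>h\<close>, the part of the unit cube that the translate leaves uncovered.\<close>
  define b :: "real ^ 'n" where "b = (\<chi> i. if i = j then h else 1)"
  have int: "f integrable_on cbox u v" for u v
    by (rule integrable_continuous) (rule continuous_on_subset[OF cont], simp)
  have Q: "cbox (axis j h) (1 + axis j h) \<inter> {x. x \<bullet> axis j 1 \<le> 1} = cbox (axis j h) 1"
    "cbox (axis j h) (1 + axis j h) \<inter> {x. x \<bullet> axis j 1 \<ge> 1} = cbox (0 + axis j 1) (b + axis j 1)"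
    "cbox 0 1 \<inter> {x. x \<bullet> axis j 1 \<le> h} = cbox 0 b"
    "cbox 0 1 \<inter> {x. x \<bullet> axis j 1 \<ge> h} = cbox (axis j h) 1"
    unfolding set_eq_iff mem_box_cart Int_iff mem_Collect_eq inner_axis b_def
    by (simp_all add: axis_def) (smt (verit) h)+
  have "integral (cbox 0 1) (\<lambda>x. f (x + axis j h)) = integral (cbox (axis j h) (1 + axis j h)) f"
    using integral_shift_cbox[of "axis j h" "axis j h" "1 + axis j h" f] by simp
  also have "\<dots> = integral (cbox (axis j h) 1) f + integral (cbox (0 + axis j 1) (b + axis j 1)) f"
    unfolding Q(1,2)[symmetric] by (rule integral_split[OF int]) simp
  also have "integral (cbox (0 + axis j 1) (b + axis j 1)) f = integral (cbox 0 b) f"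
    using integral_shift_cbox[of "0 + axis j 1" "axis j 1" "b + axis j 1" f]
    by (simp add: periodicD[OF per])
  also have "integral (cbox (axis j h) 1) f + integral (cbox 0 b) f = integral (cbox 0 1) f"
    unfolding Q(3,4)[symmetric] by (subst integral_split[OF int, of "axis j 1" _ _ h]) simp_all
  finally show ?thesis .
qed

lemma pd_has_vector_derivative:
  assumes "f differentiable at (x + axis j t)"
  shows "((\<lambda>t. f (x + axis j t)) has_vector_derivative pd j f (x + axis j t)) (at t within S)"
proof -
  have 1: "(f has_derivative frechet_derivative f (at (x + axis j t))) (at (x + axis j t))"
    using assms frechet_derivative_works by blast
  have ax: "axis j s = s *\<^sub>R axis j (1::real)" for s
    by (simp add: vec_eq_iff axis_def)
  have "((\<lambda>s. x + s *\<^sub>R axis j 1) has_derivative (\<lambda>s. s *\<^sub>R axis j 1)) (at t within S)"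
    by (auto intro!: derivative_eq_intros)
  then have 2: "((\<lambda>s. x + axis j s) has_derivative (\<lambda>s. axis j s)) (at t within S)"
    by (simp only: ax[symmetric])
  have "((\<lambda>s. f (x + axis j s)) has_derivative (\<lambda>s. frechet_derivative f (at (x + axis j t)) (axis j s)))
      (at t within S)"
    by (rule has_derivative_compose[OF 2 1])
  moreover have "frechet_derivative f (at (x + axis j t)) (axis j s) = s *\<^sub>R pd j f (x + axis j t)" for s
    unfolding pd_def ax[of s] using 1 has_derivative_linear linear_cmul by blast
  ultimately show ?thesis
    by (simp add: has_vector_derivative_def)
qed

text \<open>The integral of a translate is constant in the shift; differentiating under the integral
  sign at shift 0 gives the integral of the partial derivative. This takes the place of Fubini and
  the fundamental theorem of calculus.\<close>

lemma integral_pd_periodic: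
  fixes f :: "real ^ 'n::finite \<Rightarrow> complex"
  assumes diff: "\<And>x. f differentiable at x" and per: "periodic f"
    and cont: "continuous_on UNIV (pd j f)"
  shows "integral (cbox 0 1) (pd j f) = 0"
proof -
  have cf: "continuous_on UNIV f"
    by (simp add: assms(1) continuous_at_imp_continuous_on differentiable_imp_continuous_within)
  have ca: "continuous_on A (\<lambda>z. snd z + axis j (fst z) :: real ^ 'n)" for A
    unfolding axis_def
  proof (intro continuous_intros continuous_on_vec_lambda)
    fix i
    show "continuous_on A (\<lambda>z. if i = j then fst z else 0)"
      by (cases "i = j") (auto intro: continuous_intros)
  qed
  have "((\<lambda>t. integral (cbox 0 1) (\<lambda>x. f (x + axis j t))) has_vector_derivative
      integral (cbox 0 1) (\<lambda>x. pd j f (x + axis j 0))) (at 0 within {0..1})"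
  proof (rule leibniz_rule_vector_derivative)
    show "(\<lambda>x. f (x + axis j t)) integrable_on cbox 0 1" for t
      by (intro integrable_continuous continuous_on_compose2[OF cf] continuous_intros) simp
    show "continuous_on ({0..1} \<times> cbox 0 1) (\<lambda>(t, x). pd j f (x + axis j t))"
      unfolding case_prod_unfold by (rule continuous_on_compose2[OF cont ca]) simp
  qed (auto intro!: pd_has_vector_derivative diff)
  moreover have "((\<lambda>t. integral (cbox 0 1) (\<lambda>x. f (x + axis j t))) has_vector_derivative 0)
      (at 0 within {0..1})"
    by (rule has_vector_derivative_transform[OF _ _ has_vector_derivative_const])
      (auto simp: integral_periodic_shift[OF cf per])
  ultimately have "integral (cbox 0 1) (\<lambda>x. pd j f (x + axis j 0)) = 0"
    unfolding cbox_interval[of "0::real" 1, symmetric]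
    by (rule vector_derivative_unique_within_closed_interval[rotated 2]) auto
  moreover have "axis j (0::real) = 0"
    by (simp add: vec_eq_iff axis_def)
  ultimately show ?thesis
    by simp
qed

lemma pd_mult:
  assumes "f differentiable at x" "g differentiable at x"
  shows "pd j (\<lambda>x. f x * g x) x = f x * pd j g x + pd j f x * g x"
  unfolding pd_def
  using has_derivative_mult[OF assms[unfolded frechet_derivative_works]]
  by (simp flip: frechet_derivative_at)

lemma periodic_mult: "periodic f \<Longrightarrow> periodic g \<Longrightarrow> periodic (\<lambda>x. f x * g x)"
  by (simp add: periodic_def)

lemma character_mult: "character \<xi> x * character \<eta> x = character (\<xi> + \<eta>) x"
  unfolding character_def cis_mult
  by (simp add: distrib_left sum.distrib)

lemma character_0: "character 0 x = 1"
  by (simp add: character_def)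

lemma cnj_character: "cnj (character \<xi> x) = character (- \<xi>) x"
  by (simp add: character_def cis_cnj sum_negf)

lemma norm_character: "cmod (character \<xi> x) = 1"
  by (simp add: character_def)

lemma continuous_on_character: "continuous_on S (character \<xi>)"
  using smooth_character smooth_continuous_on by blast

text \<open>Taken over the closed cube, where integration theory over boxes applies;
  \<open>fourier_of_test\<close> gives the agreement with \<open>fourier\<close>, which goes back to
  the half-open torus.\<close>

definition fcoeff :: "(real ^ 'n::finite \<Rightarrow> complex) \<Rightarrow> int ^ 'n \<Rightarrow> complex" where
  "fcoeff f \<xi> = integral (cbox 0 1) (\<lambda>x. f x * character (- \<xi>) x)"

lemma fcoeff_integrable:
  "continuous_on UNIV f \<Longrightarrow> (\<lambda>x. f x * character \<xi> x) integrable_on cbox 0 1"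
  by (intro integrable_continuous continuous_intros continuous_on_character)
     (auto intro: continuous_on_subset)

text \<open>Integration by parts: the partial derivative of the periodic product of \<open>f\<close>
  and the character has integral 0.\<close>

lemma fcoeff_pd:
  fixes f :: "real ^ 'n::finite \<Rightarrow> complex"
  assumes "\<And>x. f differentiable at x" "periodic f" "continuous_on UNIV (pd j f)"
  shows "fcoeff (pd j f) \<xi> = 2 * pi * \<i> * of_int (\<xi> $ j) * fcoeff f \<xi>"
proof -
  let ?e = "character (- \<xi>)"
  have cf: "continuous_on UNIV f"
    by (simp add: assms(1) continuous_at_imp_continuous_on differentiable_imp_continuous_within)
  have "integral (cbox 0 1) (pd j (\<lambda>x. f x * ?e x)) = 0"
  proof (rule integral_pd_periodic)
    show "continuous_on UNIV (pd j (\<lambda>x. f x * ?e x))"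
      using assms(1)
      by (simp add: pd_mult[OF _ character_differentiable] cf assms(3) pd_character
            continuous_on_character continuous_intros cong: continuous_on_cong)
  qed (auto intro!: differentiable_mult assms character_differentiable periodic_mult periodic_character)
  also have "pd j (\<lambda>x. f x * ?e x) =
      (\<lambda>x. pd j f x * ?e x - 2 * pi * \<i> * of_int (\<xi> $ j) * (f x * ?e x))"
    by (rule ext) (simp add: pd_mult assms(1) character_differentiable pd_character)
  finally show ?thesis
    using fcoeff_integrable[OF cf, of "-\<xi>"] fcoeff_integrable[OF assms(3), of "-\<xi>"]
    by (simp add: fcoeff_def integral_diff integrable_on_mult_right)
qed

text \<open>Off the diagonal no integral is computed: differentiation in a coordinate where the
  frequencies differ multiplies the coefficient by the entry of either frequency, which forces it to
  vanish.\<close>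

lemma fcoeff_character: "fcoeff (character \<eta>) \<xi> = (if \<xi> = \<eta> then 1 else 0)"
proof (cases "\<xi> = \<eta>")
  case True
  then show ?thesis
    by (simp add: fcoeff_def character_mult character_0 content_unit_cube)
next
  case False
  then obtain j where "\<xi> $ j \<noteq> \<eta> $ j"
    by (auto simp: vec_eq_iff)
  moreover have "fcoeff (pd j (character \<eta>)) \<xi> = 2 * pi * \<i> * of_int (\<eta> $ j) * fcoeff (character \<eta>) \<xi>"
    unfolding pd_character fcoeff_def
    by (simp add: mult.assoc)
  then have "of_int (\<xi> $ j) * fcoeff (character \<eta>) \<xi> = of_int (\<eta> $ j) * fcoeff (character \<eta>) \<xi>"
    by (subst (asm) fcoeff_pd)
       (auto simp: character_differentiable periodic_character pd_character
          intro!: continuous_intros continuous_on_character)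
  ultimately show ?thesis
    using False by simp
qed

lemma norm_fcoeff_le:
  fixes f :: "real ^ 'n::finite \<Rightarrow> complex"
  assumes "continuous_on UNIV f" "\<And>x. cmod (f x) \<le> B"
  shows "cmod (fcoeff f \<xi>) \<le> B"
proof -
  have "B \<ge> 0"
    using assms(2)[of 0] norm_ge_zero order_trans by blast
  then have "cmod (fcoeff f \<xi>) \<le> B * measure lborel (cbox 0 (1 :: real ^ 'n))"
    unfolding fcoeff_def
    by (intro has_integral_bound[OF _ integrable_integral] fcoeff_integrable assms)
       (simp_all add: norm_mult norm_character assms)
  then show ?thesis
    by (simp add: content_unit_cube)
qed

lemma fourier_of_test: "fourier (of_test \<phi>) \<xi> = fcoeff (eval \<phi>) \<xi>"
  unfolding fourier_def of_test.rep_eq echar.rep_eq fcoeff_def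
  by (intro integral_torus continuous_intros smooth_continuous_on smooth_eval smooth_character)

section \<open>Completeness of the characters\<close>

lemma periodic_int_shift:
  assumes "periodic f"
  shows "f (x + (\<chi> j. of_int (k j))) = f x"
proof -
  have nat: "f (x + of_nat n *\<^sub>R axis j 1) = f x" for n j x
  proof (induction n)
    case (Suc n)
    have "x + of_nat (Suc n) *\<^sub>R axis j 1 = (x + of_nat n *\<^sub>R axis j 1) + axis j 1"
      by (simp add: algebra_simps)
    then show ?case
      using Suc periodicD[OF assms] by metis
  qed simp
  have int: "f (x + of_int i *\<^sub>R axis j 1) = f x" for i j x
  proof (cases "i \<ge> 0")
    case True
    then show ?thesis
      using nat[of x "nat i" j] by simp
  next
    case False
    then show ?thesis
      using nat[of "x + of_int i *\<^sub>R axis j 1" "nat (- i)" j] by simp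
  qed
  have sum: "f (x + (\<Sum>j\<in>S. of_int (k j) *\<^sub>R axis j 1)) = f x" for S
  proof (induction S rule: infinite_finite_induct)
    case (insert j S)
    then show ?case
      using int[of "x + (\<Sum>j\<in>S. of_int (k j) *\<^sub>R axis j 1)" "k j" j]
      by (simp add: algebra_simps)
  qed simp_all
  have "(\<Sum>j\<in>UNIV. of_int (k j) *\<^sub>R axis j 1) = (\<chi> j. real_of_int (k j))"
    by (simp add: vec_eq_iff axis_def if_distrib cong: if_cong)
  then show ?thesis
    using sum[of UNIV] by simp
qed

section \<open>Density of trigonometric polynomials by Stone-Weierstrass\<close>

inductive trig_poly :: "(real ^ 'n::finite \<Rightarrow> complex) \<Rightarrow> bool" where
  character: "trig_poly (character \<xi>)"
| cmult: "trig_poly f \<Longrightarrow> trig_poly (\<lambda>x. c * f x)"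
| add: "trig_poly f \<Longrightarrow> trig_poly g \<Longrightarrow> trig_poly (\<lambda>x. f x + g x)"

lemma trig_poly_const: "trig_poly (\<lambda>x. c)"
  using trig_poly.cmult[OF trig_poly.character[of 0], of c] by (simp add: character_0)

lemma trig_poly_sum: "(\<And>i. i \<in> I \<Longrightarrow> trig_poly (f i)) \<Longrightarrow> trig_poly (\<lambda>x. \<Sum>i\<in>I. f i x)"
  by (induction I rule: infinite_finite_induct) (auto intro: trig_poly_const trig_poly.add)

lemma trig_poly_mult:
  assumes "trig_poly f" "trig_poly g"
  shows "trig_poly (\<lambda>x. f x * g x)"
  using assms(1)
proof induction
  case (character \<xi>)
  show ?case
    using assms(2)
  proof induction
    case (character \<eta>)
    have "(\<lambda>x. character \<xi> x * character \<eta> x) = character (\<xi> + \<eta>)"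
      by (simp add: character_mult fun_eq_iff)
    then show ?case
      by (simp add: trig_poly.character)
  next
    case (cmult g c)
    then show ?case
      using trig_poly.cmult[OF cmult.IH, of c] by (simp add: mult_ac)
  qed (auto simp: distrib_left intro: trig_poly.add)
next
  case (cmult f c)
  then show ?case
    using trig_poly.cmult[OF cmult.IH, of c] by (simp add: mult_ac)
qed (auto simp: distrib_right intro: trig_poly.add)

lemma trig_poly_continuous_on: "trig_poly f \<Longrightarrow> continuous_on S f"
  by (induction rule: trig_poly.induct) (auto intro!: continuous_intros continuous_on_character)

lemma trig_poly_integral_eq_0:
  assumes cf: "continuous_on UNIV f" and z: "\<And>\<xi>. fcoeff f \<xi> = 0" and "trig_poly g"
  shows "integral (cbox 0 1) (\<lambda>x. f x * g x) = 0"
  using assms(3)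
proof induction
  case (character \<xi>)
  show ?case
    using z[of "- \<xi>"] by (simp add: fcoeff_def)
next
  case (cmult g c)
  then show ?case
    by (simp add: mult.left_commute[of _ c])
next
  case (add g h)
  have "(\<lambda>x. f x * k x) integrable_on cbox 0 1" if "trig_poly k" for k
    by (intro integrable_continuous continuous_intros trig_poly_continuous_on that
        continuous_on_subset[OF cf]) simp
  then show ?case
    using add by (simp add: distrib_left integral_add)
qed

text \<open>Realises the torus as a compact subset of complex n-space. Periodic functions factor
  through it, and polynomials on it pull back to trigonometric polynomials.\<close>

definition torus_embed :: "real ^ 'n \<Rightarrow> complex ^ 'n::finite" where
  "torus_embed x = (\<chi> j. cis (2 * pi * x $ j))"

lemma torus_embed_nth: "torus_embed x $ j = character (axis j 1) x"
  by (simp add: torus_embed_def character_def axis_def if_distrib cong: if_cong)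

lemma continuous_on_torus_embed: "continuous_on S torus_embed"
  unfolding torus_embed_def by (intro continuous_intros continuous_on_vec_lambda)

lemma periodic_torus_embed_eq:
  assumes "periodic f" "torus_embed x = torus_embed y"
  shows "f x = f y"
proof -
  have "\<exists>k::int. x $ j = y $ j + of_int k" for j
  proof -
    have "cis (2 * pi * x $ j) = cis (2 * pi * y $ j)"
      using assms(2) by (simp add: torus_embed_def vec_eq_iff)
    then have "sin (2 * pi * x $ j) = sin (2 * pi * y $ j) \<and> cos (2 * pi * x $ j) = cos (2 * pi * y $ j)"
      by (metis cis.sel)
    then obtain k :: int where "2 * pi * x $ j = 2 * pi * y $ j + 2 * pi * of_int k"
      unfolding sin_cos_eq_iff by blast
    then have "(2 * pi) * x $ j = (2 * pi) * (y $ j + of_int k)"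
      by (simp add: algebra_simps)
    then show ?thesis
      by auto
  qed
  then obtain k :: "'a \<Rightarrow> int" where "\<And>j. x $ j = y $ j + of_int (k j)"
    by metis
  then have "x = y + (\<chi> j. of_int (k j))"
    by (simp add: vec_eq_iff)
  then show ?thesis
    using periodic_int_shift[OF assms(1)] by simp
qed

text \<open>Only linear generators need work: a real-linear functional is determined by its values
  on \<open>axis j 1\<close> and \<open>axis j \<i>\<close>, and real and imaginary parts on the
  unit circle are combinations of a point and its conjugate, hence of two characters.\<close>

lemma trig_poly_real_polynomial:
  assumes "real_polynomial_function p"
  shows "trig_poly (\<lambda>x. complex_of_real (p (torus_embed x)))"
  using assms
proof induction
  case (linear p)
  interpret bounded_linear p by fact
  have "complex_of_real (p (torus_embed x)) =
      (\<Sum>j\<in>UNIV. of_real (p (axis j 1)) * ((1 / 2) * (character (axis j 1) x + character (- axis j 1) x)) +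
         of_real (p (axis j \<i>)) * ((- \<i> / 2) * (character (axis j 1) x + (- 1) * character (- axis j 1) x)))"
    (is "_ = (\<Sum>j\<in>UNIV. ?t j)") for x
  proof -
    have "p (torus_embed x) = p (\<Sum>j\<in>UNIV. axis j (torus_embed x $ j))"
      by (rule arg_cong[of _ _ p]) (simp add: vec_eq_iff axis_def if_distrib cong: if_cong)
    also have "\<dots> = (\<Sum>j\<in>UNIV. p (axis j (torus_embed x $ j)))"
      by (rule sum)
    also have "complex_of_real \<dots> = (\<Sum>j\<in>UNIV. of_real (p (axis j (torus_embed x $ j))))"
      by simp
    also have "\<dots> = (\<Sum>j\<in>UNIV. ?t j)"
    proof (rule sum.cong[OF refl])
      fix j
      let ?z = "torus_embed x $ j"
      have "axis j ?z = Re ?z *\<^sub>R axis j 1 + Im ?z *\<^sub>R axis j \<i>"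
        by (simp add: vec_eq_iff axis_def complex_eq_iff)
      then have "p (axis j ?z) = Re ?z * p (axis j 1) + Im ?z * p (axis j \<i>)"
        by (simp add: add scaleR)
      moreover have "of_real (Re ?z) = (1 / 2) * (?z + cnj ?z)" "of_real (Im ?z) = (- \<i> / 2) * (?z + (- 1) * cnj ?z)"
        by (simp_all add: complex_eq_iff)
      ultimately show "of_real (p (axis j ?z)) = ?t j"
        by (simp add: torus_embed_nth cnj_character mult_ac)
    qed
    finally show ?thesis .
  qed
  then show ?case
    by (simp only:) (intro trig_poly_sum trig_poly.intros)
qed (auto intro: trig_poly_const trig_poly.add trig_poly_mult)

lemma trig_poly_polynomial:
  fixes g :: "complex ^ 'n::finite \<Rightarrow> complex"
  assumes "polynomial_function g"
  shows "trig_poly (\<lambda>x. g (torus_embed x))"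
proof -
  have "real_polynomial_function (Re \<circ> g)" "real_polynomial_function (Im \<circ> g)"
    using assms bounded_linear_Re bounded_linear_Im unfolding polynomial_function_def by blast+
  then have "trig_poly (\<lambda>x. of_real ((Re \<circ> g) (torus_embed x)) + \<i> * of_real ((Im \<circ> g) (torus_embed x)))"
    by (intro trig_poly.intros trig_poly_real_polynomial)
  then show ?thesis
    by (simp flip: complex_eq)
qed

text \<open>\<open>f\<close> descends to a continuous function \<open>F\<close> on the compact image
  of the cube, where polynomials are uniformly dense.\<close>

lemma trig_poly_approx:
  fixes f :: "real ^ 'n::finite \<Rightarrow> complex"
  assumes cf: "continuous_on UNIV f" and per: "periodic f" and e: "e > 0"
  shows "\<exists>g. trig_poly g \<and> (\<forall>x\<in>cbox 0 1. cmod (f x - g x) < e)"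
proof -
  let ?I = "cbox 0 (1 :: real ^ 'n)" and ?K = "torus_embed ` cbox 0 (1 :: real ^ 'n)"
  \<comment> \<open>Any preimage in the cube may be chosen: by periodicity all of them have the same
    value under \<open>f\<close>.\<close>
  define F where "F z = f (SOME x. x \<in> ?I \<and> torus_embed x = z)" for z
  have F: "F (torus_embed x) = f x" if "x \<in> ?I" for x
  proof -
    have "torus_embed (SOME y. y \<in> ?I \<and> torus_embed y = torus_embed x) = torus_embed x"
      using someI[of "\<lambda>y. y \<in> ?I \<and> torus_embed y = torus_embed x" x] that by blast
    then show ?thesis
      unfolding F_def by (rule periodic_torus_embed_eq[OF per])
  qed
  have "continuous_on ?K F"
    unfolding continuous_openin_preimage_eq
  proof (intro allI impI)
    fix T :: "complex set"
    assume "open T"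
    \<comment> \<open>On the compact cube \<open>torus_embed\<close> is a quotient map onto its
      image, so openness of a preimage under \<open>F\<close> may be tested after pulling it back to
      the cube, where \<open>F\<close> becomes \<open>f\<close>.\<close>
    have "openin (top_of_set ?I) (?I \<inter> torus_embed -` (?K \<inter> F -` T))
        \<longleftrightarrow> openin (top_of_set ?K) (?K \<inter> F -` T)"
      by (rule Abstract_Topology_2.continuous_imp_quotient_map[OF continuous_on_torus_embed]) auto
    moreover have "?I \<inter> torus_embed -` (?K \<inter> F -` T) = ?I \<inter> f -` T"
    proof -
      have "x \<in> ?I \<inter> torus_embed -` (?K \<inter> F -` T) \<longleftrightarrow> x \<in> ?I \<inter> f -` T" for x
        by (cases "x \<in> ?I") (simp_all add: F)
      then show ?thesis
        by blast
    qed
    moreover have "openin (top_of_set ?I) (?I \<inter> f -` T)"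
      using \<open>open T\<close> by (intro continuous_openin_preimage_gen continuous_on_subset[OF cf]) auto
    ultimately show "openin (top_of_set ?K) (?K \<inter> F -` T)"
      by simp
  qed
  then have "\<exists>g. polynomial_function g \<and> (\<forall>z\<in>?K. cmod (F z - g z) < e)"
    by (intro Stone_Weierstrass_polynomial_function e
        compact_continuous_image[OF continuous_on_torus_embed compact_cbox])
  then obtain g where g: "polynomial_function g" "\<And>z. z \<in> ?K \<Longrightarrow> cmod (F z - g z) < e"
    by auto
  then have "cmod (f x - g (torus_embed x)) < e" if "x \<in> ?I" for x
    using F[OF that] g(2)[of "torus_embed x"] that by simp
  then show ?thesis
    using trig_poly_polynomial[OF g(1)] by blast
qed

text \<open>Such an \<open>f\<close> is annihilated by all trigonometric polynomials. Approximating
  the conjugate of \<open>f\<close> by them shows that the integral of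
  \<open>(cmod (f x))\<^sup>2\<close> is 0.\<close>

lemma fcoeff_eq_0_imp_eq_0:
  fixes f :: "real ^ 'n::finite \<Rightarrow> complex"
  assumes cf: "continuous_on UNIV f" and per: "periodic f" and z: "\<And>\<xi>. fcoeff f \<xi> = 0"
  shows "f x = 0"
proof -
  let ?I = "cbox 0 (1 :: real ^ 'n)"
  note cf' = continuous_on_subset[OF cf subset_UNIV]
  have "bounded (f ` ?I)"
    by (intro compact_imp_bounded compact_continuous_image cf' compact_cbox)
  then obtain B where B: "B > 0" "\<And>x. x \<in> ?I \<Longrightarrow> cmod (f x) \<le> B"
    by (auto simp: bounded_pos)
  have int: "(\<lambda>x. f x * h x) integrable_on ?I" if "continuous_on ?I h" for h
    by (intro integrable_continuous continuous_intros cf' that)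
  let ?J = "integral ?I (\<lambda>x. f x * cnj (f x))"
  have "cmod ?J \<le> B * e" if e: "e > 0" for e
  proof -
    have "continuous_on UNIV (\<lambda>x. cnj (f x))" "periodic (\<lambda>x. cnj (f x))"
      using cf per by (auto intro: continuous_intros simp: periodic_def)
    then obtain g where g: "trig_poly g" "\<And>x. x \<in> ?I \<Longrightarrow> cmod (cnj (f x) - g x) < e"
      using trig_poly_approx e by blast
    note cg = trig_poly_continuous_on[OF g(1)]
    have "?J = integral ?I (\<lambda>x. f x * cnj (f x)) - integral ?I (\<lambda>x. f x * g x)"
      using trig_poly_integral_eq_0[OF cf z g(1)] by simp
    also have "\<dots> = integral ?I (\<lambda>x. f x * (cnj (f x) - g x))"
      unfolding right_diff_distrib
      by (intro integral_diff[symmetric] int cg continuous_intros cf')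
    also have "cmod \<dots> \<le> (B * e) * measure lborel ?I"
    proof (rule has_integral_bound[OF _ integrable_integral])
      show "cmod (f x * (cnj (f x) - g x)) \<le> B * e" if "x \<in> ?I" for x
        unfolding norm_mult using B g(2)[OF that] that by (intro mult_mono) auto
    qed (use B e in \<open>auto intro!: int continuous_intros cg cf'\<close>)
    finally show ?thesis
      by (simp add: content_unit_cube)
  qed
  from this[of "e / B" for e] have "cmod ?J \<le> e" if "e > 0" for e
    using B that by simp
  then have "?J = 0"
    using field_le_epsilon[of "cmod ?J" 0] by simp
  moreover have "?J = of_real (integral ?I (\<lambda>x. (cmod (f x))\<^sup>2))"
    unfolding complex_norm_square[symmetric]
    using integral_linear[OF integrable_continuous bounded_linear_of_real, of 0 1 "\<lambda>x. (cmod (f x))\<^sup>2"]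
    by (simp add: o_def continuous_intros cf')
  ultimately have "integral ?I (\<lambda>x. (cmod (f x))\<^sup>2) = 0"
    by simp
  then have 0: "f x = 0" if "x \<in> ?I" for x
    by (subst (asm) integral_cbox_eq_0_iff)
       (use that in \<open>auto intro!: continuous_intros cf' simp: interval_ne_empty_cart\<close>)
  \<comment> \<open>Subtracting integer parts brings an arbitrary point into the unit cube.\<close>
  have "f (x + (\<chi> j. of_int (- \<lfloor>x $ j\<rfloor>))) = 0"
    by (rule 0) (auto simp: mem_box_cart, linarith)
  then show ?thesis
    unfolding periodic_int_shift[OF per] .
qed

section \<open>Fourier series with rapidly decaying coefficients\<close>

lemma rho_sq: "(rho \<xi>)\<^sup>2 = 1 + (\<Sum>j\<in>UNIV. (real_of_int (\<xi> $ j))\<^sup>2)"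
  by (simp add: rho_def norm_vec_def L2_set_def sum_nonneg add_nonneg_nonneg)

lemma rho_ge_1: "1 \<le> rho \<xi>"
  by (simp add: rho_def)

lemma rho_pos: "0 < rho \<xi>"
  using rho_ge_1[of \<xi>] by linarith

lemma rho_minus: "rho (- \<xi>) = rho \<xi>"
  by (rule power2_eq_imp_eq) (simp_all add: rho_sq less_imp_le[OF rho_pos])

lemma abs_nth_le_rho: "\<bar>real_of_int (\<xi> $ j)\<bar> \<le> rho \<xi>"
proof (rule power2_le_imp_le)
  have "(real_of_int (\<xi> $ j))\<^sup>2 \<le> (\<Sum>j\<in>UNIV. (real_of_int (\<xi> $ j))\<^sup>2)"
    by (rule member_le_sum) auto
  then show "\<bar>real_of_int (\<xi> $ j)\<bar>\<^sup>2 \<le> (rho \<xi>)\<^sup>2"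
    by (simp add: rho_sq)
qed (simp add: less_imp_le[OF rho_pos])

text \<open>Cubes serve as truncation sets because sums of products over them factor by coordinates
  and because they are invariant under negation.\<close>

definition lattice_cube :: "nat \<Rightarrow> (int ^ 'n::finite) set" where
  "lattice_cube N = {\<xi>. \<forall>j. \<xi> $ j \<in> {- int N..int N}}"

lemma lattice_cube_eq: "lattice_cube N = vec_lambda ` (PiE UNIV (\<lambda>_. {- int N..int N}))"
proof -
  have "\<xi> \<in> vec_lambda ` (PiE UNIV (\<lambda>_. {- int N..int N}))" if "\<xi> \<in> lattice_cube N" for \<xi> :: "int ^ 'a"
    using that by (intro image_eqI[of _ _ "\<lambda>j. \<xi> $ j"]) (auto simp: lattice_cube_def)
  then show ?thesis
    by (auto simp: lattice_cube_def PiE_def Pi_def)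
qed

lemma finite_lattice_cube: "finite (lattice_cube N)"
  unfolding lattice_cube_eq by (intro finite_imageI finite_PiE) auto

lemma lattice_cube_mono: "M \<le> N \<Longrightarrow> lattice_cube M \<subseteq> lattice_cube N"
  unfolding lattice_cube_def by (auto intro: order_trans; smt (verit) of_nat_le_iff)

lemma finite_subset_lattice_cube:
  assumes "finite F"
  shows "\<exists>N. F \<subseteq> lattice_cube N"
  using assms
proof induction
  case (insert \<xi> F)
  then obtain N where N: "F \<subseteq> lattice_cube N"
    by blast
  define M where "M = (\<Sum>j\<in>UNIV. nat \<bar>\<xi> $ j\<bar>)"
  have "nat \<bar>\<xi> $ j\<bar> \<le> M" for j
    unfolding M_def by (rule member_le_sum) auto
  then have "\<xi> \<in> lattice_cube M"
    unfolding lattice_cube_def by (smt (verit) atLeastAtMost_iff mem_Collect_eq nat_le_iff)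
  then have "insert \<xi> F \<subseteq> lattice_cube (max M N)"
    using N lattice_cube_mono[of M "max M N"] lattice_cube_mono[of N "max M N"] by auto
  then show ?case
    by blast
qed simp

text \<open>Turns unconditional convergence over finite sets into convergence of a sequence, the
  form needed for termwise differentiation and for the continuity of distributions.\<close>

lemma filterlim_lattice_cube: "filterlim lattice_cube (finite_subsets_at_top UNIV) sequentially"
  unfolding filterlim_def le_filter_def eventually_filtermap
proof (intro allI impI)
  fix P :: "(int ^ 'n) set \<Rightarrow> bool"
  assume "eventually P (finite_subsets_at_top UNIV)"
  then obtain X where X: "finite X" "\<And>Y. finite Y \<Longrightarrow> X \<subseteq> Y \<Longrightarrow> P Y"
    by (auto simp: eventually_finite_subsets_at_top)
  obtain N where "X \<subseteq> lattice_cube N"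
    using finite_subset_lattice_cube[OF X(1)] by blast
  then show "\<forall>\<^sub>F M in sequentially. P (lattice_cube M)"
    using X(2)[OF finite_lattice_cube] lattice_cube_mono
    by (intro eventually_sequentiallyI[of N]) blast
qed

text \<open>The subtracted term makes the induction close: the two new summands together are at most
  \<open>4 / ((N + 1) * (N + 2))\<close>, a telescoping difference. Equality holds for
  \<open>N = 0\<close>.\<close>

lemma sum_inverse_1_plus_sq: "(\<Sum>k\<in>{- int N..int N}. 1 / (1 + (real_of_int k)\<^sup>2)) \<le> 5 - 4 / (real N + 1)"
proof (induction N)
  case (Suc N)
  have "{- int (Suc N)..int (Suc N)} = insert (- int (Suc N)) (insert (int (Suc N)) {- int N..int N})"
    by auto
  then have "(\<Sum>k\<in>{- int (Suc N)..int (Suc N)}. 1 / (1 + (real_of_int k)\<^sup>2)) =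
      2 / (1 + (real N + 1)\<^sup>2) + (\<Sum>k\<in>{- int N..int N}. 1 / (1 + (real_of_int k)\<^sup>2))"
    by (simp add: power2_eq_square algebra_simps)
  also have "\<dots> \<le> 2 / (1 + (real N + 1)\<^sup>2) + (5 - 4 / (real N + 1))"
    using Suc by simp
  also have "\<dots> \<le> 5 - 4 / (real (Suc N) + 1)"
  proof -
    have "2 / (1 + (real N + 1)\<^sup>2) \<le> 2 / ((real N + 1) * (real N + 2) / 2)"
      by (intro divide_left_mono mult_pos_pos) (auto simp: power2_eq_square algebra_simps add_pos_nonneg)
    also have "\<dots> = 4 / (real N + 1) - 4 / (real (Suc N) + 1)"
      by (simp add: field_simps)
    finally show ?thesis
      by simp
  qed
  finally show ?case .
qed simp

lemma prod_1_plus_sq_le: "(\<Prod>j\<in>UNIV. 1 + (real_of_int (\<xi> $ j))\<^sup>2) \<le> rho \<xi> ^ (2 * CARD('n))"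
  for \<xi> :: "int ^ 'n::finite"
proof -
  have "(\<Prod>j\<in>UNIV. 1 + (real_of_int (\<xi> $ j))\<^sup>2) \<le> (\<Prod>j\<in>(UNIV :: 'n set). (rho \<xi>)\<^sup>2)"
    unfolding rho_sq by (intro prod_mono) (auto intro: member_le_sum)
  then show ?thesis
    by (simp add: power_mult)
qed

text \<open>The exponent \<open>2 * CARD('n)\<close> is chosen for convenience: by
  \<open>prod_1_plus_sq_le\<close> the sum over a cube is then dominated by a product of
  one-dimensional sums, each at most 5.\<close>

lemma summable_rho: "(\<lambda>\<xi> :: int ^ 'n::finite. 1 / rho \<xi> ^ (2 * CARD('n))) summable_on UNIV"
proof (rule nonneg_bdd_above_summable_on)
  show "bdd_above (sum (\<lambda>\<xi> :: int ^ 'n. 1 / rho \<xi> ^ (2 * CARD('n))) ` {F. F \<subseteq> UNIV \<and> finite F})"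
  proof (rule bdd_aboveI2)
    fix F :: "(int ^ 'n) set"
    assume "F \<in> {F. F \<subseteq> UNIV \<and> finite F}"
    then obtain N where N: "F \<subseteq> lattice_cube N"
      using finite_subset_lattice_cube by auto
    have "(\<Sum>\<xi>\<in>F. 1 / rho \<xi> ^ (2 * CARD('n))) \<le> (\<Sum>\<xi>\<in>(lattice_cube N :: (int ^ 'n) set). 1 / rho \<xi> ^ (2 * CARD('n)))"
      by (rule sum_mono2[OF finite_lattice_cube N]) (auto simp: less_imp_le[OF rho_pos])
    also have "\<dots> \<le> (\<Sum>\<xi>\<in>(lattice_cube N :: (int ^ 'n) set). \<Prod>j\<in>UNIV. 1 / (1 + (real_of_int (\<xi> $ j))\<^sup>2))"
      unfolding prod_dividef prod.neutral_const
      by (intro sum_mono divide_left_mono prod_1_plus_sq_le mult_pos_pos zero_less_power rho_pos prod_pos)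
         (auto simp: add_pos_nonneg)
    also have "\<dots> = (\<Sum>g\<in>PiE UNIV (\<lambda>_. {- int N..int N}). \<Prod>j\<in>(UNIV :: 'n set). 1 / (1 + (real_of_int (g j))\<^sup>2))"
      unfolding lattice_cube_eq
      by (subst sum.reindex) (auto intro!: inj_onI simp: vec_lambda_inject)
    also have "\<dots> = (\<Prod>j\<in>(UNIV :: 'n set). \<Sum>k\<in>{- int N..int N}. 1 / (1 + (real_of_int k)\<^sup>2))"
      by (rule prod_sum_PiE[symmetric]) auto
    also have "\<dots> \<le> (\<Prod>j\<in>(UNIV :: 'n set). 5)"
    proof (intro prod_mono conjI sum_nonneg)
      show "(\<Sum>k\<in>{- int N..int N}. 1 / (1 + (real_of_int k)\<^sup>2)) \<le> 5"
        using sum_inverse_1_plus_sq[of N] by (rule order_trans) simp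
    qed simp
    finally show "(\<Sum>\<xi>\<in>F. 1 / rho \<xi> ^ (2 * CARD('n))) \<le> (\<Prod>j\<in>(UNIV :: 'n set). 5)" .
  qed
qed (simp add: less_imp_le[OF rho_pos])

definition rapid :: "(int ^ 'n::finite \<Rightarrow> complex) \<Rightarrow> bool" where
  "rapid c \<longleftrightarrow> (\<forall>m. \<exists>B. \<forall>\<xi>. cmod (c \<xi>) * rho \<xi> ^ m \<le> B)"

lemma rapid_abs_summable:
  fixes c :: "int ^ 'n::finite \<Rightarrow> complex"
  assumes "rapid c"
  shows "(\<lambda>\<xi>. cmod (c \<xi>)) summable_on UNIV"
proof -
  obtain B where B: "\<And>\<xi>. cmod (c \<xi>) * rho \<xi> ^ (2 * CARD('n)) \<le> B"
    using assms by (auto simp: rapid_def)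
  show ?thesis
  proof (rule Infinite_Sum.abs_summable_on_comparison_test')
    show "(\<lambda>\<xi> :: int ^ 'n. B * (1 / rho \<xi> ^ (2 * CARD('n)))) summable_on UNIV"
      by (intro summable_on_cmult_right summable_rho)
    show "cmod (c \<xi>) \<le> B * (1 / rho \<xi> ^ (2 * CARD('n)))" for \<xi>
      using B[of \<xi>] rho_pos[of \<xi>] by (simp add: field_simps)
  qed
qed

text \<open>The Fourier multiplier of the partial derivative in direction \<open>j\<close>.\<close>

definition dcoeff :: "'n \<Rightarrow> (int ^ 'n::finite \<Rightarrow> complex) \<Rightarrow> int ^ 'n \<Rightarrow> complex" where
  "dcoeff j c \<xi> = 2 * pi * \<i> * of_int (\<xi> $ j) * c \<xi>"

lemma rapid_dcoeff:
  assumes "rapid c"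
  shows "rapid (dcoeff j c)"
  unfolding rapid_def
proof
  fix m
  obtain B where B: "\<And>\<xi>. cmod (c \<xi>) * rho \<xi> ^ Suc m \<le> B"
    using assms unfolding rapid_def by blast
  have "cmod (dcoeff j c \<xi>) * rho \<xi> ^ m \<le> 2 * pi * B" for \<xi>
  proof -
    have "cmod (dcoeff j c \<xi>) * rho \<xi> ^ m = 2 * pi * (cmod (c \<xi>) * (\<bar>of_int (\<xi> $ j)\<bar> * rho \<xi> ^ m))"
      by (simp add: dcoeff_def norm_mult mult_ac)
    also have "\<dots> \<le> 2 * pi * (cmod (c \<xi>) * (rho \<xi> * rho \<xi> ^ m))"
      by (intro mult_left_mono mult_right_mono abs_nth_le_rho) (auto simp: less_imp_le[OF rho_pos])
    also have "\<dots> \<le> 2 * pi * B"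
      using B[of \<xi>] by (intro mult_left_mono) auto
    finally show ?thesis .
  qed
  then show "\<exists>B. \<forall>\<xi>. cmod (dcoeff j c \<xi>) * rho \<xi> ^ m \<le> B"
    by blast
qed

definition fpartial :: "(int ^ 'n \<Rightarrow> complex) \<Rightarrow> nat \<Rightarrow> real ^ 'n::finite \<Rightarrow> complex" where
  "fpartial c N x = (\<Sum>\<xi>\<in>lattice_cube N. c \<xi> * character \<xi> x)"

definition fseries :: "(int ^ 'n \<Rightarrow> complex) \<Rightarrow> real ^ 'n::finite \<Rightarrow> complex" where
  "fseries c x = (\<Sum>\<^sub>\<infinity>\<xi>. c \<xi> * character \<xi> x)"

text \<open>The Weierstrass M-test applies along all finite sets, since characters have modulus 1;
  the limit is then restricted to cubes.\<close>

lemma uniform_limit_fseries: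
  assumes "rapid c"
  shows "uniform_limit UNIV (fpartial c) (fseries c) sequentially"
proof -
  have "uniform_limit UNIV (\<lambda>F x. \<Sum>\<xi>\<in>F. c \<xi> * character \<xi> x)
      (\<lambda>x. \<Sum>\<^sub>\<infinity>\<xi>. c \<xi> * character \<xi> x) (finite_subsets_at_top UNIV)"
    by (rule Weierstrass_m_test_general[OF _ rapid_abs_summable[OF assms]])
       (simp add: norm_mult norm_character)
  from filterlim_compose[OF this filterlim_lattice_cube] show ?thesis
    by (simp add: fpartial_def[abs_def] fseries_def[abs_def])
qed

lemma has_derivative_fpartial:
  "(fpartial c N has_derivative (\<lambda>h. \<Sum>j\<in>UNIV. of_real (h $ j) * fpartial (dcoeff j c) N x)) (at x)"
proof -
  have "(fpartial c N has_derivative (\<lambda>h. \<Sum>\<xi>\<in>lattice_cube N. c \<xi> *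
      (of_real (2 * pi * (\<Sum>j\<in>UNIV. h $ j * of_int (\<xi> $ j))) * \<i> * character \<xi> x))) (at x)"
    unfolding fpartial_def
    by (intro has_derivative_sum has_derivative_mult_right has_derivative_character)
  moreover have "(\<Sum>\<xi>\<in>lattice_cube N. c \<xi> *
      (of_real (2 * pi * (\<Sum>j\<in>UNIV. h $ j * of_int (\<xi> $ j))) * \<i> * character \<xi> x)) =
      (\<Sum>j\<in>UNIV. of_real (h $ j) * fpartial (dcoeff j c) N x)" for h
    unfolding fpartial_def sum_distrib_left
    by (subst sum.swap) (simp add: dcoeff_def sum_distrib_left sum_distrib_right mult_ac)
  ultimately show ?thesis
    by simp
qed

lemma fpartial_differentiable: "fpartial c N differentiable at x"
  using has_derivative_fpartial differentiableI by blast

lemma pd_fpartial: "pd j (fpartial c N) = fpartial (dcoeff j c) N"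
proof
  fix x
  show "pd j (fpartial c N) x = fpartial (dcoeff j c) N x"
    by (subst pd_eqI[OF has_derivative_fpartial])
       (simp add: axis_def if_distrib[of of_real] if_distrib[of "\<lambda>c. c * _"] cong: if_cong)
qed

text \<open>Termwise differentiation: the differentiated partial sums have coefficients
  \<open>dcoeff j c\<close>, again rapidly decreasing, and hence converge uniformly.\<close>

lemma has_derivative_fseries:
  fixes c :: "int ^ 'n::finite \<Rightarrow> complex"
  assumes c: "rapid c"
  shows "(fseries c has_derivative (\<lambda>h. \<Sum>j\<in>UNIV. of_real (h $ j) * fseries (dcoeff j c) x)) (at x)"
proof -
  have lim: "(\<lambda>N. fpartial c N x) \<longlonglongrightarrow> fseries c x" for x
    by (rule tendsto_uniform_limitI[OF uniform_limit_fseries[OF c] UNIV_I])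
  have "\<exists>g. \<forall>x\<in>UNIV. (\<lambda>N. fpartial c N x) \<longlonglongrightarrow> g x \<and>
      (g has_derivative (\<lambda>h. \<Sum>j\<in>UNIV. of_real (h $ j) * fseries (dcoeff j c) x)) (at x within UNIV)"
  proof (rule has_derivative_sequence[OF convex_UNIV has_derivative_fpartial _ UNIV_I lim])
    fix e :: real
    assume "e > 0"
    \<comment> \<open>Each of the \<open>CARD('n)\<close> partial derivatives contributes an error
      of at most \<open>norm h * d\<close>.\<close>
    define d where "d = e / real CARD('n)"
    have "d > 0"
      using \<open>e > 0\<close> by (simp add: d_def)
    then have "\<forall>\<^sub>F N in sequentially. \<forall>x\<in>UNIV.
        dist (fpartial (dcoeff j c) N x) (fseries (dcoeff j c) x) < d" for j
      by (intro uniform_limitD uniform_limit_fseries rapid_dcoeff c)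
    then have "\<forall>\<^sub>F N in sequentially. \<forall>j\<in>UNIV. \<forall>x\<in>UNIV.
        dist (fpartial (dcoeff j c) N x) (fseries (dcoeff j c) x) < d"
      by (intro eventually_ball_finite) auto
    then show "\<forall>\<^sub>F N in sequentially. \<forall>x\<in>UNIV. \<forall>h.
        cmod ((\<Sum>j\<in>UNIV. of_real (h $ j) * fpartial (dcoeff j c) N x) -
          (\<Sum>j\<in>UNIV. of_real (h $ j) * fseries (dcoeff j c) x)) \<le> e * norm h"
    proof (rule eventually_mono, intro ballI allI)
      fix N and x h :: "real ^ 'n"
      assume *: "\<forall>j\<in>UNIV. \<forall>x\<in>UNIV. dist (fpartial (dcoeff j c) N x) (fseries (dcoeff j c) x) < d"
      have "cmod ((\<Sum>j\<in>UNIV. of_real (h $ j) * fpartial (dcoeff j c) N x) -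
          (\<Sum>j\<in>UNIV. of_real (h $ j) * fseries (dcoeff j c) x)) =
        cmod (\<Sum>j\<in>UNIV. of_real (h $ j) * (fpartial (dcoeff j c) N x - fseries (dcoeff j c) x))"
        by (simp add: right_diff_distrib sum_subtractf)
      also have "\<dots> \<le> (\<Sum>j\<in>(UNIV :: 'n set). norm h * d)"
      proof (rule sum_norm_le)
        fix j
        have "cmod (fpartial (dcoeff j c) N x - fseries (dcoeff j c) x) \<le> d"
          using * by (simp add: dist_norm less_imp_le)
        then show "cmod (of_real (h $ j) * (fpartial (dcoeff j c) N x - fseries (dcoeff j c) x)) \<le> norm h * d"
          unfolding norm_mult by (intro mult_mono) (auto simp: component_le_norm_cart)
      qed
      also have "\<dots> = e * norm h"
        by (simp add: d_def)
      finally show "cmod ((\<Sum>j\<in>UNIV. of_real (h $ j) * fpartial (dcoeff j c) N x) -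
          (\<Sum>j\<in>UNIV. of_real (h $ j) * fseries (dcoeff j c) x)) \<le> e * norm h" .
    qed
  qed
  then obtain g where g: "\<And>x. (\<lambda>N. fpartial c N x) \<longlonglongrightarrow> g x"
    "(g has_derivative (\<lambda>h. \<Sum>j\<in>UNIV. of_real (h $ j) * fseries (dcoeff j c) x)) (at x)"
    by auto
  have "g = fseries c"
    using LIMSEQ_unique[OF g(1) lim] by auto
  then show ?thesis
    using g(2) by simp
qed

lemma pd_fseries: "rapid c \<Longrightarrow> pd j (fseries c) = fseries (dcoeff j c)"
proof
  fix x
  assume "rapid c"
  show "pd j (fseries c) x = fseries (dcoeff j c) x"
    by (subst pd_eqI[OF has_derivative_fseries[OF \<open>rapid c\<close>]])
       (simp add: axis_def if_distrib[of of_real] if_distrib[of "\<lambda>c. c * _"] cong: if_cong)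
qed

lemma rapid_foldr_dcoeff: "rapid c \<Longrightarrow> rapid (foldr dcoeff js c)"
  by (induction js) (simp_all add: rapid_dcoeff)

lemma pds_fseries: "rapid c \<Longrightarrow> pds js (fseries c) = fseries (foldr dcoeff js c)"
  by (induction js) (simp_all add: pd_fseries rapid_foldr_dcoeff)

lemma pds_fpartial: "pds js (fpartial c N) = fpartial (foldr dcoeff js c) N"
  by (induction js) (simp_all add: pd_fpartial)

lemma smooth_fpartial: "smooth (fpartial c N)"
  unfolding smooth_def pds_fpartial by (simp add: fpartial_differentiable)

lemma smooth_fseries: "rapid c \<Longrightarrow> smooth (fseries c)"
  unfolding smooth_def
  by (simp add: pds_fseries) (meson differentiableI has_derivative_fseries rapid_foldr_dcoeff)

lemma periodic_fseries: "periodic (fseries c)"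
  by (simp add: periodic_def fseries_def periodicD[OF periodic_character])

lemma fcoeff_cmult: "fcoeff (\<lambda>x. c * f x) \<xi> = c * fcoeff f \<xi>"
  by (simp add: fcoeff_def mult.assoc)

lemma fcoeff_diff:
  "continuous_on UNIV f \<Longrightarrow> continuous_on UNIV g \<Longrightarrow>
    fcoeff (\<lambda>x. f x - g x) \<xi> = fcoeff f \<xi> - fcoeff g \<xi>"
  by (simp add: fcoeff_def left_diff_distrib integral_diff fcoeff_integrable)

lemma fcoeff_add:
  "continuous_on UNIV f \<Longrightarrow> continuous_on UNIV g \<Longrightarrow>
    fcoeff (\<lambda>x. f x + g x) \<xi> = fcoeff f \<xi> + fcoeff g \<xi>"
  by (simp add: fcoeff_def distrib_right integral_add fcoeff_integrable)

lemma fcoeff_sum: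
  "(\<And>i. i \<in> S \<Longrightarrow> continuous_on UNIV (f i)) \<Longrightarrow>
    fcoeff (\<lambda>x. \<Sum>i\<in>S. f i x) \<xi> = (\<Sum>i\<in>S. fcoeff (f i) \<xi>)"
  by (induction S rule: infinite_finite_induct)
     (auto simp: fcoeff_add continuous_on_sum, simp_all add: fcoeff_def)

lemma fcoeff_fpartial: "fcoeff (fpartial c N) \<xi> = (if \<xi> \<in> lattice_cube N then c \<xi> else 0)"
  unfolding fpartial_def
  by (subst fcoeff_sum)
     (auto intro!: continuous_intros continuous_on_character
       simp: fcoeff_cmult fcoeff_character finite_lattice_cube if_distrib[of "\<lambda>x. _ * x"] cong: if_cong)

text \<open>By \<open>norm_fcoeff_le\<close> uniform convergence passes to coefficients, and the
  coefficient of a partial sum is \<open>c \<xi>\<close> as soon as the cube contains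
  \<open>\<xi>\<close>.\<close>

lemma fcoeff_fseries:
  assumes "rapid c"
  shows "fcoeff (fseries c) \<xi> = c \<xi>"
proof -
  note cs = smooth_continuous_on[OF smooth_fseries[OF assms]] smooth_continuous_on[OF smooth_fpartial]
  have "(\<lambda>N. fcoeff (fpartial c N) \<xi>) \<longlonglongrightarrow> fcoeff (fseries c) \<xi>"
  proof (rule LIMSEQ_I)
    fix e :: real
    assume "e > 0"
    then have "\<forall>\<^sub>F N in sequentially. \<forall>x\<in>UNIV. dist (fpartial c N x) (fseries c x) < e / 2"
      by (intro uniform_limitD uniform_limit_fseries assms) simp
    then have "\<forall>\<^sub>F N in sequentially. cmod (fcoeff (fpartial c N) \<xi> - fcoeff (fseries c) \<xi>) < e"
    proof (rule eventually_mono)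
      fix N
      assume *: "\<forall>x\<in>UNIV. dist (fpartial c N x) (fseries c x) < e / 2"
      have "cmod (fcoeff (\<lambda>x. fpartial c N x - fseries c x) \<xi>) \<le> e / 2"
        using * by (intro norm_fcoeff_le continuous_intros cs) (simp add: dist_norm less_imp_le)
      then show "cmod (fcoeff (fpartial c N) \<xi> - fcoeff (fseries c) \<xi>) < e"
        using \<open>e > 0\<close> by (simp add: fcoeff_diff cs)
    qed
    then show "\<exists>M. \<forall>N\<ge>M. cmod (fcoeff (fpartial c N) \<xi> - fcoeff (fseries c) \<xi>) < e"
      by (simp add: eventually_sequentially)
  qed
  moreover have "(\<lambda>N. fcoeff (fpartial c N) \<xi>) \<longlonglongrightarrow> c \<xi>"
  proof -
    obtain M where "\<xi> \<in> lattice_cube M"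
      using finite_subset_lattice_cube[of "{\<xi>}"] by auto
    then have "\<forall>\<^sub>F N in sequentially. fcoeff (fpartial c N) \<xi> = c \<xi>"
      using lattice_cube_mono[of M]
      by (intro eventually_sequentiallyI[of M]) (auto simp: fcoeff_fpartial)
    then show ?thesis
      by (rule tendsto_eventually)
  qed
  ultimately show ?thesis
    by (rule LIMSEQ_unique)
qed

section \<open>Fourier coefficients of periodic distributions\<close>

lemma continuous_on_eval: "continuous_on S (eval \<phi>)"
  by (rule smooth_continuous_on[OF smooth_eval])

lemma eval_sum: "eval (\<Sum>i\<in>S. f i) x = (\<Sum>i\<in>S. eval (f i) x)"
  by (induction S rule: infinite_finite_induct) (simp_all add: plus_test.rep_eq zero_test.rep_eq)

lemma fcoeff_eval_add: "fcoeff (eval (\<phi> + \<psi>)) \<xi> = fcoeff (eval \<phi>) \<xi> + fcoeff (eval \<psi>) \<xi>"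
  by (simp add: plus_test.rep_eq fcoeff_add continuous_on_eval)

lemma fcoeff_eval_scaleC: "fcoeff (eval (c *\<^sub>C \<phi>)) \<xi> = c * fcoeff (eval \<phi>) \<xi>"
  by (simp add: scaleC_test.rep_eq fcoeff_cmult)

lemma fcoeff_eval_sum: "fcoeff (eval (\<Sum>i\<in>S. f i)) \<xi> = (\<Sum>i\<in>S. fcoeff (eval (f i)) \<xi>)"
  by (induction S rule: infinite_finite_induct)
     (simp_all add: fcoeff_eval_add, simp_all add: fcoeff_def zero_test.rep_eq)

lemma fcoeff_eval_dtest:
  "fcoeff (eval (dtest j \<phi>)) \<xi> = 2 * pi * \<i> * of_int (\<xi> $ j) * fcoeff (eval \<phi>) \<xi>"
  unfolding dtest.rep_eq
  by (intro fcoeff_pd smooth_differentiable smooth_eval periodic_eval smooth_continuous_on smooth_pd)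

lemma eval_bounded: "\<exists>B. \<forall>x. cmod (eval \<phi> x) \<le> B"
proof -
  have "bounded (eval \<phi> ` cbox 0 1)"
    by (intro compact_imp_bounded compact_continuous_image continuous_on_eval compact_cbox)
  then obtain B where B: "\<And>x. x \<in> cbox 0 1 \<Longrightarrow> cmod (eval \<phi> x) \<le> B"
    by (auto simp: bounded_iff)
  have "cmod (eval \<phi> (x + (\<chi> j. of_int (- \<lfloor>x $ j\<rfloor>)))) \<le> B" for x
    by (rule B) (auto simp: mem_box_cart, linarith)
  then show ?thesis
    unfolding periodic_int_shift[OF periodic_eval] by blast
qed

text \<open>The operator 1 minus the Laplacian over \<open>4 * pi\<^sup>2\<close>, normalised so
  that its Fourier multiplier is exactly \<open>(rho \<xi>)\<^sup>2\<close>.\<close>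

definition bessel :: "'n::finite test \<Rightarrow> 'n test" where
  "bessel \<phi> = \<phi> + of_real (- 1 / (4 * pi\<^sup>2)) *\<^sub>C (\<Sum>j\<in>UNIV. dtest j (dtest j \<phi>))"

lemma fcoeff_bessel: "fcoeff (eval (bessel \<phi>)) \<xi> = of_real ((rho \<xi>)\<^sup>2) * fcoeff (eval \<phi>) \<xi>"
  unfolding rho_sq
  by (simp add: bessel_def fcoeff_eval_add fcoeff_eval_scaleC fcoeff_eval_sum fcoeff_eval_dtest
      sum_distrib_left sum_distrib_right distrib_right power2_eq_square field_simps
      flip: sum_negf)

lemma fcoeff_bessel_power:
  "fcoeff (eval ((bessel ^^ m) \<phi>)) \<xi> = of_real (rho \<xi> ^ (2 * m)) * fcoeff (eval \<phi>) \<xi>"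
  by (induction m) (simp_all add: fcoeff_bessel power_mult mult.assoc power2_eq_square)

text \<open>The \<open>m\<close>-th power of \<open>bessel\<close> multiplies coefficients by
  \<open>rho \<xi> ^ (2 * m)\<close>, and its result is again a test function, whose coefficients
  are bounded by its supremum.\<close>

lemma rapid_fcoeff: "rapid (fcoeff (eval \<phi>))"
  unfolding rapid_def
proof
  fix m
  obtain B where B: "\<And>x. cmod (eval ((bessel ^^ m) \<phi>) x) \<le> B"
    using eval_bounded by blast
  have "cmod (fcoeff (eval \<phi>) \<xi>) * rho \<xi> ^ m \<le> B" for \<xi>
  proof -
    have "cmod (fcoeff (eval \<phi>) \<xi>) * rho \<xi> ^ m \<le> cmod (fcoeff (eval \<phi>) \<xi>) * rho \<xi> ^ (2 * m)"
      by (intro mult_left_mono power_increasing rho_ge_1) auto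
    also have "\<dots> = cmod (fcoeff (eval ((bessel ^^ m) \<phi>)) \<xi>)"
      by (simp add: fcoeff_bessel_power norm_mult norm_power less_imp_le[OF rho_pos] mult.commute)
    also have "\<dots> \<le> B"
      by (intro norm_fcoeff_le continuous_on_eval B)
    finally show ?thesis .
  qed
  then show "\<exists>B. \<forall>\<xi>. cmod (fcoeff (eval \<phi>) \<xi>) * rho \<xi> ^ m \<le> B"
    by blast
qed

text \<open>Both functions are continuous and periodic with the same coefficients, so completeness
  of the characters applies to their difference.\<close>

lemma fseries_fcoeff: "fseries (fcoeff (eval \<phi>)) = eval \<phi>"
proof
  fix x
  let ?f = "fseries (fcoeff (eval \<phi>))"
  have c: "continuous_on UNIV ?f"
    by (intro smooth_continuous_on smooth_fseries rapid_fcoeff)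
  have "?f x - eval \<phi> x = 0"
  proof (rule fcoeff_eq_0_imp_eq_0[of "\<lambda>x. ?f x - eval \<phi> x"])
    show "periodic (\<lambda>x. ?f x - eval \<phi> x)"
      by (simp add: periodic_def periodicD[OF periodic_fseries] periodicD[OF periodic_eval])
    show "fcoeff (\<lambda>x. ?f x - eval \<phi> x) \<xi> = 0" for \<xi>
      by (simp add: fcoeff_diff c continuous_on_eval fcoeff_fseries rapid_fcoeff)
  qed (intro continuous_intros c continuous_on_eval)
  then show "?f x = eval \<phi> x"
    by simp
qed

text \<open>Every derivative of a truncated series is the truncation of a rapidly decreasing series,
  so it converges uniformly. Hence a distribution is determined by its values on characters.\<close>

lemma test_tendsto_fourier:
  "test_tendsto (\<lambda>N. \<Sum>\<xi>\<in>lattice_cube N. fcoeff (eval \<phi>) \<xi> *\<^sub>C echar \<xi>) \<phi>"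
proof -
  have "eval (\<Sum>\<xi>\<in>lattice_cube N. fcoeff (eval \<phi>) \<xi> *\<^sub>C echar \<xi>) = fpartial (fcoeff (eval \<phi>)) N" for N
    by (simp add: fun_eq_iff eval_sum scaleC_test.rep_eq echar.rep_eq fpartial_def)
  moreover have "pds js (eval \<phi>) = fseries (foldr dcoeff js (fcoeff (eval \<phi>)))" for js
    using pds_fseries[OF rapid_fcoeff, of js \<phi>] by (simp add: fseries_fcoeff)
  ultimately show ?thesis
    by (simp add: test_tendsto_def pds_fpartial uniform_limit_fseries rapid_foldr_dcoeff rapid_fcoeff)
qed

lemma pairing_add: "pairing g (\<phi> + \<psi>) = pairing g \<phi> + pairing g \<psi>"
  and pairing_scaleC: "pairing g (c *\<^sub>C \<phi>) = c * pairing g \<phi>"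
  using pairing[of g] by (auto simp: clinear_def scaleC_complex_def)

lemma pairing_0: "pairing g 0 = 0"
  using pairing_add[of g 0 0] by simp

lemma pairing_sum: "pairing g (\<Sum>i\<in>S. f i) = (\<Sum>i\<in>S. pairing g (f i))"
  by (induction S rule: infinite_finite_induct) (simp_all add: pairing_add pairing_0)

lemma pairing_tendsto: "test_tendsto \<Phi> \<phi> \<Longrightarrow> (\<lambda>k. pairing g (\<Phi> k)) \<longlonglongrightarrow> pairing g \<phi>"
  using pairing[of g] by auto

text \<open>Parseval in distributional form; the sign arises because
  \<open>fourier g (- \<xi>)\<close> is the pairing of \<open>g\<close> with
  \<open>echar \<xi>\<close>.\<close>

lemma pairing_fourier:
  "(\<lambda>N. \<Sum>\<xi>\<in>lattice_cube N. fcoeff (eval \<phi>) \<xi> * fourier g (- \<xi>)) \<longlonglongrightarrow> pairing g \<phi>"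
  using pairing_tendsto[OF test_tendsto_fourier]
  by (simp add: pairing_sum pairing_scaleC fourier_def)

lemma fourier_inject:
  assumes "\<And>\<xi>. fourier g \<xi> = fourier h \<xi>"
  shows "g = h"
proof -
  have "pairing g \<phi> = pairing h \<phi>" for \<phi>
    using pairing_fourier[of \<phi> g] pairing_fourier[of \<phi> h] unfolding assms by (rule LIMSEQ_unique)
  then show ?thesis
    by (simp add: pairing_inject[symmetric] fun_eq_iff)
qed

lemma fourier_zero: "fourier 0 \<xi> = 0"
  by (simp add: fourier_def zero_pdistr.rep_eq)

lemma fourier_add: "fourier (g + h) \<xi> = fourier g \<xi> + fourier h \<xi>"
  by (simp add: fourier_def plus_pdistr.rep_eq)

lemma fourier_diff: "fourier (g - h) \<xi> = fourier g \<xi> - fourier h \<xi>"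
  by (simp add: fourier_def minus_pdistr.rep_eq)

lemma fourier_minus: "fourier (- g) \<xi> = - fourier g \<xi>"
  by (simp add: fourier_def uminus_pdistr.rep_eq)

lemma fourier_scaleC: "fourier (c *\<^sub>C g) \<xi> = c * fourier g \<xi>"
  by (simp add: fourier_def scaleC_pdistr.rep_eq)

lemma fourier_sum: "fourier (\<Sum>i\<in>S. f i) \<xi> = (\<Sum>i\<in>S. fourier (f i) \<xi>)"
  by (induction S rule: infinite_finite_induct) (simp_all add: fourier_add fourier_zero)

lemma fourier_D: "fourier (D j g) \<xi> = 2 * pi * \<i> * of_int (\<xi> $ j) * fourier g \<xi>"
proof -
  have "dtest j (echar (- \<xi>)) = (- (2 * pi * \<i> * of_int (\<xi> $ j))) *\<^sub>C echar (- \<xi>)"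
    by (simp add: eval_inject[symmetric] dtest.rep_eq echar.rep_eq scaleC_test.rep_eq pd_character)
  then show ?thesis
    by (simp add: fourier_def D.rep_eq pairing_scaleC)
qed

lemma test_tendsto_add:
  assumes "test_tendsto \<Phi> \<phi>" "test_tendsto \<Psi> \<psi>"
  shows "test_tendsto (\<lambda>k. \<Phi> k + \<Psi> k) (\<phi> + \<psi>)"
  using assms unfolding test_tendsto_def plus_test.rep_eq pds_add[OF smooth_eval smooth_eval]
  by (auto intro: uniform_limit_add)

lemma test_tendsto_scaleC:
  assumes "test_tendsto \<Phi> \<phi>"
  shows "test_tendsto (\<lambda>k. c *\<^sub>C \<Phi> k) (c *\<^sub>C \<phi>)"
  using assms unfolding test_tendsto_def scaleC_test.rep_eq pds_cmult[OF smooth_eval]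
  by (intro allI bounded_linear.uniform_limit[OF bounded_linear_mult_right]) (rule spec)

lemma test_tendsto_sum:
  assumes "\<And>i. i \<in> S \<Longrightarrow> test_tendsto (\<Phi> i) (\<phi> i)"
  shows "test_tendsto (\<lambda>k. \<Sum>i\<in>S. \<Phi> i k) (\<Sum>i\<in>S. \<phi> i)"
proof -
  have 0: "test_tendsto (\<lambda>k. 0) 0"
    by (simp add: test_tendsto_def uniform_limit_const)
  show ?thesis
    using assms by (induction S rule: infinite_finite_induct) (simp_all add: test_tendsto_add 0)
qed

lemma test_tendsto_bessel: "test_tendsto \<Phi> \<phi> \<Longrightarrow> test_tendsto (\<lambda>k. bessel (\<Phi> k)) (bessel \<phi>)"
  unfolding bessel_def
  by (intro test_tendsto_add test_tendsto_scaleC test_tendsto_sum test_tendsto_dtest)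

lemma test_tendsto_bessel_power:
  "test_tendsto \<Phi> \<phi> \<Longrightarrow> test_tendsto (\<lambda>k. (bessel ^^ m) (\<Phi> k)) ((bessel ^^ m) \<phi>)"
  by (induction m) (simp_all add: test_tendsto_bessel)

text \<open>Powers of \<open>bessel\<close> preserve convergence of test functions, and the
  coefficients of their uniformly small difference carry the weight. This gives the continuity of
  distributions built from coefficients.\<close>

lemma test_tendsto_fcoeff:
  assumes "test_tendsto \<Phi> \<phi>" "e > 0"
  shows "\<forall>\<^sub>F k in sequentially. \<forall>\<xi>.
    cmod (fcoeff (eval (\<Phi> k)) \<xi> - fcoeff (eval \<phi>) \<xi>) * rho \<xi> ^ (2 * m) \<le> e"
proof -
  have "uniform_limit UNIV (\<lambda>k. pds [] (eval ((bessel ^^ m) (\<Phi> k)))) (pds [] (eval ((bessel ^^ m) \<phi>))) sequentially"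
    using test_tendsto_bessel_power[OF assms(1)] unfolding test_tendsto_def by blast
  from uniform_limitD[OF this assms(2)] have "\<forall>\<^sub>F k in sequentially. \<forall>x\<in>UNIV.
      dist (eval ((bessel ^^ m) (\<Phi> k)) x) (eval ((bessel ^^ m) \<phi>) x) < e"
    by simp
  then show ?thesis
  proof (rule eventually_mono, intro allI)
    fix k \<xi>
    assume *: "\<forall>x\<in>UNIV. dist (eval ((bessel ^^ m) (\<Phi> k)) x) (eval ((bessel ^^ m) \<phi>) x) < e"
    have "cmod (fcoeff (\<lambda>x. eval ((bessel ^^ m) (\<Phi> k)) x - eval ((bessel ^^ m) \<phi>) x) \<xi>) \<le> e"
      using * by (intro norm_fcoeff_le continuous_intros continuous_on_eval)
         (simp add: dist_norm less_imp_le)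
    also have "fcoeff (\<lambda>x. eval ((bessel ^^ m) (\<Phi> k)) x - eval ((bessel ^^ m) \<phi>) x) \<xi> =
        of_real (rho \<xi> ^ (2 * m)) * (fcoeff (eval (\<Phi> k)) \<xi> - fcoeff (eval \<phi>) \<xi>)"
      by (simp add: fcoeff_diff continuous_on_eval fcoeff_bessel_power right_diff_distrib)
    finally show "cmod (fcoeff (eval (\<Phi> k)) \<xi> - fcoeff (eval \<phi>) \<xi>) * rho \<xi> ^ (2 * m) \<le> e"
      by (simp add: norm_mult norm_power less_imp_le[OF rho_pos] mult.commute)
  qed
qed

section \<open>Distributions with prescribed Fourier coefficients\<close>

definition temperate :: "(int ^ 'n::finite \<Rightarrow> complex) \<Rightarrow> bool" where
  "temperate c \<longleftrightarrow> (\<exists>B m. \<forall>\<xi>. cmod (c \<xi>) \<le> B * rho \<xi> ^ m)"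

lemma rapid_temperate_mult:
  fixes c :: "int ^ 'n::finite \<Rightarrow> complex"
  assumes "temperate c" "rapid d"
  shows "rapid (\<lambda>\<xi>. c \<xi> * d (- \<xi>))"
  unfolding rapid_def
proof
  fix k
  obtain B m where B: "\<And>\<xi>. cmod (c \<xi>) \<le> B * rho \<xi> ^ m"
    using assms(1) by (auto simp: temperate_def)
  then have B0: "B \<ge> 0"
    using order_trans[OF norm_ge_zero B, of 0] zero_less_power[OF rho_pos[of "0 :: int ^ 'n"], of m]
    by (auto simp: zero_le_mult_iff)
  obtain A where A: "\<And>\<xi>. cmod (d \<xi>) * rho \<xi> ^ (m + k) \<le> A"
    using assms(2) by (auto simp: rapid_def)
  have "cmod (c \<xi> * d (- \<xi>)) * rho \<xi> ^ k \<le> B * A" for \<xi>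
  proof -
    have "cmod (c \<xi> * d (- \<xi>)) * rho \<xi> ^ k \<le> (B * rho \<xi> ^ m) * cmod (d (- \<xi>)) * rho \<xi> ^ k"
      unfolding norm_mult using B by (intro mult_right_mono) (auto simp: less_imp_le[OF rho_pos])
    also have "\<dots> = B * (cmod (d (- \<xi>)) * rho (- \<xi>) ^ (m + k))"
      by (simp add: rho_minus power_add mult_ac)
    also have "\<dots> \<le> B * A"
      using A B0 by (intro mult_left_mono) auto
    finally show ?thesis .
  qed
  then show "\<exists>B. \<forall>\<xi>. cmod (c \<xi> * d (- \<xi>)) * rho \<xi> ^ k \<le> B"
    by blast
qed

text \<open>\<open>G\<close> is the Parseval pairing with the prescribed coefficients. For
  continuity, \<open>m\<close> powers in the weight of \<open>test_tendsto_fcoeff\<close> absorb the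
  growth of \<open>c\<close> and \<open>CARD('n)\<close> further ones leave the summable majorant of
  \<open>summable_rho\<close>.\<close>

lemma ex_fourier:
  fixes c :: "int ^ 'n::finite \<Rightarrow> complex"
  assumes c: "temperate c"
  shows "\<exists>g. \<forall>\<xi>. fourier g \<xi> = c \<xi>"
proof -
  define G where "G \<phi> = (\<Sum>\<^sub>\<infinity>\<xi>. c \<xi> * fcoeff (eval \<phi>) (- \<xi>))" for \<phi>
  have sum: "(\<lambda>\<xi>. c \<xi> * fcoeff (eval \<phi>) (- \<xi>)) summable_on UNIV" for \<phi>
    using rapid_abs_summable[OF rapid_temperate_mult[OF c rapid_fcoeff]] by (rule abs_summable_summable)
  have lin: "clinear G"
    unfolding clinear_def
  proof (intro conjI allI)
    show "G (\<phi> + \<psi>) = G \<phi> + G \<psi>" for \<phi> \<psi>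
      unfolding G_def fcoeff_eval_add distrib_left by (intro infsum_add sum)
    show "G (a *\<^sub>C \<phi>) = a *\<^sub>C G \<phi>" for a \<phi>
      unfolding G_def fcoeff_eval_scaleC scaleC_complex_def mult.left_commute[of _ a]
      by (rule infsum_cmult_right')
  qed
  obtain B m where "\<And>\<xi>. cmod (c \<xi>) \<le> B * rho \<xi> ^ m"
    using c by (auto simp: temperate_def)
  \<comment> \<open>The maximum with 1 makes the constant positive, so that it may be divided by
    below.\<close>
  then have B: "cmod (c \<xi>) \<le> max B 1 * rho \<xi> ^ m" for \<xi>
    by (rule order_trans) (simp add: mult_right_mono less_imp_le[OF rho_pos])
  define R where "R = (\<Sum>\<^sub>\<infinity>\<xi> :: int ^ 'n. 1 / rho \<xi> ^ (2 * CARD('n)))"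
  have R: "R \<ge> 0"
    unfolding R_def by (rule infsum_nonneg) (simp add: less_imp_le[OF rho_pos])
  have cont: "(\<lambda>k. G (\<Phi> k)) \<longlonglongrightarrow> G \<phi>" if \<Phi>: "test_tendsto \<Phi> \<phi>" for \<Phi> \<phi>
  proof (rule LIMSEQ_I)
    fix e :: real
    assume "e > 0"
    \<comment> \<open>The total error will be at most \<open>max B 1 * d * R\<close>; using
      \<open>R + 1\<close> in the denominator makes it strictly less than \<open>e\<close> and
      avoids division by zero.\<close>
    define d where "d = e / (max B 1 * (R + 1))"
    have d: "d > 0"
      using \<open>e > 0\<close> R by (simp add: d_def)
    have "\<forall>\<^sub>F k in sequentially. cmod (G (\<Phi> k) - G \<phi>) < e"
      using test_tendsto_fcoeff[OF \<Phi> d, of "m + CARD('n)"]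
    proof (rule eventually_mono)
      fix k
      assume k: "\<forall>\<xi>. cmod (fcoeff (eval (\<Phi> k)) \<xi> - fcoeff (eval \<phi>) \<xi>) * rho \<xi> ^ (2 * (m + CARD('n))) \<le> d"
      have "((\<lambda>\<xi>. c \<xi> * fcoeff (eval (\<Phi> k)) (- \<xi>) - c \<xi> * fcoeff (eval \<phi>) (- \<xi>)) has_sum (G (\<Phi> k) - G \<phi>)) UNIV"
        unfolding G_def using has_sum_add[OF has_sum_infsum[OF sum] has_sum_uminusI[OF has_sum_infsum[OF sum]]]
        by simp
      moreover have "((\<lambda>\<xi> :: int ^ 'n. (max B 1 * d) * (1 / rho \<xi> ^ (2 * CARD('n)))) has_sum ((max B 1 * d) * R)) UNIV"
        unfolding R_def by (intro has_sum_cmult_right has_sum_infsum summable_rho)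
      ultimately have "cmod (G (\<Phi> k) - G \<phi>) \<le> (max B 1 * d) * R"
      proof (rule norm_infsum_le)
        fix \<xi> :: "int ^ 'n"
        let ?\<Delta> = "cmod (fcoeff (eval (\<Phi> k)) (- \<xi>) - fcoeff (eval \<phi>) (- \<xi>))"
        have "cmod (c \<xi> * fcoeff (eval (\<Phi> k)) (- \<xi>) - c \<xi> * fcoeff (eval \<phi>) (- \<xi>)) = cmod (c \<xi>) * ?\<Delta>"
          by (simp add: norm_mult flip: right_diff_distrib)
        also have "\<dots> \<le> (max B 1 * rho \<xi> ^ m) * (d / rho \<xi> ^ (2 * (m + CARD('n))))"
          using spec[OF k, of "- \<xi>"] by (intro mult_mono B) (auto simp: field_simps rho_minus rho_pos less_imp_le[OF rho_pos] intro!: mult_nonneg_nonneg)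
        \<comment> \<open>Raising the power from \<open>m\<close> to \<open>2 * m\<close> matches
          the even exponent that powers of \<open>bessel\<close> supply.\<close>
        also have "\<dots> \<le> (max B 1 * rho \<xi> ^ (2 * m)) * (d / rho \<xi> ^ (2 * (m + CARD('n))))"
          using d by (intro mult_right_mono mult_left_mono power_increasing rho_ge_1)
             (auto simp: less_imp_le[OF rho_pos])
        also have "\<dots> = (max B 1 * d) * (1 / rho \<xi> ^ (2 * CARD('n)))"
          using rho_pos[of \<xi>] by (simp add: power_add distrib_left)
        finally show "cmod (c \<xi> * fcoeff (eval (\<Phi> k)) (- \<xi>) - c \<xi> * fcoeff (eval \<phi>) (- \<xi>)) \<le> \<dots>" .
      qed
      also have "\<dots> < max B 1 * d * (R + 1)"
        using d by (intro mult_strict_left_mono) auto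
      also have "\<dots> = e"
        using R by (simp add: d_def)
      finally show "cmod (G (\<Phi> k) - G \<phi>) < e" .
    qed
    then show "\<exists>M. \<forall>k\<ge>M. cmod (G (\<Phi> k) - G \<phi>) < e"
      by (simp add: eventually_sequentially)
  qed
  have "pairing (Abs_pdistr G) = G"
    using lin cont by (intro Abs_pdistr_inverse) simp
  moreover have "G (echar (- \<xi>)) = c \<xi>" for \<xi>
  proof -
    have "G (echar (- \<xi>)) = (\<Sum>\<^sub>\<infinity>\<eta>\<in>{\<xi>}. c \<eta> * fcoeff (eval (echar (- \<xi>))) (- \<eta>))"
      unfolding G_def by (rule infsum_cong_neutral) (auto simp: echar.rep_eq fcoeff_character)
    then show ?thesis
      by (simp add: echar.rep_eq fcoeff_character)
  qed
  ultimately show ?thesis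
    by (intro exI[of _ "Abs_pdistr G"]) (simp add: fourier_def)
qed

text \<open>Conversely, a distribution with rapidly decreasing coefficients has the same
  coefficients as the smooth sum of its Fourier series, and coefficients determine it.\<close>

lemma range_of_test_iff: "g \<in> range of_test \<longleftrightarrow> rapid (fourier g)"
proof
  assume "g \<in> range of_test"
  then obtain \<phi> where "g = of_test \<phi>"
    by blast
  then have "fourier g = fcoeff (eval \<phi>)"
    by (simp add: fun_eq_iff fourier_of_test)
  then show "rapid (fourier g)"
    by (simp add: rapid_fcoeff)
next
  assume r: "rapid (fourier g)"
  have "eval (Abs_test (fseries (fourier g))) = fseries (fourier g)"
    using smooth_fseries[OF r] periodic_fseries by (intro Abs_test_inverse) auto
  then have "g = of_test (Abs_test (fseries (fourier g)))"
    by (intro fourier_inject) (simp add: fourier_of_test fcoeff_fseries r)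
  then show "g \<in> range of_test"
    by blast
qed

lemma fourier_of_test_echar: "fourier (of_test (echar \<eta>)) \<xi> = (if \<xi> = \<eta> then 1 else 0)"
  by (simp add: fourier_of_test echar.rep_eq fcoeff_character)

lemma zero_mean_iff: "g \<in> zero_mean \<longleftrightarrow> fourier g 0 = 0"
  by (simp add: zero_mean_def fourier_def)

section \<open>Real-valued distributions and conjugate symmetry of coefficients\<close>

lemma cnj_fcoeff_real:
  assumes "\<And>x. f x \<in> \<real>"
  shows "cnj (fcoeff f \<xi>) = fcoeff f (- \<xi>)"
proof -
  have "cnj (fcoeff f \<xi>) = integral (cbox 0 1) (\<lambda>x. cnj (f x * character (- \<xi>) x))"
    unfolding fcoeff_def by (rule integral_cnj)
  also have "(\<lambda>x. cnj (f x * character (- \<xi>) x)) = (\<lambda>x. f x * character (- (- \<xi>)) x)"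
    using assms by (simp add: cnj_character Reals_cnj_iff)
  finally show ?thesis
    unfolding fcoeff_def .
qed

lemma uminus_in_lattice_cube: "- \<xi> \<in> lattice_cube N \<longleftrightarrow> \<xi> \<in> lattice_cube N"
  by (simp add: lattice_cube_def) (smt (verit))

text \<open>Forwards, the distribution is tested on cosines and sines. Backwards, its value on a
  real test function is a limit of real partial sums over cubes.\<close>

lemma real_valued_iff:
  fixes g :: "'n::finite pdistr"
  shows "real_valued g \<longleftrightarrow> (\<forall>\<xi>. fourier g (- \<xi>) = cnj (fourier g \<xi>))"
proof
  assume g: "real_valued g"
  show "\<forall>\<xi>. fourier g (- \<xi>) = cnj (fourier g \<xi>)"
  proof
    fix \<xi> :: "int ^ 'n"
    \<comment> \<open>\<open>c\<close> and \<open>s\<close> are the cosine and the sine of frequency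
      \<open>\<xi>\<close>, written as test functions.\<close>
    define c where "c = (1 / 2) *\<^sub>C (echar \<xi> + echar (- \<xi>))"
    define s where "s = (- \<i> / 2) *\<^sub>C (echar \<xi> + (- 1) *\<^sub>C echar (- \<xi>))"
    have "eval c x = of_real (Re (character \<xi> x))" "eval s x = of_real (Im (character \<xi> x))" for x
      by (simp_all add: c_def s_def scaleC_test.rep_eq plus_test.rep_eq echar.rep_eq
          complex_eq_iff flip: cnj_character)
    then have "pairing g c \<in> \<real>" "pairing g s \<in> \<real>"
      using g by (simp_all add: real_valued_def)
    moreover have "pairing g c = (1 / 2) * (fourier g (- \<xi>) + fourier g \<xi>)"
      "pairing g s = (- \<i> / 2) * (fourier g (- \<xi>) - fourier g \<xi>)"
      by (simp_all add: c_def s_def pairing_add pairing_scaleC fourier_def)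
    ultimately have "Im ((1 / 2) * (fourier g (- \<xi>) + fourier g \<xi>)) = 0"
      "Im ((- \<i> / 2) * (fourier g (- \<xi>) - fourier g \<xi>)) = 0"
      by (simp_all only: complex_is_Real_iff)
    then show "fourier g (- \<xi>) = cnj (fourier g \<xi>)"
      by (simp add: complex_eq_iff)
  qed
next
  assume g: "\<forall>\<xi>. fourier g (- \<xi>) = cnj (fourier g \<xi>)"
  show "real_valued g"
    unfolding real_valued_def
  proof (intro allI impI)
    fix \<phi> :: "'n test"
    assume \<phi>: "\<forall>x. eval \<phi> x \<in> \<real>"
    let ?s = "\<lambda>N. \<Sum>\<xi>\<in>lattice_cube N. fcoeff (eval \<phi>) \<xi> * fourier g (- \<xi>)"
    have "?s N \<in> \<real>" for N
    proof -
      have "cnj (?s N) = (\<Sum>\<xi>\<in>lattice_cube N. fcoeff (eval \<phi>) (- \<xi>) * fourier g \<xi>)"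
        using g \<phi> by (simp add: cnj_fcoeff_real)
      also have "\<dots> = ?s N"
        \<comment> \<open>Negation of the frequency preserves the cube, so conjugation only permutes
          the summands.\<close>
        by (rule sum.reindex_bij_witness[of _ uminus uminus]) (simp_all add: uminus_in_lattice_cube)
      finally show ?thesis
        by (simp add: Reals_cnj_iff)
    qed
    then show "pairing g \<phi> \<in> \<real>"
      by (intro Lim_in_closed_set[OF closed_complex_Reals _ _ pairing_fourier]) auto
  qed
qed

section \<open>The symbol matrix\<close>

definition symbol_form :: "'n::finite tensor \<Rightarrow> int ^ 'n \<Rightarrow> 'n \<Rightarrow> 'n \<Rightarrow> real" where
  "symbol_form a \<xi> k j = (\<Sum>\<alpha>\<in>UNIV. \<Sum>\<beta>\<in>UNIV. of_int (\<xi> $ \<alpha>) * a k j \<alpha> \<beta> * of_int (\<xi> $ \<beta>))"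

definition symbol_op :: "'n::finite tensor \<Rightarrow> int ^ 'n \<Rightarrow> complex ^ 'n \<Rightarrow> complex ^ 'n" where
  "symbol_op a \<xi> w = (\<chi> k. \<Sum>j\<in>UNIV. of_real (symbol_form a \<xi> k j) * w $ j)"

definition freq :: "int ^ 'n \<Rightarrow> real ^ 'n::finite" where
  "freq \<xi> = (\<chi> j. of_int (\<xi> $ j))"

lemma norm_freq_sq: "(norm (freq \<xi>))\<^sup>2 = (\<Sum>j\<in>UNIV. (real_of_int (\<xi> $ j))\<^sup>2)"
  by (simp add: freq_def norm_vec_def L2_set_def sum_nonneg)

lemma rho_sq': "(rho \<xi>)\<^sup>2 = 1 + (norm (freq \<xi>))\<^sup>2"
  by (simp add: rho_sq norm_freq_sq)

lemma abs_nth_le_norm_freq: "\<bar>real_of_int (\<xi> $ j)\<bar> \<le> norm (freq \<xi>)"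
  using component_le_norm_cart[of "freq \<xi>" j] by (simp add: freq_def)

lemma norm_freq_ge_1:
  assumes "\<xi> \<noteq> 0"
  shows "1 \<le> norm (freq \<xi>)"
proof -
  obtain j where "\<xi> $ j \<noteq> 0"
    using assms by (auto simp: vec_eq_iff)
  then have "1 \<le> \<bar>real_of_int (\<xi> $ j)\<bar>"
    by linarith
  then show ?thesis
    using abs_nth_le_norm_freq order_trans by blast
qed

lemma norm_freq_le_rho: "norm (freq \<xi>) \<le> rho \<xi>"
  by (rule power2_le_imp_le) (simp_all add: rho_sq' less_imp_le[OF rho_pos])

lemma rho_le_2_norm_freq:
  assumes "\<xi> \<noteq> 0"
  shows "(rho \<xi>)\<^sup>2 \<le> 2 * (norm (freq \<xi>))\<^sup>2" "rho \<xi> \<le> 2 * norm (freq \<xi>)"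
proof -
  have "1 \<le> (norm (freq \<xi>))\<^sup>2"
    using norm_freq_ge_1[OF assms] by simp
  then show *: "(rho \<xi>)\<^sup>2 \<le> 2 * (norm (freq \<xi>))\<^sup>2"
    by (simp add: rho_sq')
  show "rho \<xi> \<le> 2 * norm (freq \<xi>)"
  proof (rule power2_le_imp_le)
    show "(rho \<xi>)\<^sup>2 \<le> (2 * norm (freq \<xi>))\<^sup>2"
      using order_trans[OF *] by (simp add: power_mult_distrib)
  qed simp
qed

lemma abs_le_tensor_norm: "\<bar>a k j \<alpha> \<beta>\<bar> \<le> tensor_norm a"
  unfolding tensor_norm_def
  by (rule Max_ge) (auto intro!: image_eqI[of _ _ "(k, j, \<alpha>, \<beta>)"])

lemma tensor_norm_nonneg: "0 \<le> tensor_norm a"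
  using abs_le_tensor_norm[of a] abs_ge_zero order_trans by blast

text \<open>Exchanges the names of two non-adjacent summation indices, so that an index symmetry of
  the tensor can be used under the sum.\<close>

lemma sum_swap_outer_inner:
  "(\<Sum>k\<in>A. \<Sum>j\<in>B. \<Sum>\<alpha>\<in>A. f k j \<alpha>) = (\<Sum>k\<in>A. \<Sum>j\<in>B. \<Sum>\<alpha>\<in>A. f \<alpha> j k)"
proof -
  have "(\<Sum>k\<in>A. \<Sum>j\<in>B. \<Sum>\<alpha>\<in>A. f k j \<alpha>) = (\<Sum>j\<in>B. \<Sum>k\<in>A. \<Sum>\<alpha>\<in>A. f k j \<alpha>)"
    by (rule sum.swap)
  also have "\<dots> = (\<Sum>j\<in>B. \<Sum>\<alpha>\<in>A. \<Sum>k\<in>A. f k j \<alpha>)"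
    by (intro sum.cong refl sum.swap)
  also have "\<dots> = (\<Sum>k\<in>A. \<Sum>j\<in>B. \<Sum>\<alpha>\<in>A. f \<alpha> j k)"
    by (rule sum.swap)
  finally show ?thesis .
qed

lemma tensor_symmetricD:
  assumes "tensor_symmetric a"
  shows "a k j \<alpha> \<beta> = a \<alpha> j k \<beta>" "a k j \<alpha> \<beta> = a k \<beta> \<alpha> j"
  using assms unfolding tensor_symmetric_def by blast+

text \<open>Ellipticity is tested on the symmetric part of \<open>v \<otimes> x\<close>, which is trace free because
  \<open>v\<close> is orthogonal to \<open>x\<close>.\<close>

lemma ellipticity_rank_one:
  fixes v x :: "real ^ 'n::finite"
  assumes sym: "tensor_symmetric a" and ell: "relaxed_elliptic C a" and orth: "v \<bullet> x = 0"
  shows "inverse C * (norm x)\<^sup>2 * (norm v)\<^sup>2 / 2 \<le>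
    (\<Sum>k\<in>UNIV. \<Sum>j\<in>UNIV. \<Sum>\<alpha>\<in>UNIV. \<Sum>\<beta>\<in>UNIV. a k j \<alpha> \<beta> * (v $ k * x $ \<alpha>) * (v $ j * x $ \<beta>))"
proof -
  define \<zeta> :: "real ^ 'n ^ 'n" where "\<zeta> = (\<chi> k \<alpha>. (v $ k * x $ \<alpha> + v $ \<alpha> * x $ k) / 2)"
  let ?P = "\<lambda>k \<alpha>. v $ k * x $ \<alpha>"
  have "\<zeta> = transpose \<zeta>"
    by (simp add: \<zeta>_def transpose_def vec_eq_iff add.commute)
  moreover have "(\<Sum>k\<in>UNIV. \<zeta> $ k $ k) = 0"
    using orth by (simp add: \<zeta>_def inner_vec_def)
  ultimately have 1: "inverse C * (\<Sum>k\<in>UNIV. \<Sum>\<alpha>\<in>UNIV. (\<zeta> $ k $ \<alpha>)\<^sup>2) \<le>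
      (\<Sum>k\<in>UNIV. \<Sum>j\<in>UNIV. \<Sum>\<alpha>\<in>UNIV. \<Sum>\<beta>\<in>UNIV. a k j \<alpha> \<beta> * \<zeta> $ k $ \<alpha> * \<zeta> $ j $ \<beta>)"
    using ell unfolding relaxed_elliptic_def by blast
  \<comment> \<open>By symmetry in \<open>k\<close> and \<open>\<alpha>\<close> both halves of
    \<open>\<zeta>\<close> contribute equally, so the first factor may be replaced by the rank one
    matrix \<open>?P\<close>. The fact \<open>right\<close> does the same for the second
    factor.\<close>
  have left: "(\<Sum>k\<in>UNIV. \<Sum>j\<in>UNIV. \<Sum>\<alpha>\<in>UNIV. \<Sum>\<beta>\<in>UNIV. a k j \<alpha> \<beta> * \<zeta> $ k $ \<alpha> * c j \<beta>) =
      (\<Sum>k\<in>UNIV. \<Sum>j\<in>UNIV. \<Sum>\<alpha>\<in>UNIV. \<Sum>\<beta>\<in>UNIV. a k j \<alpha> \<beta> * ?P k \<alpha> * c j \<beta>)" (is "?l = ?r") for c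
  proof -
    have "?l = (1 / 2) * (?r + (\<Sum>k\<in>UNIV. \<Sum>j\<in>UNIV. \<Sum>\<alpha>\<in>UNIV. \<Sum>\<beta>\<in>UNIV. a k j \<alpha> \<beta> * ?P \<alpha> k * c j \<beta>))"
      unfolding \<zeta>_def sum.distrib[symmetric] sum_distrib_left
      by (intro sum.cong refl) (simp add: field_simps)
    also have "(\<Sum>k\<in>UNIV. \<Sum>j\<in>UNIV. \<Sum>\<alpha>\<in>UNIV. \<Sum>\<beta>\<in>UNIV. a k j \<alpha> \<beta> * ?P \<alpha> k * c j \<beta>) = ?r"
      by (subst sum_swap_outer_inner) (simp only: tensor_symmetricD(1)[OF sym, symmetric])
    finally show ?thesis
      by simp
  qed
  have right: "(\<Sum>k\<in>UNIV. \<Sum>j\<in>UNIV. \<Sum>\<alpha>\<in>UNIV. \<Sum>\<beta>\<in>UNIV. a k j \<alpha> \<beta> * c k \<alpha> * \<zeta> $ j $ \<beta>) =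
      (\<Sum>k\<in>UNIV. \<Sum>j\<in>UNIV. \<Sum>\<alpha>\<in>UNIV. \<Sum>\<beta>\<in>UNIV. a k j \<alpha> \<beta> * c k \<alpha> * ?P j \<beta>)" (is "?l = ?r") for c
  proof -
    have "?l = (1 / 2) * (?r + (\<Sum>k\<in>UNIV. \<Sum>j\<in>UNIV. \<Sum>\<alpha>\<in>UNIV. \<Sum>\<beta>\<in>UNIV. a k j \<alpha> \<beta> * c k \<alpha> * ?P \<beta> j))"
      unfolding \<zeta>_def sum.distrib[symmetric] sum_distrib_left
      by (intro sum.cong refl) (simp add: field_simps)
    also have "(\<Sum>k\<in>UNIV. \<Sum>j\<in>UNIV. \<Sum>\<alpha>\<in>UNIV. \<Sum>\<beta>\<in>UNIV. a k j \<alpha> \<beta> * c k \<alpha> * ?P \<beta> j) = ?r"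
      by (rule sum.cong[OF refl], subst sum_swap_outer_inner)
         (simp only: tensor_symmetricD(2)[OF sym, symmetric])
    finally show ?thesis
      by simp
  qed
  have "(\<Sum>k\<in>UNIV. \<Sum>\<alpha>\<in>UNIV. (\<zeta> $ k $ \<alpha>)\<^sup>2) =
      (1 / 4) * (\<Sum>k\<in>UNIV. \<Sum>\<alpha>\<in>UNIV. (v $ k)\<^sup>2 * (x $ \<alpha>)\<^sup>2) +
      (1 / 2) * (\<Sum>k\<in>UNIV. \<Sum>\<alpha>\<in>UNIV. (v $ k * x $ k) * (v $ \<alpha> * x $ \<alpha>)) +
      (1 / 4) * (\<Sum>k\<in>UNIV. \<Sum>\<alpha>\<in>UNIV. (x $ k)\<^sup>2 * (v $ \<alpha>)\<^sup>2)"
    unfolding \<zeta>_def sum_distrib_left sum.distrib[symmetric]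
    by (intro sum.cong refl) (simp add: power2_eq_square field_simps)
  \<comment> \<open>The cross term is the square of \<open>v \<bullet> x\<close> and vanishes; the
    two quarters add up to the factor 1/2 of the statement.\<close>
  also have "\<dots> = (norm x)\<^sup>2 * (norm v)\<^sup>2 / 2"
  proof -
    have "(norm y)\<^sup>2 = (\<Sum>k\<in>UNIV. (y $ k)\<^sup>2)" for y :: "real ^ 'n"
      by (simp add: power2_norm_eq_inner inner_vec_def) (simp add: power2_eq_square)
    then show ?thesis
      using orth unfolding sum_product[symmetric] by (simp add: inner_vec_def)
  qed
  finally have 2: "(\<Sum>k\<in>UNIV. \<Sum>\<alpha>\<in>UNIV. (\<zeta> $ k $ \<alpha>)\<^sup>2) = (norm x)\<^sup>2 * (norm v)\<^sup>2 / 2" .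
  show ?thesis
    using 1 unfolding left right 2 by (simp add: mult.assoc)
qed

lemma symbol_form_ge:
  fixes v :: "real ^ 'n::finite"
  assumes "tensor_symmetric a" "relaxed_elliptic C a" "v \<bullet> freq \<xi> = 0"
  shows "inverse C * (norm (freq \<xi>))\<^sup>2 * (norm v)\<^sup>2 / 2 \<le>
    (\<Sum>k\<in>UNIV. \<Sum>j\<in>UNIV. v $ k * symbol_form a \<xi> k j * v $ j)"
proof -
  have "(\<Sum>k\<in>UNIV. \<Sum>j\<in>UNIV. v $ k * symbol_form a \<xi> k j * v $ j) = (\<Sum>k\<in>UNIV. \<Sum>j\<in>UNIV.
      \<Sum>\<alpha>\<in>UNIV. \<Sum>\<beta>\<in>UNIV. a k j \<alpha> \<beta> * (v $ k * freq \<xi> $ \<alpha>) * (v $ j * freq \<xi> $ \<beta>))"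
    unfolding symbol_form_def sum_distrib_left sum_distrib_right
    by (intro sum.cong refl) (simp add: freq_def)
  then show ?thesis
    using ellipticity_rank_one[OF assms] by simp
qed

lemma norm_complex_vec_sq:
  fixes v :: "complex ^ 'n::finite"
  shows "(norm v)\<^sup>2 = (norm (\<chi> k. Re (v $ k)))\<^sup>2 + (norm (\<chi> k. Im (v $ k)))\<^sup>2"
  by (simp add: power2_norm_eq_inner inner_vec_def inner_complex_def sum.distrib)

text \<open>The matrix is real and \<open>\<bullet>\<close> is the real inner product, so the form
  splits into those of the real and imaginary parts of \<open>v\<close>, both orthogonal to
  \<open>\<xi>\<close>.\<close>

lemma inner_symbol_op_ge:
  fixes v :: "complex ^ 'n::finite"
  assumes sym: "tensor_symmetric a" and ell: "relaxed_elliptic C a"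
    and orth: "(\<Sum>j\<in>UNIV. of_int (\<xi> $ j) * v $ j) = 0"
  shows "inverse C * (norm (freq \<xi>))\<^sup>2 * (norm v)\<^sup>2 / 2 \<le> v \<bullet> symbol_op a \<xi> v"
proof -
  let ?p = "\<chi> k. Re (v $ k)" and ?q = "\<chi> k. Im (v $ k)"
  have "?p \<bullet> freq \<xi> = Re (\<Sum>j\<in>UNIV. of_int (\<xi> $ j) * v $ j)"
    "?q \<bullet> freq \<xi> = Im (\<Sum>j\<in>UNIV. of_int (\<xi> $ j) * v $ j)"
    by (simp_all add: inner_vec_def freq_def mult.commute)
  then have "?p \<bullet> freq \<xi> = 0" "?q \<bullet> freq \<xi> = 0"
    by (simp_all add: orth)
  note ge = symbol_form_ge[OF sym ell this(1)] symbol_form_ge[OF sym ell this(2)]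
  have "v \<bullet> symbol_op a \<xi> v = (\<Sum>k\<in>UNIV. \<Sum>j\<in>UNIV. ?p $ k * symbol_form a \<xi> k j * ?p $ j) +
      (\<Sum>k\<in>UNIV. \<Sum>j\<in>UNIV. ?q $ k * symbol_form a \<xi> k j * ?q $ j)"
    by (simp add: inner_vec_def symbol_op_def inner_complex_def sum_distrib_left sum.distrib mult.assoc)
  then show ?thesis
    using ge by (simp add: norm_complex_vec_sq[of v] distrib_left add_divide_distrib)
qed

lemma norm_vec_le_sum: "norm (x :: 'a::real_normed_vector ^ 'n::finite) \<le> (\<Sum>k\<in>UNIV. norm (x $ k))"
  unfolding norm_vec_def by (rule L2_set_le_sum) simp

text \<open>A crude count: two powers of the dimension come from summing over
  \<open>\<alpha>\<close> and \<open>\<beta>\<close>, two from the entries \<open>k\<close> and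
  \<open>j\<close>.\<close>

lemma norm_symbol_op_le:
  fixes w :: "complex ^ 'n::finite"
  shows "norm (symbol_op a \<xi> w) \<le> (real CARD('n) ^ 4 * tensor_norm a) * (norm (freq \<xi>))\<^sup>2 * norm w"
proof -
  let ?r = "norm (freq \<xi>)" and ?n = "real CARD('n)"
  have form: "\<bar>symbol_form a \<xi> k j\<bar> \<le> ?n\<^sup>2 * (?r * tensor_norm a * ?r)" for k j
  proof -
    have "\<bar>symbol_form a \<xi> k j\<bar> \<le> (\<Sum>\<alpha>\<in>UNIV. \<Sum>\<beta>\<in>UNIV. \<bar>of_int (\<xi> $ \<alpha>) * a k j \<alpha> \<beta> * of_int (\<xi> $ \<beta>)\<bar>)"
      unfolding symbol_form_def by (intro order_trans[OF sum_abs] sum_mono sum_abs)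
    also have "\<dots> \<le> (\<Sum>\<alpha>\<in>(UNIV :: 'n set). \<Sum>\<beta>\<in>(UNIV :: 'n set). ?r * tensor_norm a * ?r)"
      unfolding abs_mult
      by (intro sum_mono mult_mono abs_nth_le_norm_freq abs_le_tensor_norm mult_nonneg_nonneg
          norm_ge_zero tensor_norm_nonneg abs_ge_zero)
    finally show ?thesis
      by (simp add: power2_eq_square)
  qed
  have "norm (symbol_op a \<xi> w) \<le> (\<Sum>k\<in>UNIV. norm (\<Sum>j\<in>UNIV. of_real (symbol_form a \<xi> k j) * w $ j))"
    using norm_vec_le_sum[of "symbol_op a \<xi> w"] by (simp add: symbol_op_def)
  also have "\<dots> \<le> (\<Sum>k\<in>(UNIV :: 'n set). \<Sum>j\<in>(UNIV :: 'n set). ?n\<^sup>2 * (?r * tensor_norm a * ?r) * norm w)"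
    by (intro sum_mono sum_norm_le)
       (auto simp: norm_mult intro!: mult_mono form Finite_Cartesian_Product.norm_nth_le
         tensor_norm_nonneg mult_nonneg_nonneg)
  finally show ?thesis
    by (simp add: power2_eq_square power4_eq_xxxx mult_ac)
qed

lemma sum_UNIV_option: "(\<Sum>r\<in>UNIV. f r) = f None + (\<Sum>k\<in>UNIV. f (Some k))"
  for f :: "'n::finite option \<Rightarrow> 'a::comm_monoid_add"
  unfolding UNIV_option_conv by (simp add: sum.reindex o_def)

definition velocity_part :: "complex ^ 'n option \<Rightarrow> complex ^ 'n::finite" where
  "velocity_part X = (\<chi> k. X $ Some k)"

definition freq_mult :: "int ^ 'n \<Rightarrow> complex \<Rightarrow> complex ^ 'n::finite" where
  "freq_mult \<xi> c = (\<chi> k. of_int (\<xi> $ k) * c)"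

definition freq_dot :: "int ^ 'n \<Rightarrow> complex ^ 'n::finite \<Rightarrow> complex" where
  "freq_dot \<xi> w = (\<Sum>j\<in>UNIV. of_int (\<xi> $ j) * w $ j)"

lemma symbol_mult_velocity:
  "velocity_part (symbol a \<xi> *v X) =
    (4 * pi\<^sup>2) *\<^sub>R symbol_op a \<xi> (velocity_part X) + freq_mult \<xi> (2 * pi * \<i> * X $ None)"
  by (simp add: vec_eq_iff velocity_part_def matrix_vector_mult_def sum_UNIV_option symbol_def
      symbol_op_def symbol_form_def freq_mult_def)
    (simp add: scaleR_conv_of_real sum_distrib_left sum_distrib_right mult_ac)

lemma symbol_mult_None: "(symbol a \<xi> *v X) $ None = 2 * pi * \<i> * freq_dot \<xi> (velocity_part X)"
  by (simp add: velocity_part_def matrix_vector_mult_def sum_UNIV_option symbol_def freq_dot_def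
      sum_distrib_left mult_ac)

lemma norm_freq_mult: "norm (freq_mult \<xi> c) = norm (freq \<xi>) * cmod c"
proof (rule power2_eq_imp_eq)
  show "(norm (freq_mult \<xi> c))\<^sup>2 = (norm (freq \<xi>) * cmod c)\<^sup>2"
    unfolding power_mult_distrib norm_freq_sq
    by (simp add: freq_mult_def norm_vec_def L2_set_def sum_nonneg norm_mult power_mult_distrib
        sum_distrib_right)
qed auto

lemma norm_freq_dot_le: "cmod (freq_dot \<xi> w) \<le> real CARD('n) * (norm (freq \<xi>) * norm w)"
  for w :: "complex ^ 'n::finite"
proof -
  have "cmod (freq_dot \<xi> w) \<le> (\<Sum>j\<in>(UNIV :: 'n set). norm (freq \<xi>) * norm w)"
    unfolding freq_dot_def
    by (rule sum_norm_le)
       (auto simp: norm_mult intro!: mult_mono abs_nth_le_norm_freq Finite_Cartesian_Product.norm_nth_le)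
  then show ?thesis
    by simp
qed

lemma symbol_op_add: "symbol_op a \<xi> (v + w) = symbol_op a \<xi> v + symbol_op a \<xi> w"
  by (simp add: symbol_op_def vec_eq_iff distrib_left sum.distrib)

text \<open>The reason why the pressure term drops out when the momentum equation is tested with a
  solenoidal vector.\<close>

lemma inner_freq_mult_eq_0:
  assumes "freq_dot \<xi> v = 0"
  shows "v \<bullet> freq_mult \<xi> c = 0"
proof -
  have "v \<bullet> freq_mult \<xi> c = freq_dot \<xi> v \<bullet> c"
    by (simp add: inner_vec_def freq_mult_def freq_dot_def inner_sum_left inner_complex_def
        sum_distrib_left sum.distrib algebra_simps)
  then show ?thesis
    by (simp add: assms)
qed

text \<open>With \<open>L\<close> the bound of \<open>norm_symbol_op_le\<close>, the factor
  \<open>K = C + 2 * C * L + 1\<close> bounds the velocity and \<open>1 + 8 * L * K\<close> the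
  pressure; the constant is their sum.\<close>

definition symbol_const :: "real \<Rightarrow> real \<Rightarrow> real" where
  "symbol_const C L = (C + 2 * C * L + 1) + 1 + 8 * L * (C + 2 * C * L + 1)"

text \<open>The velocity splits into a gradient part, which the divergence equation determines, and a
  solenoidal part \<open>v\<close>. Testing the momentum equation with \<open>v\<close> eliminates the pressure.\<close>

lemma symbol_lower_bound:
  fixes X :: "complex ^ 'n::finite option"
  assumes sym: "tensor_symmetric a" and ell: "relaxed_elliptic C a" and C: "C > 0" and \<xi>: "\<xi> \<noteq> 0"
  defines "r \<equiv> norm (freq \<xi>)" and "L \<equiv> real CARD('n) ^ 4 * tensor_norm a" and "Y \<equiv> symbol a \<xi> *v X"
  shows "r\<^sup>2 * norm (velocity_part X) + r * cmod (X $ None) \<le>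
    symbol_const C L * (norm (velocity_part Y) + r * cmod (Y $ None))"
proof -
  define w q F G where "w = velocity_part X" and "q = X $ None" and "F = velocity_part Y" and "G = Y $ None"
  define \<gamma> where "\<gamma> = freq_dot \<xi> w"
  have F: "F = (4 * pi\<^sup>2) *\<^sub>R symbol_op a \<xi> w + freq_mult \<xi> (2 * pi * \<i> * q)"
    and "G = 2 * pi * \<i> * \<gamma>"
    by (simp_all add: F_def G_def Y_def w_def q_def \<gamma>_def symbol_mult_velocity symbol_mult_None)
  then have G: "cmod G = 2 * pi * cmod \<gamma>"
    by (simp add: norm_mult)
  have r1: "r \<ge> 1"
    unfolding r_def by (rule norm_freq_ge_1[OF \<xi>])
  have L0: "L \<ge> 0"
    by (simp add: L_def tensor_norm_nonneg)
  have op_le: "norm (symbol_op a \<xi> z) \<le> L * r\<^sup>2 * norm z" for z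
    unfolding L_def r_def by (rule norm_symbol_op_le)
  \<comment> \<open>The orthogonal projection of \<open>w\<close> onto the direction of
    \<open>\<xi>\<close>, determined by the divergence datum \<open>\<gamma>\<close>.\<close>
  define e where "e = freq_mult \<xi> (\<gamma> / of_real (r\<^sup>2))"
  define v where "v = w - e"
  have w: "w = v + e"
    by (simp add: v_def)
  have norm_e: "norm e = cmod \<gamma> / r"
    using r1 by (simp add: e_def norm_freq_mult r_def[symmetric] norm_divide norm_power)
      (simp add: power2_eq_square)
  have "freq_dot \<xi> e = (\<Sum>j\<in>UNIV. of_real ((of_int (\<xi> $ j))\<^sup>2)) * (\<gamma> / of_real (r\<^sup>2))"
    by (simp add: freq_dot_def e_def freq_mult_def sum_distrib_left sum_distrib_right
        sum_divide_distrib power2_eq_square mult_ac)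
  also have "(\<Sum>j\<in>UNIV. complex_of_real ((of_int (\<xi> $ j))\<^sup>2)) = of_real (r\<^sup>2)"
    unfolding r_def norm_freq_sq by simp
  finally have "freq_dot \<xi> e = \<gamma>"
    using r1 by simp
  then have orth: "freq_dot \<xi> v = 0"
    by (simp add: v_def freq_dot_def \<gamma>_def right_diff_distrib sum_subtractf)
  have solenoidal: "2 * pi\<^sup>2 * r\<^sup>2 * norm v \<le> C * (norm F + 4 * pi\<^sup>2 * L * r * cmod \<gamma>)"
  proof (cases "v = 0")
    case True
    then show ?thesis
      using C L0 r1 by simp
  next
    case False
    \<comment> \<open>Testing with \<open>v\<close> removes the pressure. Ellipticity bounds the
      \<open>v\<close> part from below; the \<open>e\<close> part is a perturbation of size
      \<open>L * r * cmod \<gamma>\<close>. One factor \<open>norm v\<close> cancels at the end,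
      hence the case split.\<close>
    have "v \<bullet> F = (4 * pi\<^sup>2) * (v \<bullet> symbol_op a \<xi> v + v \<bullet> symbol_op a \<xi> e)"
      using inner_freq_mult_eq_0[OF orth] by (simp add: F w symbol_op_add inner_add_right)
    moreover have "inverse C * r\<^sup>2 * (norm v)\<^sup>2 / 2 \<le> v \<bullet> symbol_op a \<xi> v"
      unfolding r_def using inner_symbol_op_ge[OF sym ell] orth unfolding freq_dot_def by blast
    moreover have "v \<bullet> F \<le> norm v * norm F"
      by (rule norm_cauchy_schwarz)
    moreover have "- (v \<bullet> symbol_op a \<xi> e) \<le> norm v * (L * r * cmod \<gamma>)"
    proof -
      have "- (v \<bullet> symbol_op a \<xi> e) \<le> norm v * norm (symbol_op a \<xi> e)"
        using Cauchy_Schwarz_ineq2[of v "symbol_op a \<xi> e"] by linarith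
      also have "\<dots> \<le> norm v * (L * r\<^sup>2 * norm e)"
        by (intro mult_left_mono op_le) simp
      also have "\<dots> = norm v * (L * r * cmod \<gamma>)"
        using r1 by (simp add: norm_e power2_eq_square)
      finally show ?thesis .
    qed
    ultimately have "(4 * pi\<^sup>2) * (inverse C * r\<^sup>2 * (norm v)\<^sup>2 / 2) \<le>
        norm v * norm F + (4 * pi\<^sup>2) * (norm v * (L * r * cmod \<gamma>))"
      by (smt (verit) mult_left_mono pi_gt_zero zero_le_power2 right_diff_distrib distrib_left)
    then have "norm v * (2 * pi\<^sup>2 * r\<^sup>2 * norm v) \<le> norm v * (C * (norm F + 4 * pi\<^sup>2 * L * r * cmod \<gamma>))"
      using C by (simp add: field_simps power2_eq_square)
    then show ?thesis
      using False by simp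
  qed
  have pi3: "pi > 3"
    by (rule pi_gt3)
  have pi9: "pi\<^sup>2 > 9"
    using pi3 power_strict_mono[of 3 pi 2] by simp
  \<comment> \<open>Written so that \<open>2 * pi\<^sup>2\<close> cancels; as this factor exceeds 1,
    it may be inserted in front of \<open>C * norm F\<close>.\<close>
  have "2 * pi\<^sup>2 * (r\<^sup>2 * norm v) \<le> 2 * pi\<^sup>2 * (C * norm F + 2 * C * L * (r * cmod \<gamma>))"
  proof -
    have "C * norm F * 1 \<le> C * norm F * (2 * pi\<^sup>2)"
      using C pi9 by (intro mult_left_mono) auto
    then show ?thesis
      using solenoidal by (simp add: algebra_simps)
  qed
  then have v_le: "r\<^sup>2 * norm v \<le> C * norm F + 2 * C * L * (r * cmod \<gamma>)"
    by simp
  have \<gamma>_le: "r * cmod \<gamma> \<le> r * cmod G"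
  proof -
    have "1 * cmod \<gamma> \<le> 2 * pi * cmod \<gamma>"
      using pi3 by (intro mult_right_mono) auto
    then show ?thesis
      using G r1 by (intro mult_left_mono) auto
  qed
  let ?S = "norm F + r * cmod G" and ?K = "C + 2 * C * L + 1"
  have w_le: "r\<^sup>2 * norm w \<le> ?K * ?S"
  proof -
    have "r\<^sup>2 * norm w \<le> r\<^sup>2 * (norm v + norm e)"
      unfolding w by (intro mult_left_mono norm_triangle_ineq) simp
    also have "\<dots> = r\<^sup>2 * norm v + r * cmod \<gamma>"
      using r1 by (simp add: norm_e distrib_left power2_eq_square)
    also have "\<dots> \<le> C * norm F + 2 * C * L * (r * cmod G) + r * cmod G"
    proof -
      have "2 * C * L * (r * cmod \<gamma>) \<le> 2 * C * L * (r * cmod G)"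
        using C L0 by (intro mult_left_mono \<gamma>_le) auto
      then show ?thesis
        using v_le \<gamma>_le by linarith
    qed
    also have "\<dots> \<le> C * ?S + 2 * C * L * ?S + 1 * ?S"
      using C L0 r1 by (intro add_mono mult_left_mono) auto
    finally show ?thesis
      by (simp add: distrib_right)
  qed
  have q_le: "r * cmod q \<le> ?S + 8 * L * (?K * ?S)"
  proof -
    \<comment> \<open>The momentum equation solved for the pressure gradient, now that the velocity
      is bounded.\<close>
    have "freq_mult \<xi> (2 * pi * \<i> * q) = F - (4 * pi\<^sup>2) *\<^sub>R symbol_op a \<xi> w"
      by (simp add: F)
    then have "r * (2 * pi * cmod q) = norm (F - (4 * pi\<^sup>2) *\<^sub>R symbol_op a \<xi> w)"
      by (metis norm_freq_mult norm_mult norm_ii norm_of_real abs_of_pos pi_gt_zero mult_2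
          add_pos_pos mult.right_neutral r_def)
    also have "\<dots> \<le> norm F + (4 * pi\<^sup>2) * norm (symbol_op a \<xi> w)"
      using norm_triangle_ineq4[of F "(4 * pi\<^sup>2) *\<^sub>R symbol_op a \<xi> w"] by simp
    also have "\<dots> \<le> norm F + (4 * pi\<^sup>2) * (L * (r\<^sup>2 * norm w))"
      using op_le[of w] by (intro add_left_mono mult_left_mono) (auto simp: mult_ac)
    also have "\<dots> \<le> ?S + (4 * pi\<^sup>2) * (L * (?K * ?S))"
      using w_le L0 r1 by (intro add_mono mult_left_mono) auto
    \<comment> \<open>Prepares division by \<open>2 * pi\<close>. The 8 in
      \<open>symbol_const\<close> originates here, from \<open>pi < 4\<close>.\<close>
    also have "\<dots> \<le> 2 * pi * ?S + 2 * pi * (8 * L * (?K * ?S))"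
    proof (rule add_mono)
      show "?S \<le> 2 * pi * ?S"
        using pi3 r1 mult_right_mono[of 1 "2 * pi" ?S] by simp
      have "0 \<le> L * (?K * ?S)"
        using L0 C r1 by (intro mult_nonneg_nonneg add_nonneg_nonneg) auto
      moreover have "4 * pi\<^sup>2 \<le> 2 * pi * 8"
        using pi_less_4 pi3 by (simp add: power2_eq_square)
      ultimately have "(4 * pi\<^sup>2) * (L * (?K * ?S)) \<le> (2 * pi * 8) * (L * (?K * ?S))"
        by (rule mult_right_mono[rotated])
      then show "(4 * pi\<^sup>2) * (L * (?K * ?S)) \<le> 2 * pi * (8 * L * (?K * ?S))"
        by (simp only: mult.assoc)
    qed
    finally have "2 * pi * (r * cmod q) \<le> 2 * pi * (?S + 8 * L * (?K * ?S))"
      by (simp add: algebra_simps)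
    then show ?thesis
      by simp
  qed
  have "r\<^sup>2 * norm w + r * cmod q \<le> ?K * ?S + (?S + 8 * L * (?K * ?S))"
    using w_le q_le by (rule add_mono)
  also have "\<dots> = symbol_const C L * ?S"
    by (simp add: symbol_const_def algebra_simps)
  finally show ?thesis
    by (simp add: w_def q_def F_def G_def)
qed

lemma symbol_const_pos: "C > 0 \<Longrightarrow> L \<ge> 0 \<Longrightarrow> symbol_const C L > 0"
  unfolding symbol_const_def by (intro add_pos_nonneg add_nonneg_nonneg mult_nonneg_nonneg) auto

text \<open>Squared so that it can be summed over frequencies. Replacing the length of a nonzero
  frequency by \<open>rho\<close> costs a factor 2, squared to 4; a further 2 comes from the square
  of a sum.\<close>

lemma symbol_lower_bound_sq:
  fixes X :: "complex ^ 'n::finite option"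
  assumes sym: "tensor_symmetric a" and ell: "relaxed_elliptic C a" and C: "C > 0" and \<xi>: "\<xi> \<noteq> 0"
  defines "L \<equiv> real CARD('n) ^ 4 * tensor_norm a" and "Y \<equiv> symbol a \<xi> *v X"
  shows "rho \<xi> ^ 4 * (norm (velocity_part X))\<^sup>2 + (rho \<xi>)\<^sup>2 * (cmod (X $ None))\<^sup>2 \<le>
    8 * (symbol_const C L)\<^sup>2 * ((norm (velocity_part Y))\<^sup>2 + (rho \<xi>)\<^sup>2 * (cmod (Y $ None))\<^sup>2)"
proof -
  let ?r = "norm (freq \<xi>)" and ?s = "rho \<xi>" and ?K = "symbol_const C L"
  let ?w = "norm (velocity_part X)" and ?q = "cmod (X $ None)"
  let ?F = "norm (velocity_part Y)" and ?G = "cmod (Y $ None)"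
  have s: "?s > 0"
    by (rule rho_pos)
  have K: "?K > 0"
    unfolding L_def by (intro symbol_const_pos C) (simp add: tensor_norm_nonneg)
  have "?s\<^sup>2 * ?w + ?s * ?q \<le> 2 * ?r\<^sup>2 * ?w + 2 * ?r * ?q"
    by (intro add_mono mult_right_mono rho_le_2_norm_freq \<xi>) auto
  also have "\<dots> \<le> 2 * (?K * (?F + ?r * ?G))"
    using symbol_lower_bound[OF sym ell C \<xi>, of X] by (simp add: L_def Y_def)
  also have "\<dots> \<le> 2 * (?K * (?F + ?s * ?G))"
    using K by (intro mult_left_mono add_left_mono mult_right_mono norm_freq_le_rho) auto
  finally have "(?s\<^sup>2 * ?w + ?s * ?q)\<^sup>2 \<le> (2 * (?K * (?F + ?s * ?G)))\<^sup>2"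
    using s by (intro power_mono) auto
  moreover have "?s ^ 4 * ?w\<^sup>2 + ?s\<^sup>2 * ?q\<^sup>2 \<le> (?s\<^sup>2 * ?w + ?s * ?q)\<^sup>2"
    using s by (simp add: power2_sum power_mult_distrib)
  moreover have "(2 * (?K * (?F + ?s * ?G)))\<^sup>2 \<le> 8 * ?K\<^sup>2 * (?F\<^sup>2 + ?s\<^sup>2 * ?G\<^sup>2)"
  proof -
    have "(?F + ?s * ?G)\<^sup>2 \<le> 2 * (?F\<^sup>2 + (?s * ?G)\<^sup>2)"
      using sum_squares_bound[of ?F "?s * ?G"] by (simp add: power2_sum)
    then have "4 * ?K\<^sup>2 * (?F + ?s * ?G)\<^sup>2 \<le> 4 * ?K\<^sup>2 * (2 * (?F\<^sup>2 + (?s * ?G)\<^sup>2))"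
      by (intro mult_left_mono) auto
    also have "\<dots> = 8 * ?K\<^sup>2 * (?F\<^sup>2 + ?s\<^sup>2 * ?G\<^sup>2)"
      by (simp add: power_mult_distrib)
    also have "4 * ?K\<^sup>2 * (?F + ?s * ?G)\<^sup>2 = (2 * (?K * (?F + ?s * ?G)))\<^sup>2"
      by (simp add: power_mult_distrib)
    finally show ?thesis .
  qed
  ultimately show ?thesis
    by linarith
qed

text \<open>Yields boundedness of \<open>stokes_S\<close>. \<open>M\<close> dominates the
  coefficients of all terms; the two-term momentum bound costs \<open>2 * M\<^sup>2\<close> when
  squared and the divergence row \<open>M\<^sup>2\<close>.\<close>

lemma symbol_upper_bound_sq:
  fixes a :: "'n::finite tensor"
  shows "\<exists>K\<ge>0. \<forall>\<xi> X. (norm (velocity_part (symbol a \<xi> *v X)))\<^sup>2 + (rho \<xi>)\<^sup>2 * (cmod ((symbol a \<xi> *v X) $ None))\<^sup>2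
    \<le> K * (rho \<xi> ^ 4 * (norm (velocity_part X))\<^sup>2 + (rho \<xi>)\<^sup>2 * (cmod (X $ None))\<^sup>2)"
proof -
  define L where "L = real CARD('n) ^ 4 * tensor_norm a"
  have L: "L \<ge> 0"
    by (simp add: L_def tensor_norm_nonneg)
  define M where "M = 4 * pi\<^sup>2 * L + 2 * pi + 2 * pi * real CARD('n)"
  have M: "M \<ge> 0"
    using L by (simp add: M_def)
  have "(norm (velocity_part (symbol a \<xi> *v X)))\<^sup>2 + (rho \<xi>)\<^sup>2 * (cmod ((symbol a \<xi> *v X) $ None))\<^sup>2
    \<le> 3 * M\<^sup>2 * (rho \<xi> ^ 4 * (norm (velocity_part X))\<^sup>2 + (rho \<xi>)\<^sup>2 * (cmod (X $ None))\<^sup>2)"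
    for \<xi> :: "int ^ 'n" and X
  proof -
    let ?r = "norm (freq \<xi>)" and ?s = "rho \<xi>"
    let ?w = "norm (velocity_part X)" and ?q = "cmod (X $ None)"
    let ?F = "norm (velocity_part (symbol a \<xi> *v X))" and ?G = "cmod ((symbol a \<xi> *v X) $ None)"
    have s: "?s > 0"
      by (rule rho_pos)
    have rs: "?r \<le> ?s" "?r\<^sup>2 \<le> ?s\<^sup>2"
      using norm_freq_le_rho[of \<xi>] by (auto intro: power_mono)
    have "?F \<le> (4 * pi\<^sup>2) * norm (symbol_op a \<xi> (velocity_part X)) + ?r * (2 * pi * ?q)"
      unfolding symbol_mult_velocity
      by (rule order_trans[OF norm_triangle_ineq]) (simp add: norm_freq_mult norm_mult)
    also have "\<dots> \<le> (4 * pi\<^sup>2) * (L * ?r\<^sup>2 * ?w) + ?r * (2 * pi * ?q)"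
      unfolding L_def by (intro add_right_mono mult_left_mono norm_symbol_op_le) simp
    also have "\<dots> \<le> (4 * pi\<^sup>2) * (L * ?s\<^sup>2 * ?w) + ?s * (2 * pi * ?q)"
      using L rs by (intro add_mono mult_left_mono mult_right_mono) auto
    also have "\<dots> = (4 * pi\<^sup>2 * L) * (?s\<^sup>2 * ?w) + (2 * pi) * (?s * ?q)"
      by simp
    also have "\<dots> \<le> M * (?s\<^sup>2 * ?w) + M * (?s * ?q)"
      using L s by (intro add_mono mult_right_mono) (auto simp: M_def)
    finally have "?F\<^sup>2 \<le> (M * (?s\<^sup>2 * ?w) + M * (?s * ?q))\<^sup>2"
      by (intro power_mono) auto
    also have "\<dots> \<le> 2 * ((M * (?s\<^sup>2 * ?w))\<^sup>2 + (M * (?s * ?q))\<^sup>2)"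
      using sum_squares_bound[of "M * (?s\<^sup>2 * ?w)" "M * (?s * ?q)"] by (simp add: power2_sum)
    finally have F: "?F\<^sup>2 \<le> 2 * M\<^sup>2 * (?s ^ 4 * ?w\<^sup>2 + ?s\<^sup>2 * ?q\<^sup>2)"
      by (simp add: power_mult_distrib algebra_simps)
    have "?s * ?G = ?s * (2 * pi * cmod (freq_dot \<xi> (velocity_part X)))"
      by (simp add: symbol_mult_None norm_mult)
    also have "\<dots> \<le> ?s * (2 * pi * (real CARD('n) * (?r * ?w)))"
      using s by (intro mult_left_mono norm_freq_dot_le) auto
    also have "\<dots> \<le> ?s * (2 * pi * (real CARD('n) * (?s * ?w)))"
      using s rs by (intro mult_left_mono mult_right_mono) auto
    also have "\<dots> = (2 * pi * real CARD('n)) * (?s\<^sup>2 * ?w)"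
      by (simp add: power2_eq_square)
    also have "\<dots> \<le> M * (?s\<^sup>2 * ?w)"
      using L by (intro mult_right_mono) (auto simp: M_def)
    finally have "(?s * ?G)\<^sup>2 \<le> (M * (?s\<^sup>2 * ?w))\<^sup>2"
      using s by (intro power_mono) auto
    then have "?s\<^sup>2 * ?G\<^sup>2 \<le> M\<^sup>2 * (?s ^ 4 * ?w\<^sup>2)"
      by (simp add: power_mult_distrib)
    also have "\<dots> \<le> M\<^sup>2 * (?s ^ 4 * ?w\<^sup>2 + ?s\<^sup>2 * ?q\<^sup>2)"
      by (intro mult_left_mono) auto
    finally show ?thesis
      using F by simp
  qed
  then show ?thesis
    by (intro exI[of _ "3 * M\<^sup>2"]) auto
qed

lemma vec_option_eq_0_iff: "X = 0 \<longleftrightarrow> velocity_part X = 0 \<and> X $ None = 0"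
  by (auto simp: vec_eq_iff velocity_part_def split: option.splits) (metis option.exhaust)

text \<open>A square matrix with trivial kernel is invertible, and the lower bound makes the kernel
  trivial.\<close>

lemma invertible_symbol:
  fixes a :: "'n::finite tensor"
  assumes "tensor_symmetric a" "relaxed_elliptic C a" "C > 0" "\<xi> \<noteq> 0"
  shows "invertible (symbol a \<xi>)"
  unfolding invertible_left_inverse matrix_left_invertible_ker
proof (intro allI impI)
  fix X
  assume X: "symbol a \<xi> *v X = 0"
  have 0: "velocity_part (0 :: complex ^ 'n option) = 0"
    by (simp add: velocity_part_def vec_eq_iff)
  have "rho \<xi> ^ 4 * (norm (velocity_part X))\<^sup>2 + (rho \<xi>)\<^sup>2 * (cmod (X $ None))\<^sup>2 \<le> 0"
    using symbol_lower_bound_sq[OF assms, of X] by (simp add: X 0)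
  moreover have "rho \<xi> \<noteq> 0"
    using rho_pos[of \<xi>] by simp
  ultimately have "velocity_part X = 0" "X $ None = 0"
    by (auto simp: add_nonneg_eq_0_iff order_antisym_conv)
  then show "X = 0"
    by (simp add: vec_option_eq_0_iff)
qed

lemma matrix_inv_mult:
  fixes A :: "complex ^ 'm::finite ^ 'm"
  assumes "invertible A"
  shows "matrix_inv A *v (A *v X) = X" "A *v (matrix_inv A *v X) = X"
proof -
  have "A ** matrix_inv A = mat 1 \<and> matrix_inv A ** A = mat 1"
    using assms unfolding invertible_def matrix_inv_def by (rule someI_ex)
  then show "matrix_inv A *v (A *v X) = X" "A *v (matrix_inv A *v X) = X"
    by (simp_all add: matrix_vector_mul_assoc)
qed

text \<open>The velocity block is real and even in \<open>\<xi>\<close>, the remaining nonzero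
  entries are imaginary and odd, so negating \<open>\<xi>\<close> conjugates the matrix.\<close>

lemma symbol_cnj: "symbol a (- \<xi>) *v (\<chi> r. cnj (X $ r)) = (\<chi> r. cnj ((symbol a \<xi> *v X) $ r))"
  by (simp add: vec_eq_iff matrix_vector_mult_def symbol_def sum_UNIV_option split: option.split)

section \<open>Solution of the Stokes system\<close>

text \<open>The two halves of the strain contribute equally by the symmetry of the tensor in
  \<open>j\<close> and \<open>\<beta>\<close>, so the symbol can be written with the plain
  gradient.\<close>

lemma fourier_viscous:
  assumes "tensor_symmetric a"
  shows "fourier (viscous a u $ k) \<xi> =
    - (4 * pi\<^sup>2) * (\<Sum>j\<in>UNIV. of_real (symbol_form a \<xi> k j) * fourier (u $ j) \<xi>)"
proof -
  let ?x = "\<lambda>j. complex_of_int (\<xi> $ j)" and ?u = "\<lambda>j. fourier (u $ j) \<xi>"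
    and ?a = "\<lambda>j \<alpha> \<beta>. complex_of_real (a k j \<alpha> \<beta>)"
  have swap: "(\<Sum>j\<in>UNIV. \<Sum>\<beta>\<in>UNIV. ?a j \<alpha> \<beta> * (?x j * ?u \<beta>)) =
      (\<Sum>j\<in>UNIV. \<Sum>\<beta>\<in>UNIV. ?a j \<alpha> \<beta> * (?x \<beta> * ?u j))" for \<alpha>
    by (subst sum.swap) (simp only: tensor_symmetricD(2)[OF assms, symmetric])
  have "fourier (viscous a u $ k) \<xi> = (\<Sum>\<alpha>\<in>UNIV. 2 * pi * \<i> * ?x \<alpha> *
      (\<Sum>j\<in>UNIV. \<Sum>\<beta>\<in>UNIV. ?a j \<alpha> \<beta> * ((1 / 2) * (2 * pi * \<i> * ?x j * ?u \<beta> + 2 * pi * \<i> * ?x \<beta> * ?u j))))"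
    by (simp add: viscous_def strain_def fourier_sum fourier_D fourier_scaleC fourier_add)
  also have "\<dots> = (\<Sum>\<alpha>\<in>UNIV. 2 * pi * \<i> * ?x \<alpha> * (pi * \<i> *
      ((\<Sum>j\<in>UNIV. \<Sum>\<beta>\<in>UNIV. ?a j \<alpha> \<beta> * (?x j * ?u \<beta>)) + (\<Sum>j\<in>UNIV. \<Sum>\<beta>\<in>UNIV. ?a j \<alpha> \<beta> * (?x \<beta> * ?u j)))))"
    unfolding sum.distrib[symmetric] sum_distrib_left
    by (intro sum.cong refl) (simp add: field_simps)
  also have "\<dots> = (\<Sum>\<alpha>\<in>UNIV. \<Sum>j\<in>UNIV. \<Sum>\<beta>\<in>UNIV. - (4 * pi\<^sup>2) * (?x \<alpha> * ?a j \<alpha> \<beta> * ?x \<beta> * ?u j))"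
    unfolding swap sum_distrib_left mult_2[symmetric]
    by (intro sum.cong refl) (simp add: power2_eq_square)
  also have "\<dots> = - (4 * pi\<^sup>2) * (\<Sum>j\<in>UNIV. of_real (symbol_form a \<xi> k j) * ?u j)"
    by (subst sum.swap) (simp add: symbol_form_def sum_distrib_left sum_distrib_right mult_ac)
  finally show ?thesis .
qed

lemma fourier_pair_stokes_S:
  assumes "tensor_symmetric a"
  shows "fourier_pair (stokes_S a up) \<xi> = symbol a \<xi> *v fourier_pair up \<xi>"
proof -
  obtain u p where up: "up = (u, p)"
    by (cases up)
  have "fourier_pair (stokes_S a up) \<xi> $ r = (symbol a \<xi> *v fourier_pair up \<xi>) $ r" for r
  proof (cases r)
    case None
    then show ?thesis
      by (simp add: up fourier_pair_def stokes_S_def dvg_def fourier_sum fourier_D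
          symbol_mult_None freq_dot_def velocity_part_def sum_distrib_left mult.assoc)
  next
    case (Some k)
    have "(symbol a \<xi> *v fourier_pair up \<xi>) $ r = velocity_part (symbol a \<xi> *v fourier_pair up \<xi>) $ k"
      by (simp add: Some velocity_part_def)
    then show ?thesis
      unfolding symbol_mult_velocity
      by (simp add: up Some fourier_pair_def stokes_S_def stokes_L_def grad_def fourier_minus fourier_diff
          fourier_D fourier_viscous[OF assms] velocity_part_def symbol_op_def freq_mult_def)
        (simp add: scaleR_conv_of_real)
  qed
  then show ?thesis
    by (simp add: vec_eq_iff)
qed

lemma fourier_pair_inject:
  assumes "\<And>\<xi>. fourier_pair up \<xi> = fourier_pair vq \<xi>"
  shows "up = vq"
proof -
  have "fourier (fst up $ k) \<xi> = fourier (fst vq $ k) \<xi>" "fourier (snd up) \<xi> = fourier (snd vq) \<xi>" for k \<xi>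
    using arg_cong[OF assms[of \<xi>], of "\<lambda>X. X $ Some k"] arg_cong[OF assms[of \<xi>], of "\<lambda>X. X $ None"]
    by (simp_all add: fourier_pair_def)
  then have "fst up $ k = fst vq $ k" "snd up = snd vq" for k
    by (blast intro: fourier_inject)+
  then show ?thesis
    by (simp add: prod_eq_iff vec_eq_iff)
qed

lemma ex_fourier_pair:
  assumes "\<And>r. temperate (\<lambda>\<xi>. X \<xi> $ r)"
  shows "\<exists>up. \<forall>\<xi>. fourier_pair up \<xi> = X \<xi>"
proof -
  have "\<forall>k. \<exists>g. \<forall>\<xi>. fourier g \<xi> = X \<xi> $ Some k" "\<exists>p. \<forall>\<xi>. fourier p \<xi> = X \<xi> $ None"
    using ex_fourier[OF assms] by blast+
  then obtain u p where "\<And>k \<xi>. fourier (u k) \<xi> = X \<xi> $ Some k" "\<And>\<xi>. fourier p \<xi> = X \<xi> $ None"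
    by metis
  then show ?thesis
    by (intro exI[of _ "((\<chi> k. u k), p)"]) (auto simp: fourier_pair_def vec_eq_iff split: option.split)
qed

lemma clinear_stokes_S:
  assumes "tensor_symmetric a"
  shows "clinear (stokes_S a)"
proof -
  have add: "fourier_pair (x + y) \<xi> = fourier_pair x \<xi> + fourier_pair y \<xi>" for x y :: "('n pdistr ^ 'n) \<times> 'n pdistr" and \<xi>
    by (simp add: fourier_pair_def vec_eq_iff fourier_add split: option.split)
  have mult: "fourier_pair (c *\<^sub>C x) \<xi> = c *s fourier_pair x \<xi>" for c and x :: "('n pdistr ^ 'n) \<times> 'n pdistr" and \<xi>
    by (simp add: fourier_pair_def vec_eq_iff scaleC_prod_def scaleC_vec_def fourier_scaleC split: option.split)
  show ?thesis
    unfolding clinear_def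
  proof (intro conjI allI)
    show "stokes_S a (x + y) = stokes_S a x + stokes_S a y" for x y
      by (rule fourier_pair_inject)
         (simp add: add fourier_pair_stokes_S[OF assms] matrix_vector_right_distrib)
    show "stokes_S a (c *\<^sub>C x) = c *\<^sub>C stokes_S a x" for c x
      by (rule fourier_pair_inject)
         (simp add: mult fourier_pair_stokes_S[OF assms] vector_scalar_commute)
  qed
qed

section \<open>Weighted energies and Sobolev norms\<close>

definition energy :: "real \<Rightarrow> real \<Rightarrow> int ^ 'n \<Rightarrow> complex ^ 'n::finite option \<Rightarrow> real" where
  "energy s t \<xi> X =
    rho \<xi> powr (2 * s) * (norm (velocity_part X))\<^sup>2 + rho \<xi> powr (2 * t) * (cmod (X $ None))\<^sup>2"

lemma energy_nonneg: "0 \<le> energy s t \<xi> X"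
  by (simp add: energy_def)

lemma energy_0: "energy s t \<xi> 0 = 0"
  by (simp add: energy_def velocity_part_def flip: zero_vec_def)

text \<open>Pulls out the weight shared by solution and data; what remains is free of
  \<open>s\<close>, and so are all constants below.\<close>

lemma energy_factor:
  "energy s (s - 1) \<xi> X = rho \<xi> powr (2 * (s - 2)) *
    (rho \<xi> ^ 4 * (norm (velocity_part X))\<^sup>2 + (rho \<xi>)\<^sup>2 * (cmod (X $ None))\<^sup>2)"
  "energy (s - 2) (s - 1) \<xi> X = rho \<xi> powr (2 * (s - 2)) *
    ((norm (velocity_part X))\<^sup>2 + (rho \<xi>)\<^sup>2 * (cmod (X $ None))\<^sup>2)"
proof -
  have 1: "rho \<xi> powr (2 * s) = rho \<xi> powr (2 * (s - 2)) * rho \<xi> ^ 4"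
    using powr_add[of "rho \<xi>" "2 * (s - 2)" "real 4"] powr_realpow[OF rho_pos, of \<xi> 4] by simp
  have 2: "rho \<xi> powr (2 * (s - 1)) = rho \<xi> powr (2 * (s - 2)) * (rho \<xi>)\<^sup>2"
    using powr_add[of "rho \<xi>" "2 * (s - 2)" "real 2"] powr_realpow[OF rho_pos, of \<xi> 2] by simp
  show "energy s (s - 1) \<xi> X = rho \<xi> powr (2 * (s - 2)) *
      (rho \<xi> ^ 4 * (norm (velocity_part X))\<^sup>2 + (rho \<xi>)\<^sup>2 * (cmod (X $ None))\<^sup>2)"
    unfolding energy_def 1 2 by (simp add: distrib_left)
  show "energy (s - 2) (s - 1) \<xi> X = rho \<xi> powr (2 * (s - 2)) *
      ((norm (velocity_part X))\<^sup>2 + (rho \<xi>)\<^sup>2 * (cmod (X $ None))\<^sup>2)"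
    unfolding energy_def 2 by (simp add: distrib_left)
qed

lemma energy_lower:
  fixes a :: "'n::finite tensor"
  assumes "tensor_symmetric a" "relaxed_elliptic C a" "C > 0" "\<xi> \<noteq> 0"
  shows "energy s (s - 1) \<xi> X \<le> 8 * (symbol_const C (real CARD('n) ^ 4 * tensor_norm a))\<^sup>2 *
    energy (s - 2) (s - 1) \<xi> (symbol a \<xi> *v X)"
  using mult_left_mono[OF symbol_lower_bound_sq[OF assms, of X], of "rho \<xi> powr (2 * (s - 2))"]
  unfolding energy_factor by (simp add: mult.left_commute)

lemma energy_upper:
  fixes a :: "'n::finite tensor"
  shows "\<exists>K\<ge>0. \<forall>s \<xi> X. energy (s - 2) (s - 1) \<xi> (symbol a \<xi> *v X) \<le> K * energy s (s - 1) \<xi> X"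
proof -
  obtain K where "K \<ge> 0" and K: "\<And>\<xi> X. (norm (velocity_part (symbol a \<xi> *v X)))\<^sup>2 +
      (rho \<xi>)\<^sup>2 * (cmod ((symbol a \<xi> *v X) $ None))\<^sup>2
    \<le> K * (rho \<xi> ^ 4 * (norm (velocity_part X))\<^sup>2 + (rho \<xi>)\<^sup>2 * (cmod (X $ None))\<^sup>2)"
    using symbol_upper_bound_sq[of a] by blast
  then have "energy (s - 2) (s - 1) \<xi> (symbol a \<xi> *v X) \<le> K * energy s (s - 1) \<xi> X" for s \<xi> X
    using mult_left_mono[OF K[of \<xi> X], of "rho \<xi> powr (2 * (s - 2))"]
    unfolding energy_factor by (simp add: mult.left_commute)
  then show ?thesis
    using \<open>K \<ge> 0\<close> by blast
qed

text \<open>Since \<open>rho\<close> is at least 1, the exponent obtained by rounding up the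
  absolute value of \<open>s\<close> covers both signs of \<open>s\<close>.\<close>

lemma weighted_bound:
  assumes "rho \<xi> powr (2 * s) * c\<^sup>2 \<le> B" "0 \<le> c"
  shows "c \<le> sqrt B * rho \<xi> ^ nat \<lceil>\<bar>s\<bar>\<rceil>"
proof -
  have "(rho \<xi> powr s * c)\<^sup>2 \<le> B"
    using assms(1) rho_pos[of \<xi>]
    by (simp add: power_mult_distrib powr_add[symmetric] power2_eq_square[of "_ powr _"])
  then have le: "rho \<xi> powr s * c \<le> sqrt B"
    by (rule real_le_rsqrt)
  have "rho \<xi> powr (- s) \<le> rho \<xi> powr real (nat \<lceil>\<bar>s\<bar>\<rceil>)"
    by (intro powr_mono rho_ge_1) linarith
  also have "\<dots> = rho \<xi> ^ nat \<lceil>\<bar>s\<bar>\<rceil>"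
    by (rule powr_realpow[OF rho_pos])
  finally have p: "rho \<xi> powr (- s) \<le> rho \<xi> ^ nat \<lceil>\<bar>s\<bar>\<rceil>" .
  have "c = rho \<xi> powr (- s) * (rho \<xi> powr s * c)"
    using rho_pos[of \<xi>] by (simp add: powr_minus)
  also have "\<dots> \<le> rho \<xi> ^ nat \<lceil>\<bar>s\<bar>\<rceil> * sqrt B"
    using assms(2) rho_pos[of \<xi>] by (intro mult_mono p le) auto
  finally show ?thesis
    by (simp add: mult.commute)
qed

lemma temperate_energy:
  assumes B: "\<And>\<xi>. energy s t \<xi> (X \<xi>) \<le> B"
  shows "temperate (\<lambda>\<xi>. X \<xi> $ r)"
proof (cases r)
  case None
  have "cmod (X \<xi> $ None) \<le> sqrt B * rho \<xi> ^ nat \<lceil>\<bar>t\<bar>\<rceil>" for \<xi>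
    using B[of \<xi>] by (intro weighted_bound) (auto simp: energy_def intro: order_trans[rotated])
  then show ?thesis
    unfolding temperate_def None by blast
next
  case (Some k)
  have "cmod (X \<xi> $ Some k) \<le> sqrt B * rho \<xi> ^ nat \<lceil>\<bar>s\<bar>\<rceil>" for \<xi>
  proof -
    have "cmod (X \<xi> $ Some k) \<le> norm (velocity_part (X \<xi>))"
      using Finite_Cartesian_Product.norm_nth_le[of "velocity_part (X \<xi>)" k] by (simp add: velocity_part_def)
    also have "\<dots> \<le> sqrt B * rho \<xi> ^ nat \<lceil>\<bar>s\<bar>\<rceil>"
      using B[of \<xi>] by (intro weighted_bound) (auto simp: energy_def intro: order_trans[rotated])
    finally show ?thesis .
  qed
  then show ?thesis
    unfolding temperate_def Some by blast
qed

lemma has_sum_finite_sum: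
  fixes f :: "'i \<Rightarrow> 'a \<Rightarrow> real"
  assumes "\<And>i. i \<in> I \<Longrightarrow> (f i has_sum S i) A"
  shows "((\<lambda>x. \<Sum>i\<in>I. f i x) has_sum (\<Sum>i\<in>I. S i)) A"
  using assms
  by (induction I rule: infinite_finite_induct) (auto intro!: has_sum_add has_sum_0)

lemma sobolev_norm_nonneg: "0 \<le> sobolev_norm s g"
  unfolding sobolev_norm_def by (intro real_sqrt_ge_zero infsum_nonneg) auto

lemma vec_sobolev_norm_nonneg: "0 \<le> vec_sobolev_norm s u"
  by (simp add: vec_sobolev_norm_def L2_set_nonneg)

lemma sobolev_norm_has_sum:
  assumes "g \<in> sobolev s"
  shows "((\<lambda>\<xi>. rho \<xi> powr (2 * s) * (cmod (fourier g \<xi>))\<^sup>2) has_sum (sobolev_norm s g)\<^sup>2) UNIV"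
proof -
  have "(sobolev_norm s g)\<^sup>2 = (\<Sum>\<^sub>\<infinity>\<xi>. rho \<xi> powr (2 * s) * (cmod (fourier g \<xi>))\<^sup>2)"
    unfolding sobolev_norm_def by (intro real_sqrt_pow2 infsum_nonneg) auto
  then show ?thesis
    using assms by (simp add: sobolev_def)
qed

lemma energy_fourier_pair:
  "energy s t \<xi> (fourier_pair up \<xi>) =
    (\<Sum>k\<in>UNIV. rho \<xi> powr (2 * s) * (cmod (fourier (fst up $ k) \<xi>))\<^sup>2) +
    rho \<xi> powr (2 * t) * (cmod (fourier (snd up) \<xi>))\<^sup>2"
  by (simp add: energy_def velocity_part_def fourier_pair_def norm_vec_def L2_set_def sum_nonneg
      sum_distrib_left)

lemma energy_has_sum:
  assumes "up \<in> vecs (sobolev s) \<times> sobolev t"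
  shows "((\<lambda>\<xi>. energy s t \<xi> (fourier_pair up \<xi>)) has_sum
    ((vec_sobolev_norm s (fst up))\<^sup>2 + (sobolev_norm t (snd up))\<^sup>2)) UNIV"
proof -
  have "(vec_sobolev_norm s (fst up))\<^sup>2 = (\<Sum>k\<in>UNIV. (sobolev_norm s (fst up $ k))\<^sup>2)"
    by (simp add: vec_sobolev_norm_def L2_set_def sum_nonneg)
  then show ?thesis
    unfolding energy_fourier_pair using assms
    by (auto simp: vecs_def intro!: has_sum_add has_sum_finite_sum sobolev_norm_has_sum)
qed

lemma sobolev_pairI:
  assumes "(\<lambda>\<xi>. energy s t \<xi> (fourier_pair up \<xi>)) summable_on UNIV"
  shows "up \<in> vecs (sobolev s) \<times> sobolev t"
proof -
  have "rho \<xi> powr (2 * s) * (cmod (fourier (fst up $ k) \<xi>))\<^sup>2 \<le> energy s t \<xi> (fourier_pair up \<xi>)" for k \<xi>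
  proof -
    have "rho \<xi> powr (2 * s) * (cmod (fourier (fst up $ k) \<xi>))\<^sup>2 \<le>
        (\<Sum>k\<in>UNIV. rho \<xi> powr (2 * s) * (cmod (fourier (fst up $ k) \<xi>))\<^sup>2)"
      by (rule member_le_sum) auto
    then show ?thesis
      by (simp add: energy_fourier_pair add_increasing2)
  qed
  then have "fst up $ k \<in> sobolev s" for k
    unfolding sobolev_def mem_Collect_eq by (intro summable_on_comparison_test[OF assms]) auto
  moreover have "snd up \<in> sobolev t"
    unfolding sobolev_def mem_Collect_eq
    by (intro summable_on_comparison_test[OF assms]) (auto simp: energy_fourier_pair sum_nonneg)
  ultimately show ?thesis
    by (auto simp: vecs_def mem_Times_iff)
qed

text \<open>Sums a frequencywise comparison. The energies add squares whereas
  \<open>pair_norm\<close> adds norms; squaring the sum of two norms costs the 2 under the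
  root.\<close>

lemma sobolev_pair_transfer:
  assumes fg: "fg \<in> vecs (sobolev s') \<times> sobolev t'" and K: "K \<ge> 0"
    and le: "\<And>\<xi>. energy s t \<xi> (fourier_pair up \<xi>) \<le> K * energy s' t' \<xi> (fourier_pair fg \<xi>)"
  shows "up \<in> vecs (sobolev s) \<times> sobolev t" "pair_norm s t up \<le> sqrt (2 * K) * pair_norm s' t' fg"
proof -
  note sum = has_sum_cmult_right[OF energy_has_sum[OF fg], of K]
  show up: "up \<in> vecs (sobolev s) \<times> sobolev t"
    by (intro sobolev_pairI summable_on_comparison_test[OF has_sum_imp_summable[OF sum]] le energy_nonneg)
  let ?A = "vec_sobolev_norm s (fst up)" and ?B = "sobolev_norm t (snd up)"
  let ?A' = "vec_sobolev_norm s' (fst fg)" and ?B' = "sobolev_norm t' (snd fg)"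
  have "(?A + ?B)\<^sup>2 \<le> 2 * (?A\<^sup>2 + ?B\<^sup>2)"
    using sum_squares_bound[of ?A ?B] by (simp add: power2_sum)
  also have "\<dots> \<le> 2 * (K * (?A'\<^sup>2 + ?B'\<^sup>2))"
    using has_sum_mono[OF energy_has_sum[OF up] sum le] by simp
  also have "\<dots> \<le> 2 * (K * (?A' + ?B')\<^sup>2)"
    using K vec_sobolev_norm_nonneg[of s' "fst fg"] sobolev_norm_nonneg[of t' "snd fg"]
    by (intro mult_left_mono) (auto simp: power2_sum)
  also have "\<dots> = (sqrt (2 * K) * (?A' + ?B'))\<^sup>2"
    using K by (simp add: power_mult_distrib)
  finally show "pair_norm s t up \<le> sqrt (2 * K) * pair_norm s' t' fg"
    unfolding pair_norm_def
    by (rule power2_le_imp_le)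
       (simp add: K vec_sobolev_norm_nonneg sobolev_norm_nonneg add_nonneg_nonneg)
qed

lemma sobolev0_pair_iff:
  "up \<in> vecs (sobolev0 s) \<times> sobolev0 t \<longleftrightarrow>
    up \<in> vecs (sobolev s) \<times> sobolev t \<and> fourier_pair up 0 = 0"
  by (auto simp: vecs_def sobolev0_def zero_mean_iff fourier_pair_def vec_eq_iff mem_Times_iff
      split: option.splits)

text \<open>Rapid decay leaves room for the summable majorant; conversely each single term is
  bounded by the whole Sobolev sum, with \<open>s = m\<close> for the decay of order
  \<open>m\<close>.\<close>

lemma range_of_test_eq_sobolev: "g \<in> range of_test \<longleftrightarrow> (\<forall>s. g \<in> sobolev s)"
  for g :: "'n::finite pdistr"
proof
  assume "g \<in> range of_test"
  then have r: "rapid (fourier g)"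
    by (simp add: range_of_test_iff)
  show "\<forall>s. g \<in> sobolev s"
  proof
    fix s :: real
    define m where "m = nat \<lceil>\<bar>s\<bar>\<rceil>"
    \<comment> \<open>After squaring, \<open>m\<close> powers absorb the weight and the additional
      \<open>CARD('n)\<close> leave the majorant of \<open>summable_rho\<close>.\<close>
    obtain B where B: "\<And>\<xi>. cmod (fourier g \<xi>) * rho \<xi> ^ (m + CARD('n)) \<le> B"
      using r unfolding rapid_def by blast
    have "rho \<xi> powr (2 * s) * (cmod (fourier g \<xi>))\<^sup>2 \<le> B\<^sup>2 * (1 / rho \<xi> ^ (2 * CARD('n)))" for \<xi>
    proof -
      have "rho \<xi> powr (2 * s) \<le> rho \<xi> powr real (2 * m)"
        by (intro powr_mono rho_ge_1) (unfold m_def, linarith)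
      also have "\<dots> = rho \<xi> ^ (2 * m)"
        by (rule powr_realpow[OF rho_pos])
      finally have "rho \<xi> powr (2 * s) * (cmod (fourier g \<xi>))\<^sup>2 \<le> rho \<xi> ^ (2 * m) * (cmod (fourier g \<xi>))\<^sup>2"
        by (rule mult_right_mono) simp
      also have "\<dots> = (cmod (fourier g \<xi>) * rho \<xi> ^ (m + CARD('n)))\<^sup>2 * (1 / rho \<xi> ^ (2 * CARD('n)))"
        using rho_pos[of \<xi>]
        by (simp add: power_mult_distrib power_add power_mult[symmetric] mult.commute[of _ 2])
      also have "\<dots> \<le> B\<^sup>2 * (1 / rho \<xi> ^ (2 * CARD('n)))"
        using rho_pos[of \<xi>] by (intro mult_right_mono power_mono B) auto
      finally show ?thesis .
    qed
    then show "g \<in> sobolev s"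
      unfolding sobolev_def mem_Collect_eq
      by (intro summable_on_comparison_test[OF summable_on_cmult_right[OF summable_rho]]) auto
  qed
next
  assume g: "\<forall>s. g \<in> sobolev s"
  have "\<exists>B. \<forall>\<xi>. cmod (fourier g \<xi>) * rho \<xi> ^ m \<le> B" for m
  proof -
    let ?S = "(sobolev_norm (real m) g)\<^sup>2"
    have "cmod (fourier g \<xi>) * rho \<xi> ^ m \<le> sqrt ?S" for \<xi>
    proof (rule real_le_rsqrt)
      have "rho \<xi> powr (2 * real m) = rho \<xi> ^ (2 * m)"
        using powr_realpow[OF rho_pos, of \<xi> "2 * m"] by simp
      moreover have "(\<Sum>\<eta>\<in>{\<xi>}. rho \<eta> powr (2 * real m) * (cmod (fourier g \<eta>))\<^sup>2) \<le> ?S"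
        by (rule finite_sum_le_has_sum[OF sobolev_norm_has_sum]) (use g in auto)
      ultimately show "(cmod (fourier g \<xi>) * rho \<xi> ^ m)\<^sup>2 \<le> ?S"
        by (simp add: power_mult_distrib power_mult[symmetric] mult.commute)
    qed
    then show ?thesis
      by blast
  qed
  then show "g \<in> range of_test"
    by (simp add: range_of_test_iff rapid_def)
qed

lemma smooth0_pair_iff:
  "up \<in> vecs smooth0 \<times> smooth0 \<longleftrightarrow> (\<forall>s. up \<in> vecs (sobolev0 s) \<times> sobolev0 (s - 1))"
  for up :: "('n::finite pdistr ^ 'n) \<times> 'n pdistr"
proof -
  have shift: "(\<forall>s. g \<in> sobolev (s - 1)) \<longleftrightarrow> (\<forall>s. g \<in> sobolev s)" for g :: "'n pdistr"
    by (metis add_diff_cancel)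
  show ?thesis
    by (auto simp: vecs_def smooth0_def sobolev0_def range_of_test_eq_sobolev mem_Times_iff
        all_conj_distrib shift)
qed

text \<open>Subtracting finitely many terms deletes these frequencies, so the squared norm of the
  remainder is the total minus a finite partial sum.\<close>

lemma sobolev_series_fourier:
  assumes "g \<in> sobolev0 s"
  shows "sobolev_series s (fourier g) (UNIV - {0}) g"
proof -
  have g: "g \<in> sobolev s" and g0: "fourier g 0 = 0"
    using assms by (auto simp: sobolev0_def zero_mean_iff)
  let ?w = "\<lambda>\<xi>. rho \<xi> powr (2 * s) * (cmod (fourier g \<xi>))\<^sup>2"
  let ?T = "(sobolev_norm s g)\<^sup>2"
  note sum = sobolev_norm_has_sum[OF g]
  \<comment> \<open>Zero mean makes the term at frequency 0 vanish, so it may be left out of the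
    sum.\<close>
  have "(?w has_sum ?T) (UNIV - {0})"
    using sum by (rule has_sum_cong_neutral[THEN iffD1, rotated -1]) (auto simp: g0)
  then have "((\<lambda>F. sqrt (?T - sum ?w F)) \<longlongrightarrow> sqrt (?T - ?T)) (finite_subsets_at_top (UNIV - {0}))"
    unfolding has_sum_def by (intro tendsto_intros)
  moreover have "sobolev_norm s (g - (\<Sum>\<xi>\<in>F. fourier g \<xi> *\<^sub>C of_test (echar \<xi>))) = sqrt (?T - sum ?w F)"
    if "finite F" for F
  proof -
    have "fourier (g - (\<Sum>\<xi>\<in>F. fourier g \<xi> *\<^sub>C of_test (echar \<xi>))) \<xi> = (if \<xi> \<in> F then 0 else fourier g \<xi>)" for \<xi>
      using that
      by (simp add: fourier_diff fourier_sum fourier_scaleC fourier_of_test_echar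
          if_distrib[of "\<lambda>x. _ * x"] cong: if_cong)
    then have "(\<Sum>\<^sub>\<infinity>\<xi>. rho \<xi> powr (2 * s) *
        (cmod (fourier (g - (\<Sum>\<xi>\<in>F. fourier g \<xi> *\<^sub>C of_test (echar \<xi>))) \<xi>))\<^sup>2) = infsum ?w (UNIV - F)"
      by (intro infsum_cong_neutral) auto
    also have "\<dots> = ?T - sum ?w F"
      by (intro infsumI has_sum_Diff sum has_sum_finite that) auto
    finally show ?thesis
      by (simp add: sobolev_norm_def)
  qed
  then have "\<forall>\<^sub>F F in finite_subsets_at_top (UNIV - {0}).
      sqrt (?T - sum ?w F) = sobolev_norm s (g - (\<Sum>\<xi>\<in>F. fourier g \<xi> *\<^sub>C of_test (echar \<xi>)))"
    by (intro eventually_finite_subsets_at_top_weakI) simp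
  ultimately have "((\<lambda>F. sobolev_norm s (g - (\<Sum>\<xi>\<in>F. fourier g \<xi> *\<^sub>C of_test (echar \<xi>)))) \<longlongrightarrow> sqrt (?T - ?T))
      (finite_subsets_at_top (UNIV - {0}))"
    by (rule Lim_transform_eventually)
  then show ?thesis
    using g by (simp add: sobolev_series_def)
qed

lemma real_valued_pair_iff:
  "(\<forall>k. real_valued (u $ k)) \<and> real_valued p \<longleftrightarrow>
    (\<forall>\<xi>. fourier_pair (u, p) (- \<xi>) = (\<chi> r. cnj (fourier_pair (u, p) \<xi> $ r)))"
proof -
  have "fourier_pair (u, p) (- \<xi>) = (\<chi> r. cnj (fourier_pair (u, p) \<xi> $ r)) \<longleftrightarrow>
      (\<forall>k. fourier (u $ k) (- \<xi>) = cnj (fourier (u $ k) \<xi>)) \<and> fourier p (- \<xi>) = cnj (fourier p \<xi>)" for \<xi>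
    by (auto simp: vec_eq_iff fourier_pair_def split: option.split)
  then show ?thesis
    by (auto simp: real_valued_iff)
qed

section \<open>Solvability, regularity and reality for a fixed elliptic tensor\<close>

definition stokes_bound :: "real \<Rightarrow> 'n::finite tensor \<Rightarrow> real" where
  "stokes_bound C a = 8 * (symbol_const C (real CARD('n) ^ 4 * tensor_norm a))\<^sup>2"

lemma stokes_bound_nonneg: "0 \<le> stokes_bound C a"
  by (simp add: stokes_bound_def)

context
  fixes a :: "'n::finite tensor" and C\<^sub>A :: real
  assumes C\<^sub>A: "C\<^sub>A > 0" and sym: "tensor_symmetric a" and ell: "relaxed_elliptic C\<^sub>A a"
begin

lemma fourier_pair_solution:
  "\<xi> \<noteq> 0 \<Longrightarrow> fourier_pair up \<xi> = matrix_inv (symbol a \<xi>) *v fourier_pair (stokes_S a up) \<xi>"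
  by (simp add: fourier_pair_stokes_S[OF sym] matrix_inv_mult(1)[OF invertible_symbol[OF sym ell C\<^sub>A]])

lemma stokes_S_inject:
  assumes "fourier_pair up 0 = 0" "fourier_pair vq 0 = 0" "stokes_S a up = stokes_S a vq"
  shows "up = vq"
proof (rule fourier_pair_inject)
  show "fourier_pair up \<xi> = fourier_pair vq \<xi>" for \<xi>
    using assms fourier_pair_solution[of \<xi> up] fourier_pair_solution[of \<xi> vq]
    by (cases "\<xi> = 0") simp_all
qed

text \<open>No Sobolev membership of \<open>up\<close> is assumed beforehand. The lemma thus serves
  the existence proof, where \<open>up\<close> is a mere distribution, and smooth data, for every
  \<open>s\<close> at once.\<close>

lemma stokes_regularity:
  assumes 0: "fourier_pair up 0 = 0"
    and fg: "stokes_S a up \<in> vecs (sobolev (s - 2)) \<times> sobolev (s - 1)"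
  shows "up \<in> vecs (sobolev0 s) \<times> sobolev0 (s - 1)"
    "pair_norm s (s - 1) up \<le> sqrt (2 * stokes_bound C\<^sub>A a) * pair_norm (s - 2) (s - 1) (stokes_S a up)"
proof -
  have "energy s (s - 1) \<xi> (fourier_pair up \<xi>) \<le>
      stokes_bound C\<^sub>A a * energy (s - 2) (s - 1) \<xi> (fourier_pair (stokes_S a up) \<xi>)" for \<xi>
  proof (cases "\<xi> = 0")
    case True
    then show ?thesis
      by (simp add: 0 energy_0 energy_nonneg stokes_bound_nonneg)
  next
    case False
    then show ?thesis
      using energy_lower[OF sym ell C\<^sub>A] by (simp add: fourier_pair_stokes_S[OF sym] stokes_bound_def)
  qed
  note * = sobolev_pair_transfer[OF fg stokes_bound_nonneg this]
  show "up \<in> vecs (sobolev0 s) \<times> sobolev0 (s - 1)"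
    using *(1) 0 unfolding sobolev0_pair_iff by blast
  show "pair_norm s (s - 1) up \<le> sqrt (2 * stokes_bound C\<^sub>A a) * pair_norm (s - 2) (s - 1) (stokes_S a up)"
    by (rule *(2))
qed

lemma stokes_S_bounded:
  "\<exists>K. \<forall>s. \<forall>up\<in>vecs (sobolev0 s) \<times> sobolev0 (s - 1).
    stokes_S a up \<in> vecs (sobolev0 (s - 2)) \<times> sobolev0 (s - 1) \<and>
    pair_norm (s - 2) (s - 1) (stokes_S a up) \<le> K * pair_norm s (s - 1) up"
proof -
  obtain K where K: "K \<ge> 0"
    "\<And>s \<xi> X. energy (s - 2) (s - 1) \<xi> (symbol a \<xi> *v X) \<le> K * energy s (s - 1) \<xi> X"
    using energy_upper[of a] by blast
  have "stokes_S a up \<in> vecs (sobolev0 (s - 2)) \<times> sobolev0 (s - 1) \<and>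
      pair_norm (s - 2) (s - 1) (stokes_S a up) \<le> sqrt (2 * K) * pair_norm s (s - 1) up"
    if "up \<in> vecs (sobolev0 s) \<times> sobolev0 (s - 1)" for s up
  proof -
    have up: "up \<in> vecs (sobolev s) \<times> sobolev (s - 1)" and 0: "fourier_pair up 0 = 0"
      using that unfolding sobolev0_pair_iff by blast+
    have "energy (s - 2) (s - 1) \<xi> (fourier_pair (stokes_S a up) \<xi>) \<le>
        K * energy s (s - 1) \<xi> (fourier_pair up \<xi>)" for \<xi>
      unfolding fourier_pair_stokes_S[OF sym] by (rule K(2))
    note * = sobolev_pair_transfer[OF up K(1) this]
    show ?thesis
      unfolding sobolev0_pair_iff using * by (simp add: fourier_pair_stokes_S[OF sym] 0)
  qed
  then show ?thesis
    by blast
qed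

text \<open>The inverse symbol, completed by 0 at frequency 0, gives coefficients of bounded energy.
  They are therefore temperate and define a distribution, whose Sobolev membership follows from
  \<open>stokes_regularity\<close>.\<close>

lemma stokes_solvable:
  assumes fg: "fg \<in> vecs (sobolev0 (s - 2)) \<times> sobolev0 (s - 1)"
  shows "\<exists>up \<in> vecs (sobolev0 s) \<times> sobolev0 (s - 1). stokes_S a up = fg"
proof -
  have fg': "fg \<in> vecs (sobolev (s - 2)) \<times> sobolev (s - 1)" and fg0: "fourier_pair fg 0 = 0"
    using fg unfolding sobolev0_pair_iff by blast+
  define X where "X \<xi> = (if \<xi> = 0 then 0 else matrix_inv (symbol a \<xi>) *v fourier_pair fg \<xi>)" for \<xi>
  have X: "symbol a \<xi> *v X \<xi> = fourier_pair fg \<xi>" for \<xi>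
    by (simp add: X_def fg0 matrix_inv_mult(2)[OF invertible_symbol[OF sym ell C\<^sub>A]])
  let ?S = "(vec_sobolev_norm (s - 2) (fst fg))\<^sup>2 + (sobolev_norm (s - 1) (snd fg))\<^sup>2"
  \<comment> \<open>A single nonnegative term is at most the total sum.\<close>
  have S: "energy (s - 2) (s - 1) \<xi> (fourier_pair fg \<xi>) \<le> ?S" for \<xi>
    using finite_sum_le_has_sum[OF energy_has_sum[OF fg'], of "{\<xi>}"] by (simp add: energy_nonneg)
  have "energy s (s - 1) \<xi> (X \<xi>) \<le> stokes_bound C\<^sub>A a * ?S" for \<xi>
  proof (cases "\<xi> = 0")
    case True
    then show ?thesis
      by (simp add: X_def energy_0 stokes_bound_nonneg add_nonneg_nonneg)
  next
    case False
    then have "energy s (s - 1) \<xi> (X \<xi>) \<le> stokes_bound C\<^sub>A a * energy (s - 2) (s - 1) \<xi> (fourier_pair fg \<xi>)"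
      using energy_lower[OF sym ell C\<^sub>A, of \<xi> s "X \<xi>"] by (simp add: X stokes_bound_def)
    also have "\<dots> \<le> stokes_bound C\<^sub>A a * ?S"
      by (intro mult_left_mono S stokes_bound_nonneg)
    finally show ?thesis .
  qed
  from ex_fourier_pair[OF temperate_energy[OF this]]
  obtain up where up: "\<And>\<xi>. fourier_pair up \<xi> = X \<xi>"
    by blast
  have "stokes_S a up = fg"
    by (rule fourier_pair_inject) (simp add: fourier_pair_stokes_S[OF sym] up X)
  moreover have "up \<in> vecs (sobolev0 s) \<times> sobolev0 (s - 1)"
    by (rule stokes_regularity) (simp_all add: up X_def fg' \<open>stokes_S a up = fg\<close>)
  ultimately show ?thesis
    by blast
qed

lemma top_iso_stokes_S:
  "top_iso_on (vecs (sobolev0 s) \<times> sobolev0 (s - 1)) (pair_norm s (s - 1))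
     (vecs (sobolev0 (s - 2)) \<times> sobolev0 (s - 1)) (pair_norm (s - 2) (s - 1)) (stokes_S a)"
  unfolding top_iso_on_def
proof (intro conjI)
  let ?V = "vecs (sobolev0 s) \<times> sobolev0 (s - 1)" and ?W = "vecs (sobolev0 (s - 2)) \<times> sobolev0 (s - 1)"
  obtain K where K: "\<And>up. up \<in> ?V \<Longrightarrow> stokes_S a up \<in> ?W"
    "\<And>up. up \<in> ?V \<Longrightarrow> pair_norm (s - 2) (s - 1) (stokes_S a up) \<le> K * pair_norm s (s - 1) up"
    using stokes_S_bounded by blast
  show "clinear (stokes_S a)"
    by (rule clinear_stokes_S[OF sym])
  show "bij_betw (stokes_S a) ?V ?W"
  proof (rule bij_betw_imageI)
    show "inj_on (stokes_S a) ?V"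
      using stokes_S_inject by (intro inj_onI) (simp only: sobolev0_pair_iff)
    show "stokes_S a ` ?V = ?W"
    proof
      show "stokes_S a ` ?V \<subseteq> ?W"
        using K(1) by (rule image_subsetI)
      show "?W \<subseteq> stokes_S a ` ?V"
      proof
        fix fg :: "('n pdistr ^ 'n) \<times> 'n pdistr"
        assume "fg \<in> ?W"
        from stokes_solvable[OF this] show "fg \<in> stokes_S a ` ?V"
          by blast
      qed
    qed
  qed
  show "\<exists>K. \<forall>up\<in>?V. pair_norm (s - 2) (s - 1) (stokes_S a up) \<le> K * pair_norm s (s - 1) up"
    using K(2) by blast
  have "pair_norm s (s - 1) up \<le> sqrt (2 * stokes_bound C\<^sub>A a) * pair_norm (s - 2) (s - 1) (stokes_S a up)"
    if "up \<in> ?V" for up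
  proof (rule stokes_regularity(2))
    show "fourier_pair up 0 = 0"
      using that unfolding sobolev0_pair_iff by (rule conjunct2)
    show "stokes_S a up \<in> vecs (sobolev (s - 2)) \<times> sobolev (s - 1)"
      using K(1)[OF that] unfolding sobolev0_pair_iff by (rule conjunct1)
  qed
  then show "\<exists>K. \<forall>up\<in>?V. pair_norm s (s - 1) up \<le> K * pair_norm (s - 2) (s - 1) (stokes_S a up)"
    by blast
qed

text \<open>By \<open>symbol_cnj\<close> and invertibility of the symbol, conjugate symmetry of the
  coefficients passes in both directions between data and solution.\<close>

lemma real_valued_solution_iff:
  assumes 0: "fourier_pair (u, p) 0 = 0" and fg: "stokes_S a (u, p) = (f, g)"
  shows "(\<forall>k. real_valued (f $ k)) \<and> real_valued g \<longleftrightarrow> (\<forall>k. real_valued (u $ k)) \<and> real_valued p"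
proof -
  let ?X = "fourier_pair (u, p)" and ?cnj = "\<lambda>X :: complex ^ 'n option. \<chi> r. cnj (X $ r)"
  have Y: "fourier_pair (f, g) \<xi> = symbol a \<xi> *v ?X \<xi>" for \<xi>
    using fourier_pair_stokes_S[OF sym, of "(u, p)" \<xi>] by (simp add: fg)
  have "symbol a (- \<xi>) *v ?X (- \<xi>) = ?cnj (symbol a \<xi> *v ?X \<xi>) \<longleftrightarrow> ?X (- \<xi>) = ?cnj (?X \<xi>)" for \<xi>
  proof (cases "\<xi> = 0")
    case True
    then show ?thesis
      by (simp add: 0)
  next
    case False
    then have "- \<xi> \<noteq> 0"
      by simp
    then show ?thesis
      unfolding symbol_cnj[symmetric] by (metis matrix_inv_mult(1)[OF invertible_symbol[OF sym ell C\<^sub>A]])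
  qed
  then show ?thesis
    unfolding real_valued_pair_iff Y by simp
qed

end

text \<open>The function \<open>C\<close> is chosen before the tensor and \<open>s\<close>, and
  depends on the dimension through the type. The spaces are complex; the equivalence with
  \<open>real_valued\<close> adds the real version.\<close>

theorem theorem1:
  "\<exists>C :: real \<Rightarrow> real \<Rightarrow> real. \<forall>(a :: 'n::finite tensor) C\<^sub>A.
     C\<^sub>A > 0 \<and> tensor_symmetric a \<and> relaxed_elliptic C\<^sub>A a \<longrightarrow>
     C C\<^sub>A (tensor_norm a) > 0 \<and>
     (\<forall>\<xi>. \<xi> \<noteq> 0 \<longrightarrow> invertible (symbol a \<xi>)) \<and>
     (\<forall>s.
       (\<forall>f \<in> vecs (sobolev0 (s - 2)). \<forall>g \<in> sobolev0 (s - 1).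
          (\<exists>!up. up \<in> vecs (sobolev0 s) \<times> sobolev0 (s - 1) \<and> stokes_S a up = (f, g)) \<and>
          (\<forall>u \<in> vecs (sobolev0 s). \<forall>p \<in> sobolev0 (s - 1). stokes_S a (u, p) = (f, g) \<longrightarrow>
             (\<forall>k. sobolev_series s (fourier (u $ k)) (UNIV - {0}) (u $ k)) \<and>
             sobolev_series (s - 1) (fourier p) (UNIV - {0}) p \<and>
             (\<forall>\<xi>. \<xi> \<noteq> 0 \<longrightarrow>
                fourier_pair (u, p) \<xi> = matrix_inv (symbol a \<xi>) *v fourier_pair (f, g) \<xi>) \<and>
             vec_sobolev_norm s u + sobolev_norm (s - 1) p
               \<le> C C\<^sub>A (tensor_norm a) * (vec_sobolev_norm (s - 2) f + sobolev_norm (s - 1) g) \<and>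
             ((\<forall>k. real_valued (f $ k)) \<and> real_valued g \<longleftrightarrow>
                (\<forall>k. real_valued (u $ k)) \<and> real_valued p))) \<and>
       top_iso_on (vecs (sobolev0 s) \<times> sobolev0 (s - 1)) (pair_norm s (s - 1))
         (vecs (sobolev0 (s - 2)) \<times> sobolev0 (s - 1)) (pair_norm (s - 2) (s - 1)) (stokes_S a)) \<and>
     (\<forall>f \<in> vecs smooth0. \<forall>g \<in> smooth0.
        (\<exists>up \<in> vecs smooth0 \<times> smooth0. stokes_S a up = (f, g)) \<and>
        (\<forall>s. \<forall>u \<in> vecs (sobolev0 s). \<forall>p \<in> sobolev0 (s - 1). stokes_S a (u, p) = (f, g) \<longrightarrow>
           u \<in> vecs smooth0 \<and> p \<in> smooth0))"
proof (rule exI[of _ "\<lambda>C\<^sub>A M. sqrt (2 * (8 * (symbol_const C\<^sub>A (real CARD('n) ^ 4 * M))\<^sup>2))"],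
    intro allI impI, elim conjE)
  fix a :: "'n tensor" and C\<^sub>A :: real
  assume C\<^sub>A: "C\<^sub>A > 0" and sym: "tensor_symmetric a" and ell: "relaxed_elliptic C\<^sub>A a"
  note stokes = C\<^sub>A sym ell
  \<comment> \<open>This is \<open>sqrt (2 * stokes_bound C\<^sub>A a)\<close> unfolded, so that it
    is visibly a function of \<open>C\<^sub>A\<close> and \<open>tensor_norm a\<close>.\<close>
  let ?C = "sqrt (2 * (8 * (symbol_const C\<^sub>A (real CARD('n) ^ 4 * tensor_norm a))\<^sup>2))"
  have pos: "?C > 0"
    using symbol_const_pos[OF C\<^sub>A, of "real CARD('n) ^ 4 * tensor_norm a"]
    by (simp add: tensor_norm_nonneg)
  have solvable: "\<exists>!up. up \<in> vecs (sobolev0 s) \<times> sobolev0 (s - 1) \<and> stokes_S a up = (f, g)"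
    if "f \<in> vecs (sobolev0 (s - 2))" "g \<in> sobolev0 (s - 1)" for s f g
  proof -
    have "(f, g) \<in> vecs (sobolev0 (s - 2)) \<times> sobolev0 (s - 1)"
      using that by simp
    from stokes_solvable[OF stokes this] obtain up
      where up: "up \<in> vecs (sobolev0 s) \<times> sobolev0 (s - 1)" "stokes_S a up = (f, g)"
      by (elim bexE)
    have inj: "vq = wr"
      if "vq \<in> vecs (sobolev0 s) \<times> sobolev0 (s - 1)" "wr \<in> vecs (sobolev0 s) \<times> sobolev0 (s - 1)"
        "stokes_S a vq = stokes_S a wr" for vq wr
      by (rule stokes_S_inject[OF stokes conjunct2[OF that(1)[unfolded sobolev0_pair_iff]]
          conjunct2[OF that(2)[unfolded sobolev0_pair_iff]] that(3)])
    show ?thesis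
      using up by (intro ex1I[of _ up] conjI; (elim conjE)?) (assumption | rule inj, simp_all)+
  qed
  have estimate: "vec_sobolev_norm s u + sobolev_norm (s - 1) p
      \<le> ?C * (vec_sobolev_norm (s - 2) f + sobolev_norm (s - 1) g)"
    if "f \<in> vecs (sobolev0 (s - 2))" "g \<in> sobolev0 (s - 1)" "fourier_pair (u, p) 0 = 0"
      "stokes_S a (u, p) = (f, g)" for s u p f g
  proof -
    have "(f, g) \<in> vecs (sobolev (s - 2)) \<times> sobolev (s - 1)"
      using that(1,2) sobolev0_pair_iff[of "(f, g)" "s - 2" "s - 1"] by simp
    then show ?thesis
      using stokes_regularity(2)[OF stokes that(3), of s]
      by (simp add: that(4) pair_norm_def stokes_bound_def)
  qed
  have zero: "fourier_pair (u, p) 0 = 0" if "u \<in> vecs (sobolev0 s)" "p \<in> sobolev0 (s - 1)" for s u p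
    using that sobolev0_pair_iff[of "(u, p)" s "s - 1"] by simp
  have smooth: "up \<in> vecs smooth0 \<times> smooth0"
    if fg: "stokes_S a up \<in> vecs smooth0 \<times> smooth0" and 0: "fourier_pair up 0 = 0" for up
    unfolding smooth0_pair_iff
  proof
    fix s
    have "stokes_S a up \<in> vecs (sobolev (s - 2)) \<times> sobolev (s - 1)"
      using fg by (auto simp: vecs_def smooth0_def range_of_test_eq_sobolev mem_Times_iff)
    then show "up \<in> vecs (sobolev0 s) \<times> sobolev0 (s - 1)"
      by (rule stokes_regularity(1)[OF stokes 0])
  qed
  show "?C > 0 \<and>
     (\<forall>\<xi>. \<xi> \<noteq> 0 \<longrightarrow> invertible (symbol a \<xi>)) \<and>
     (\<forall>s.
       (\<forall>f \<in> vecs (sobolev0 (s - 2)). \<forall>g \<in> sobolev0 (s - 1).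
          (\<exists>!up. up \<in> vecs (sobolev0 s) \<times> sobolev0 (s - 1) \<and> stokes_S a up = (f, g)) \<and>
          (\<forall>u \<in> vecs (sobolev0 s). \<forall>p \<in> sobolev0 (s - 1). stokes_S a (u, p) = (f, g) \<longrightarrow>
             (\<forall>k. sobolev_series s (fourier (u $ k)) (UNIV - {0}) (u $ k)) \<and>
             sobolev_series (s - 1) (fourier p) (UNIV - {0}) p \<and>
             (\<forall>\<xi>. \<xi> \<noteq> 0 \<longrightarrow>
                fourier_pair (u, p) \<xi> = matrix_inv (symbol a \<xi>) *v fourier_pair (f, g) \<xi>) \<and>
             vec_sobolev_norm s u + sobolev_norm (s - 1) p
               \<le> ?C * (vec_sobolev_norm (s - 2) f + sobolev_norm (s - 1) g) \<and>
             ((\<forall>k. real_valued (f $ k)) \<and> real_valued g \<longleftrightarrow>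
                (\<forall>k. real_valued (u $ k)) \<and> real_valued p))) \<and>
       top_iso_on (vecs (sobolev0 s) \<times> sobolev0 (s - 1)) (pair_norm s (s - 1))
         (vecs (sobolev0 (s - 2)) \<times> sobolev0 (s - 1)) (pair_norm (s - 2) (s - 1)) (stokes_S a)) \<and>
     (\<forall>f \<in> vecs smooth0. \<forall>g \<in> smooth0.
        (\<exists>up \<in> vecs smooth0 \<times> smooth0. stokes_S a up = (f, g)) \<and>
        (\<forall>s. \<forall>u \<in> vecs (sobolev0 s). \<forall>p \<in> sobolev0 (s - 1). stokes_S a (u, p) = (f, g) \<longrightarrow>
           u \<in> vecs smooth0 \<and> p \<in> smooth0))"
  proof (intro conjI allI ballI impI)
    show "?C > 0"
      by (rule pos)
    show "invertible (symbol a \<xi>)" if "\<xi> \<noteq> 0" for \<xi>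
      by (rule invertible_symbol[OF sym ell C\<^sub>A that])
    show "top_iso_on (vecs (sobolev0 s) \<times> sobolev0 (s - 1)) (pair_norm s (s - 1))
         (vecs (sobolev0 (s - 2)) \<times> sobolev0 (s - 1)) (pair_norm (s - 2) (s - 1)) (stokes_S a)" for s
      by (rule top_iso_stokes_S[OF stokes])
  next
    fix s and f :: "'n pdistr ^ 'n" and g :: "'n pdistr"
    assume fg: "f \<in> vecs (sobolev0 (s - 2))" "g \<in> sobolev0 (s - 1)"
    show "\<exists>!up. up \<in> vecs (sobolev0 s) \<times> sobolev0 (s - 1) \<and> stokes_S a up = (f, g)"
      by (rule solvable[OF fg])
    fix u :: "'n pdistr ^ 'n" and p :: "'n pdistr"
    assume up: "u \<in> vecs (sobolev0 s)" "p \<in> sobolev0 (s - 1)" and S: "stokes_S a (u, p) = (f, g)"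
    show "sobolev_series s (fourier (u $ k)) (UNIV - {0}) (u $ k)" for k
      using up(1) by (intro sobolev_series_fourier) (simp add: vecs_def)
    show "sobolev_series (s - 1) (fourier p) (UNIV - {0}) p"
      by (rule sobolev_series_fourier[OF up(2)])
    show "fourier_pair (u, p) \<xi> = matrix_inv (symbol a \<xi>) *v fourier_pair (f, g) \<xi>" if "\<xi> \<noteq> 0" for \<xi>
      using fourier_pair_solution[OF stokes that, of "(u, p)"] by (simp add: S)
    show "vec_sobolev_norm s u + sobolev_norm (s - 1) p
        \<le> ?C * (vec_sobolev_norm (s - 2) f + sobolev_norm (s - 1) g)"
      by (rule estimate[OF fg zero[OF up] S])
    show "(\<forall>k. real_valued (f $ k)) \<and> real_valued g \<longleftrightarrow> (\<forall>k. real_valued (u $ k)) \<and> real_valued p"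
      by (rule real_valued_solution_iff[OF stokes zero[OF up] S])
  next
    fix f :: "'n pdistr ^ 'n" and g :: "'n pdistr"
    assume fg: "f \<in> vecs smooth0" "g \<in> smooth0"
    then have sob: "f \<in> vecs (sobolev0 s)" "g \<in> sobolev0 s" for s
      by (auto simp: vecs_def smooth0_def sobolev0_def range_of_test_eq_sobolev)
    \<comment> \<open>A solution is taken at the arbitrary level \<open>s = 0\<close>;
      \<open>smooth\<close> then raises its regularity to all levels.\<close>
    obtain u p where up: "u \<in> vecs (sobolev0 0)" "p \<in> sobolev0 (0 - 1)" "stokes_S a (u, p) = (f, g)"
      using ex1_implies_ex[OF solvable[OF sob, of 0]] by (elim exE conjE SigmaE) simp
    have "stokes_S a (u, p) \<in> vecs smooth0 \<times> smooth0"
      using fg by (simp add: up(3))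
    then have "(u, p) \<in> vecs smooth0 \<times> smooth0"
      by (rule smooth[OF _ zero[OF up(1,2)]])
    then show "\<exists>up \<in> vecs smooth0 \<times> smooth0. stokes_S a up = (f, g)"
      using up(3) by (rule bexI[rotated])
  next
    fix f u :: "'n pdistr ^ 'n" and g p :: "'n pdistr" and s
    assume fg: "f \<in> vecs smooth0" "g \<in> smooth0"
      and up: "u \<in> vecs (sobolev0 s)" "p \<in> sobolev0 (s - 1)" and S: "stokes_S a (u, p) = (f, g)"
    have "stokes_S a (u, p) \<in> vecs smooth0 \<times> smooth0"
      using fg by (simp add: S)
    then have "(u, p) \<in> vecs smooth0 \<times> smooth0"
      by (rule smooth[OF _ zero[OF up]])
    then show "u \<in> vecs smooth0" "p \<in> smooth0"
      by auto
  qed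
qed

end
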